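(* For every $(\tau,\sigma)\in J:=J_1\cup J_2\cup J_3$ there exists a unique $u_\theta=(u_\theta)_{\tau,\sigma}$, smooth on $\mathbb{S}^2\setminus\{S\}$ (i.e. the corresponding vector field $u$ is in $C^\infty(\mathbb{S}^2\setminus\{S\})$), such that the corresponding pair $(u,p)$ satisfies the stationary Navier-Stokes equations on $\mathbb{S}^2\setminus\{S\}$ and $$\lim_{\theta\to\pi^-}u_\theta\sin\theta=\tau,\qquad \lim_{\theta\to0^+}\frac{u_\theta}{\sin\theta}=\sigma .$$ Moreover, these are all the $(-1)$-homogeneous axisymmetric no-swirl solutions of the stationary Navier-Stokes equations in $C^2(\mathbb{S}^2\setminus\{S\})$. The solutions are explicitly given, with $b:=|1-\frac{\tau}{2}|$, by $$u_\theta=\begin{cases}\dfrac{1-\cos\theta}{\sin\theta}\left(1-b-\dfrac{2b(1-2\sigma-b)}{(1-2\sigma+b)\left(\frac{1+\cos\theta}{2}\right)^{-b}+2\sigma-1+b}\right), & (\tau,\sigma)\in J_1,\\[3mm] \dfrac{1-\cos\theta}{\sin\theta}\left(1+\dfrac{2(1-2\sigma)}{(1-2\sigma)\ln\frac{1+\cos\theta}{2}-2}\right), & (\tau,\sigma)\in J_2,\\[3mm] \dfrac{(1+b)(1-\cos\theta)}{\sin\theta}, & (\tau,\sigma)\in J_3.\end{cases}$$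
   Context: The stationary incompressible Navier-Stokes equations in $\mathbb{R}^3$ are $-\Delta u+u\cdot\nabla u+\nabla p=0$, $\operatorname{div}u=0$. Spherical coordinates $(r,\theta,\phi)$: $r$ is the distance to the origin, $\theta$ the angle with the positive $x_3$-axis, $\phi$ the meridian angle; a vector field is written $u=u_re_r+u_\theta e_\theta+u_\phi e_\phi$ in the usual orthonormal frame. It is axisymmetric if $u_r,u_\theta,u_\phi$ depend only on $(r,\theta)$, and no-swirl if $u_\phi=0$. $S=(0,0,-1)$ is the south pole of $\mathbb{S}^2$. Throughout $u$ is $(-1)$-homogeneous and $p$ is $(-2)$-homogeneous. A pair $(u,p)$ given on $\mathbb{S}^2\setminus\{S\}$ is extended by homogeneity to $\mathbb{R}^3\setminus\{(0,0,x_3):x_3\le0\}$, and "satisfies the Navier-Stokes equations on $\mathbb{S}^2\setminus\{S\}$" means that the extension satisfies them there. $u\in C^k(\mathbb{S}^2\setminus\{S\})$ refers to regularity of the vector field $u$ restricted to $\mathbb{S}^2\setminus\{S\}$. For axisymmetric no-swirl $(u,p)$, the pair $(u,p)$ corresponding to $u_\theta=u_\theta(\theta)$ is obtained on $\mathbb{S}^2$ by $u_\phi=0$, $u_r=-\frac{du_\theta}{d\theta}-\cot\theta\,u_\theta$ (divergence-free condition), and $p$ determined by $\frac{d^2u_r}{d\theta^2}+(\cot\theta-u_\theta)\frac{du_r}{d\theta}+u_r^2+u_\theta^2+2p=0$, and then extended by homogeneity. Parameter sets: $J_1=\{(\tau,\sigma):\tau<2,\ \sigma<\frac14(4-\tau)\}$,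 $J_2=\{(\tau,\sigma):\tau=2,\ \sigma<\frac12\}$, $J_3=\{(\tau,\sigma):\tau\ge2,\ \sigma=\frac{\tau}{4}\}$. *)

theory Defs
  imports "HOL-Analysis.Analysis"
begin

section \<open>Regularity\<close>

primrec Ck_on :: "nat \<Rightarrow> ('a::real_normed_vector \<Rightarrow> 'b::real_normed_vector) \<Rightarrow> 'a set \<Rightarrow> bool" where
  "Ck_on 0 f U \<longleftrightarrow> continuous_on U f"
| "Ck_on (Suc k) f U \<longleftrightarrow>
     (\<forall>x\<in>U. f differentiable (at x)) \<and> (\<forall>v. Ck_on k (\<lambda>x. frechet_derivative f (at x) v) U)"

text \<open>
  \<^const>\<open>Ck_on\<close> is meant for open sets. A function on an arbitrary subset of the space, such as
  a punctured sphere, is of class \<open>C\<^sup>k\<close> if near each point of the subset it is the restriction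
  of a \<open>C\<^sup>k\<close> function on an open set. On an embedded submanifold this is the usual notion. Only
  the values of \<open>f\<close> on \<open>A\<close> matter.
\<close>

definition Ck_on_subset :: "nat \<Rightarrow> ('a::real_normed_vector \<Rightarrow> 'b::real_normed_vector) \<Rightarrow> 'a set \<Rightarrow> bool"
  where "Ck_on_subset k f A \<longleftrightarrow>
    (\<forall>x\<in>A. \<exists>V g. open V \<and> x \<in> V \<and> Ck_on k g V \<and> (\<forall>y\<in>V \<inter> A. g y = f y))"

definition smooth_on_subset :: "('a::real_normed_vector \<Rightarrow> 'b::real_normed_vector) \<Rightarrow> 'a set \<Rightarrow> bool"
  where "smooth_on_subset f A \<longleftrightarrow> (\<forall>k. Ck_on_subset k f A)"

section \<open>The stationary Navier-Stokes equations in three dimensions\<close>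

definition partial_deriv :: "3 \<Rightarrow> (real^3 \<Rightarrow> 'b::real_normed_vector) \<Rightarrow> real^3 \<Rightarrow> 'b"
  where "partial_deriv i f x = frechet_derivative f (at x) (axis i 1)"

definition laplacian :: "(real^3 \<Rightarrow> 'b::real_normed_vector) \<Rightarrow> real^3 \<Rightarrow> 'b"
  where "laplacian f x = (\<Sum>i\<in>UNIV. partial_deriv i (partial_deriv i f) x)"

definition gradient :: "(real^3 \<Rightarrow> real) \<Rightarrow> real^3 \<Rightarrow> real^3"
  where "gradient p x = (\<chi> i. partial_deriv i p x)"

definition divergence :: "(real^3 \<Rightarrow> real^3) \<Rightarrow> real^3 \<Rightarrow> real"
  where "divergence u x = (\<Sum>i\<in>UNIV. partial_deriv i u x $ i)"

definition convection :: "(real^3 \<Rightarrow> real^3) \<Rightarrow> real^3 \<Rightarrow> real^3"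
  where "convection u x = (\<Sum>i\<in>UNIV. (u x $ i) *\<^sub>R partial_deriv i u x)"

text \<open>
  Classical solutions on an open set \<open>D\<close>. The differentiability clauses ensure that every
  derivative in the equations exists; they impose no continuity of the highest derivatives.
\<close>

definition navier_stokes_on :: "(real^3) set \<Rightarrow> (real^3 \<Rightarrow> real^3) \<Rightarrow> (real^3 \<Rightarrow> real) \<Rightarrow> bool"
  where "navier_stokes_on D u p \<longleftrightarrow>
    (\<forall>x\<in>D. u differentiable (at x) \<and> (\<forall>i. partial_deriv i u differentiable (at x)) \<and>
           p differentiable (at x)) \<and>
    (\<forall>x\<in>D. - laplacian u x + convection u x + gradient p x = 0 \<and> divergence u x = 0)"

section \<open>The punctured sphere, its cone and spherical coordinates\<close>

definition south_pole :: "real^3"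
  where "south_pole = vector [0, 0, -1]"

definition punctured_sphere :: "(real^3) set"
  where "punctured_sphere = sphere 0 1 - {south_pole}"

definition slit_space :: "(real^3) set"
  where "slit_space = UNIV - {x. x $ 1 = 0 \<and> x $ 2 = 0 \<and> x $ 3 \<le> 0}"

definition e_r :: "real \<Rightarrow> real \<Rightarrow> real^3"
  where "e_r \<theta> \<phi> = vector [sin \<theta> * cos \<phi>, sin \<theta> * sin \<phi>, cos \<theta>]"

definition e_theta :: "real \<Rightarrow> real \<Rightarrow> real^3"
  where "e_theta \<theta> \<phi> = vector [cos \<theta> * cos \<phi>, cos \<theta> * sin \<phi>, - sin \<theta>]"

definition e_phi :: "real \<Rightarrow> real \<Rightarrow> real^3"
  where "e_phi \<theta> \<phi> = vector [- sin \<phi>, cos \<phi>, 0]"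

definition spherical_point :: "real \<Rightarrow> real \<Rightarrow> real \<Rightarrow> real^3"
  where "spherical_point r \<theta> \<phi> = r *\<^sub>R e_r \<theta> \<phi>"

definition homogeneous_on :: "(real^3) set \<Rightarrow> int \<Rightarrow> (real^3 \<Rightarrow> 'b::real_normed_vector) \<Rightarrow> bool"
  where "homogeneous_on D d f \<longleftrightarrow> (\<forall>x\<in>D. \<forall>c>0. f (c *\<^sub>R x) = (c powi d) *\<^sub>R f x)"

text \<open>
  The spherical frame is undefined on the axis, so the components are only considered for
  \<open>0 < \<theta> < \<pi>\<close>. On the positive \<open>x\<^sub>3\<close>-axis all fields below are determined by continuity.
\<close>

definition axisymmetric :: "(real^3 \<Rightarrow> real^3) \<Rightarrow> bool"
  where "axisymmetric u \<longleftrightarrow> (\<forall>r>0. \<forall>\<theta>\<in>{0<..<pi}. \<forall>\<phi> \<psi>.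
    u (spherical_point r \<theta> \<phi>) \<bullet> e_r \<theta> \<phi> = u (spherical_point r \<theta> \<psi>) \<bullet> e_r \<theta> \<psi> \<and>
    u (spherical_point r \<theta> \<phi>) \<bullet> e_theta \<theta> \<phi> = u (spherical_point r \<theta> \<psi>) \<bullet> e_theta \<theta> \<psi> \<and>
    u (spherical_point r \<theta> \<phi>) \<bullet> e_phi \<theta> \<phi> = u (spherical_point r \<theta> \<psi>) \<bullet> e_phi \<theta> \<psi>)"

definition no_swirl :: "(real^3 \<Rightarrow> real^3) \<Rightarrow> bool"
  where "no_swirl u \<longleftrightarrow>
    (\<forall>r>0. \<forall>\<theta>\<in>{0<..<pi}. \<forall>\<phi>. u (spherical_point r \<theta> \<phi>) \<bullet> e_phi \<theta> \<phi> = 0)"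

section \<open>The pair corresponding to a polar component\<close>

definition radial_component :: "(real \<Rightarrow> real) \<Rightarrow> real \<Rightarrow> real"
  where "radial_component v \<theta> = - deriv v \<theta> - cot \<theta> * v \<theta>"

text \<open>The pressure on the sphere, solved from
  \<open>u\<^sub>r'' + (cot \<theta> - u\<^sub>\<theta>) u\<^sub>r' + u\<^sub>r\<^sup>2 + u\<^sub>\<theta>\<^sup>2 + 2p = 0\<close>.\<close>

definition pressure_profile :: "(real \<Rightarrow> real) \<Rightarrow> real \<Rightarrow> real"
  where "pressure_profile v \<theta> =
    - (deriv (deriv (radial_component v)) \<theta> + (cot \<theta> - v \<theta>) * deriv (radial_component v) \<theta>
       + (radial_component v \<theta>)\<^sup>2 + (v \<theta>)\<^sup>2) / 2"

text \<open>
  \<open>(u, p)\<close> is the pair on the slit space corresponding to \<open>u\<^sub>\<theta> = v\<close>. The last clause gives the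
  values on the unit sphere off the axis, homogeneity extends them to the slit space off the axis,
  and continuity determines them on the positive \<open>x\<^sub>3\<close>-axis. Hence \<open>v\<close>, through its values on
  \<open>(0, \<pi>)\<close>, determines \<open>u\<close> and \<open>p\<close> on the slit space.
\<close>

definition corresponding_pair :: "(real \<Rightarrow> real) \<Rightarrow> (real^3 \<Rightarrow> real^3) \<Rightarrow> (real^3 \<Rightarrow> real) \<Rightarrow> bool"
  where "corresponding_pair v u p \<longleftrightarrow>
    homogeneous_on slit_space (-1) u \<and> homogeneous_on slit_space (-2) p \<and>
    continuous_on slit_space u \<and> continuous_on slit_space p \<and>
    (\<forall>\<theta>\<in>{0<..<pi}. \<forall>\<phi>.
       u (spherical_point 1 \<theta> \<phi>) = radial_component v \<theta> *\<^sub>R e_r \<theta> \<phi> + v \<theta> *\<^sub>R e_theta \<theta> \<phi> \<and>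
       p (spherical_point 1 \<theta> \<phi>) = pressure_profile v \<theta>)"

definition is_solution_profile :: "real \<Rightarrow> real \<Rightarrow> (real \<Rightarrow> real) \<Rightarrow> bool"
  where "is_solution_profile \<tau> \<sigma> v \<longleftrightarrow>
    (\<exists>u p. corresponding_pair v u p \<and> smooth_on_subset u punctured_sphere \<and>
           navier_stokes_on slit_space u p) \<and>
    ((\<lambda>\<theta>. v \<theta> * sin \<theta>) \<longlongrightarrow> \<tau>) (at_left pi) \<and>
    ((\<lambda>\<theta>. v \<theta> / sin \<theta>) \<longlongrightarrow> \<sigma>) (at_right 0)"

definition homogeneous_axisymmetric_noswirl_C2_solution ::
    "(real^3 \<Rightarrow> real^3) \<Rightarrow> (real^3 \<Rightarrow> real) \<Rightarrow> bool"
  where "homogeneous_axisymmetric_noswirl_C2_solution u p \<longleftrightarrow>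
    homogeneous_on slit_space (-1) u \<and> homogeneous_on slit_space (-2) p \<and>
    axisymmetric u \<and> no_swirl u \<and>
    Ck_on_subset 2 u punctured_sphere \<and> navier_stokes_on slit_space u p"

section \<open>Parameters and explicit formulas\<close>

definition J1 :: "(real \<times> real) set"
  where "J1 = {(\<tau>, \<sigma>). \<tau> < 2 \<and> \<sigma> < (4 - \<tau>) / 4}"

definition J2 :: "(real \<times> real) set"
  where "J2 = {(\<tau>, \<sigma>). \<tau> = 2 \<and> \<sigma> < 1 / 2}"

definition J3 :: "(real \<times> real) set"
  where "J3 = {(\<tau>, \<sigma>). \<tau> \<ge> 2 \<and> \<sigma> = \<tau> / 4}"

definition explicit_profile :: "real \<Rightarrow> real \<Rightarrow> real \<Rightarrow> real"
  where "explicit_profile \<tau> \<sigma> \<theta> =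
    (let b = \<bar>1 - \<tau> / 2\<bar> in
     if (\<tau>, \<sigma>) \<in> J1 then
       (1 - cos \<theta>) / sin \<theta> *
       (1 - b - 2 * b * (1 - 2 * \<sigma> - b) /
          ((1 - 2 * \<sigma> + b) * ((1 + cos \<theta>) / 2) powr (- b) + 2 * \<sigma> - 1 + b))
     else if (\<tau>, \<sigma>) \<in> J2 then
       (1 - cos \<theta>) / sin \<theta> *
       (1 + 2 * (1 - 2 * \<sigma>) / ((1 - 2 * \<sigma>) * ln ((1 + cos \<theta>) / 2) - 2))
     else (1 + b) * (1 - cos \<theta>) / sin \<theta>)"

end

theory Submission
  imports Defs
begin

text \<open>
  Write \<open>q = cos \<theta>\<close>, \<open>R = |x|\<close> and \<open>u\<^sub>\<theta> = G(q) sin \<theta>\<close> on the unit sphere. A homogeneous axisymmetric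
  field without swirl is \<open>u = A(q) x / R\<^sup>2 - G(q) e\<^sub>3 / R\<close>, and the Navier-Stokes equations become ordinary
  differential equations for \<open>A\<close>, \<open>G\<close> and the pressure profile. Differentiability at the north
  pole fixes the constants of integration up to one, which leaves the autonomous Riccati equation
  \<open>(1 + q) W' = c + W - W\<^sup>2 / 2\<close> for \<open>W = (1 + q) G\<close>. In the variable \<open>ln ((1 + q) / 2)\<close> it is
  linearized by \<open>W = 1 + 2 \<psi>' / \<psi>\<close> with \<open>\<psi>'' = (1 + 2c) \<psi> / 4\<close>. A solution lives on all of
  \<open>-1 < q < 1\<close> only if \<open>\<psi>\<close> has no zero on the negative half-line, and this condition is exactly
  the description of the parameter sets. Conversely, the Riccati equation expresses every
  derivative of \<open>W\<close> through \<open>W\<close>, so that it yields both smoothness and the equations.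
\<close>

section \<open>Homogeneous functions of the polar angle\<close>

text \<open>The spherical frame is singular on the axis, while \<open>x\<close> and
  \<open>e_3\<close> are not: functions \<open>A\<close> and \<open>G\<close> that are regular at q
  = 1 give a field regular across the north pole. A given solution is only twice differentiable, so
  a third derivative of \<open>G\<close> is not at hand, and at the pole one first derivative of the
  field yields just the limits of \<open>A\<close> and \<open>G\<close>. Hence the equations are
  integrated on the open interval and the constants are found from these limits alone. The equation
  for \<open>W\<close> is equidimensional in 1 + q, which is why a logarithm makes it autonomous; s
  = 0 is the north pole and s = -\<infinity> the slit. Put 1 + 2c = b^2. For b > 0, \<psi> combines
  exp(b s / 2) and exp(-b s / 2). The second dominates near the slit, so W tends to 1 - b there,
  unless its coefficient is zero and W is the constant 1 + b. With \<sigma> = W(1) / 2 and \<tau> =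
  2 W(-1), a positive coefficient is the bound on \<sigma> in \<open>J1\<close>, a negative one
  gives \<psi> a zero. The case b = 0 leads to \<open>J2\<close>, and the constants W = 1 + b, b = 0
  included, to \<open>J3\<close>.\<close>

definition cos_polar :: "real^3 \<Rightarrow> real"
  where "cos_polar x = x $ 3 / norm x"

text \<open>An axisymmetric scalar of homogeneity -k. Its gradient is a combination of
  \<open>x\<close> and \<open>e_3\<close> with coefficients of the same kind, so differentiation
  becomes bookkeeping in \<open>k\<close> and the profile.\<close>

definition hom_lift :: "nat \<Rightarrow> (real \<Rightarrow> real) \<Rightarrow> real^3 \<Rightarrow> real"
  where "hom_lift k F x = F (cos_polar x) / norm x ^ k"

lemma partial_deriv_eq:
  assumes "(f has_derivative f') (at x)"
  shows "partial_deriv i f x = f' (axis i 1)"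
  unfolding partial_deriv_def using frechet_derivative_at[OF assms] by simp

lemma partial_deriv_cong:
  assumes "open D" "x \<in> D" "\<And>y. y \<in> D \<Longrightarrow> f y = g y"
  shows "partial_deriv i f x = partial_deriv i g x"
proof -
  have "(f has_derivative f') (at x) \<longleftrightarrow> (g has_derivative f') (at x)" for f'
    using assms has_derivative_transform_within_open[of f f' x UNIV D g]
      has_derivative_transform_within_open[of g f' x UNIV D f] by auto
  then show ?thesis
    unfolding partial_deriv_def frechet_derivative_def by simp
qed

lemma differentiable_cong_open:
  assumes "open D" "x \<in> D" "\<And>y. y \<in> D \<Longrightarrow> f y = g y" "f differentiable (at x)"
  shows "g differentiable (at x)"
  using assms has_derivative_transform_within_open[of f _ x UNIV D g]
  unfolding differentiable_def by blast

lemma norm_has_derivative: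
  fixes x :: "real^3"
  assumes "x \<noteq> 0"
  shows "(norm has_derivative (\<lambda>h. (x \<bullet> h) / norm x)) (at x)"
  using has_derivative_norm[OF assms] by (rule has_derivative_eq_rhs) (auto simp: sgn_div_norm divide_inverse mult.commute inner_commute)

lemma vec_nth_has_derivative:
  fixes x :: "real^'n"
  shows "((\<lambda>x. x $ i) has_derivative (\<lambda>h. h $ i)) (at x)"
  by (rule bounded_linear_imp_has_derivative, rule bounded_linear_vec_nth)

lemma cos_polar_has_derivative:
  assumes "x \<noteq> 0"
  shows "(cos_polar has_derivative (\<lambda>h. h $ 3 / norm x - cos_polar x * (x \<bullet> h) / (norm x)\<^sup>2)) (at x)"
  unfolding cos_polar_def[abs_def]
  apply (rule has_derivative_eq_rhs)
  apply (rule has_derivative_divide[OF vec_nth_has_derivative norm_has_derivative[OF assms]])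
  using assms apply simp
  using assms apply (auto simp: fun_eq_iff field_simps power2_eq_square)
  done

lemma hom_lift_has_derivative:
  assumes "x \<noteq> 0" "(F has_real_derivative F') (at (cos_polar x))"
  shows "(hom_lift k F has_derivative
     (\<lambda>h. F' * (h $ 3) / norm x ^ (k+1)
         - (real k * F (cos_polar x) + cos_polar x * F') * (x \<bullet> h) / norm x ^ (k+2))) (at x)"
proof -
  have 1: "((\<lambda>x. F (cos_polar x)) has_derivative
     (\<lambda>h. F' * (h $ 3 / norm x - cos_polar x * (x \<bullet> h) / (norm x)\<^sup>2))) (at x)"
    using has_derivative_compose[OF cos_polar_has_derivative[OF assms(1)], of F "\<lambda>h. F' * h"] assms(2)
    by (simp add: has_field_derivative_def)
  have 2: "((\<lambda>x::real^3. norm x ^ k) has_derivative (\<lambda>h. real k * norm x ^ (k-1) * ((x \<bullet> h) / norm x))) (at x)"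
    using has_derivative_power[OF norm_has_derivative[OF assms(1)], of k]
    by (rule has_derivative_eq_rhs) (auto simp: mult_ac)
  show ?thesis unfolding hom_lift_def[abs_def]
    apply (rule has_derivative_eq_rhs)
     apply (rule has_derivative_divide[OF 1 2])
    using assms(1) apply simp
    using assms(1) by (cases k) (auto simp: fun_eq_iff field_simps power2_eq_square)
qed

lemma partial_deriv_hom_lift:
  assumes "x \<noteq> 0" "(F has_real_derivative F' (cos_polar x)) (at (cos_polar x))"
  shows "partial_deriv i (hom_lift k F) x =
     hom_lift (k+1) F' x * axis i 1 $ 3 - hom_lift (k+2) (\<lambda>t. real k * F t + t * F' t) x * x $ i"
  using partial_deriv_eq[OF hom_lift_has_derivative[OF assms, of k], of i]
  by (simp add: hom_lift_def inner_axis)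

lemma norm_sq_3: "(norm (x::real^3))\<^sup>2 = (x$1)\<^sup>2 + (x$2)\<^sup>2 + (x$3)\<^sup>2"
  by (simp add: norm_vec_def L2_set_def sum_3)

text \<open>The profile is differentiated only at cosines that occur in \<open>D\<close>: off the
  axis these fill (-1, 1), on \<open>slit_space\<close> they include 1, where the derivative is
  two-sided. Continuity of \<open>F2\<close> is not asked for, since \<open>navier_stokes_on\<close>
  does not provide it.\<close>

locale hom_lift_C2 =
  fixes D :: "(real^3) set" and F F1 F2 :: "real \<Rightarrow> real"
  assumes openD: "open D"
    and nonzero: "x \<in> D \<Longrightarrow> x \<noteq> 0"
    and F: "x \<in> D \<Longrightarrow> (F has_real_derivative F1 (cos_polar x)) (at (cos_polar x))"
    and F1: "x \<in> D \<Longrightarrow> (F1 has_real_derivative F2 (cos_polar x)) (at (cos_polar x))"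
begin

abbreviation "H k t \<equiv> real k * F t + t * F1 t"

lemma partial:
  assumes "x \<in> D"
  shows "partial_deriv i (hom_lift k F) x = hom_lift (k+1) F1 x * axis i 1 $ 3 - hom_lift (k+2) (H k) x * x $ i"
  using partial_deriv_hom_lift[OF nonzero[OF assms], of F F1] F[OF assms] by simp

lemma differentiable: "x \<in> D \<Longrightarrow> hom_lift k F differentiable (at x)"
  using hom_lift_has_derivative[OF nonzero F] unfolding differentiable_def by blast

lemma H_deriv:
  assumes "x \<in> D"
  shows "(H k has_real_derivative ((real k + 1) * F1 (cos_polar x) + cos_polar x * F2 (cos_polar x))) (at (cos_polar x))"
  by (rule derivative_eq_intros F F1 assms refl | simp add: algebra_simps)+

lemma second_has_derivative:
  assumes "x \<in> D"
  shows "(partial_deriv i (hom_lift k F) has_derivative (\<lambda>h.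
     (F2 (cos_polar x) * (h $ 3) / norm x ^ (k+2)
         - (real (k+1) * F1 (cos_polar x) + cos_polar x * F2 (cos_polar x)) * (x \<bullet> h) / norm x ^ (k+3)) * axis i 1 $ 3
     - (((real k + 1) * F1 (cos_polar x) + cos_polar x * F2 (cos_polar x)) * (h $ 3) / norm x ^ (k+3)
         - (real (k+2) * H k (cos_polar x) + cos_polar x * ((real k + 1) * F1 (cos_polar x) + cos_polar x * F2 (cos_polar x))) * (x \<bullet> h) / norm x ^ (k+4)) * x $ i
     - hom_lift (k+2) (H k) x * h $ i)) (at x)"
proof -
  have "((\<lambda>x. hom_lift (k+1) F1 x * axis i 1 $ 3 - hom_lift (k+2) (H k) x * x $ i) has_derivative (\<lambda>h.
     (F2 (cos_polar x) * (h $ 3) / norm x ^ (k+2)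
         - (real (k+1) * F1 (cos_polar x) + cos_polar x * F2 (cos_polar x)) * (x \<bullet> h) / norm x ^ (k+3)) * axis i 1 $ 3
     - (((real k + 1) * F1 (cos_polar x) + cos_polar x * F2 (cos_polar x)) * (h $ 3) / norm x ^ (k+3)
         - (real (k+2) * H k (cos_polar x) + cos_polar x * ((real k + 1) * F1 (cos_polar x) + cos_polar x * F2 (cos_polar x))) * (x \<bullet> h) / norm x ^ (k+4)) * x $ i
     - hom_lift (k+2) (H k) x * h $ i)) (at x)"
    apply (rule has_derivative_eq_rhs)
     apply (rule has_derivative_diff)
      apply (rule has_derivative_mult_left)
      apply (rule hom_lift_has_derivative[OF nonzero[OF assms] F1[OF assms], of "k+1"])
     apply (rule has_derivative_mult[OF _ vec_nth_has_derivative])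
     apply (rule hom_lift_has_derivative[OF nonzero[OF assms] H_deriv[OF assms], of "k+2"])
    apply (auto simp: fun_eq_iff algebra_simps numeral_eq_Suc)
    done
  then show ?thesis
    by (rule has_derivative_transform_within_open[OF _ openD assms]) (simp add: partial)
qed

lemma second_differentiable: "x \<in> D \<Longrightarrow> partial_deriv i (hom_lift k F) differentiable (at x)"
  using second_has_derivative unfolding differentiable_def by blast

text \<open>The sphere contributes the Legendre operator, the radial factor r^(-k) the number k (k +
  1) - 2 k = k (k - 1). Coordinates enter only through x_3 = q r and the sum of their
  squares.\<close>

lemma laplacian:
  assumes x: "x \<in> D"
  shows "laplacian (hom_lift k F) x =
    hom_lift (k+2) (\<lambda>t. (1 - t\<^sup>2) * F2 t - 2 * t * F1 t + real k * (real k - 1) * F t) x"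
proof -
  have n: "norm x \<noteq> 0" using nonzero[OF x] by simp
  define q where "q = cos_polar x"
  define r where "r = norm x"
  have r: "r \<noteq> 0" using n r_def by simp
  have x3: "x$3 = q * r" using n by (simp add: q_def r_def cos_polar_def)
  have sq: "x$1 * x$1 + x$2 * x$2 + x$3 * x$3 = r\<^sup>2"
    using norm_sq_3[of x] by (simp add: r_def power2_eq_square)
  have ia: "x \<bullet> axis i 1 = x $ i" for i by (simp add: inner_axis)
  have ax: "axis i (1::real) $ j = (if i = j then 1 else 0)" for i j :: 3 by (simp add: axis_def)
  define K where "K = (real k + 1) * F1 q + q * F2 q"
  define h where "h = H k q"
  have "laplacian (hom_lift k F) x = F2 q / r ^ (k+2) - 2 * K * x$3 / r ^ (k+3)
      + ((real k + 2) * h + q * K) * (x$1 * x$1 + x$2 * x$2 + x$3 * x$3) / r ^ (k+4) - 3 * h / r ^ (k+2)"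
    unfolding laplacian_def partial_deriv_eq[OF second_has_derivative[OF x]] hom_lift_def sum_3
    unfolding q_def[symmetric] r_def[symmetric] of_nat_add of_nat_1 of_nat_numeral
      K_def[symmetric] h_def[symmetric]
    by (simp add: ia ax algebra_simps add_divide_distrib diff_divide_distrib)
  also have "\<dots> = (F2 q - 2 * K * q + ((real k + 2) * h + q * K) - 3 * h) / r ^ (k+2)"
    unfolding sq unfolding x3 using r by (simp add: field_simps power_add power2_eq_square power3_eq_cube power4_eq_xxxx)
  also have "\<dots> = hom_lift (k+2) (\<lambda>t. (1 - t\<^sup>2) * F2 t - 2 * t * F1 t + real k * (real k - 1) * F t) x"
    unfolding hom_lift_def by (fold q_def r_def) (simp add: K_def h_def algebra_simps power2_eq_square)
  finally show ?thesis .
qed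

end

section \<open>The Navier-Stokes operator on conical fields\<close>

lemma has_derivative_partial:
  assumes "f differentiable (at x)"
  shows "(f has_derivative frechet_derivative f (at x)) (at x)"
    and "frechet_derivative f (at x) (axis i 1) = partial_deriv i f x"
  using assms by (auto simp: partial_deriv_def frechet_derivative_works)

lemma affine_field_has_derivative:
  fixes a g :: "real^3 \<Rightarrow> real"
  assumes "a differentiable (at x)" "g differentiable (at x)"
  shows "((\<lambda>x. a x *\<^sub>R x - g x *\<^sub>R e) has_derivative
    (\<lambda>h. frechet_derivative a (at x) h *\<^sub>R x + a x *\<^sub>R h - frechet_derivative g (at x) h *\<^sub>R e)) (at x)"
  by (rule has_derivative_eq_rhs, (rule has_derivative_diff has_derivative_scaleR has_derivative_partial(1)[OF assms(1)]
   has_derivative_partial(1)[OF assms(2)] has_derivative_ident has_derivative_const)+) (simp add: add.commute)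

lemma affine_field_partial_has_derivative:
  fixes a g :: "real^3 \<Rightarrow> real"
  assumes "a differentiable (at x)" "partial_deriv i a differentiable (at x)" "partial_deriv i g differentiable (at x)"
  shows "((\<lambda>x. partial_deriv i a x *\<^sub>R x + a x *\<^sub>R c - partial_deriv i g x *\<^sub>R e) has_derivative
    (\<lambda>h. frechet_derivative (partial_deriv i a) (at x) h *\<^sub>R x + partial_deriv i a x *\<^sub>R h
       + frechet_derivative a (at x) h *\<^sub>R c - frechet_derivative (partial_deriv i g) (at x) h *\<^sub>R e)) (at x)"
  by (rule has_derivative_eq_rhs, (rule has_derivative_diff has_derivative_add has_derivative_scaleR
     has_derivative_partial(1)[OF assms(1)] has_derivative_partial(1)[OF assms(2)]
   has_derivative_partial(1)[OF assms(3)] has_derivative_ident has_derivative_const)+) (simp add: add_ac)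

lemma sum_axis_vec: "(\<Sum>i\<in>UNIV. f i *\<^sub>R axis i (1::real)) = (\<chi> i. f i)"
  for f :: "3 \<Rightarrow> real"
  by (simp add: vec_eq_iff sum_3 axis_def forall_3)

text \<open>In the spherical frame the field of this locale has \<open>u\<^sub>\<theta> = G(cos \<theta>) sin \<theta> / R\<close> and
  \<open>u\<^sub>r = (A - cos \<theta> G)(cos \<theta>) / R\<close>. The two residuals below are the coefficients of \<open>x\<close> and
  \<open>e\<^sub>3\<close> in the momentum equation; these vectors are parallel on the axis.\<close>

locale conical_flow =
  A: hom_lift_C2 D A A1 A2 + G: hom_lift_C2 D G G1 G2
  for D A A1 A2 G G1 G2 +
  fixes P P1 :: "real \<Rightarrow> real" and u :: "real^3 \<Rightarrow> real^3" and p :: "real^3 \<Rightarrow> real"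
  assumes P: "x \<in> D \<Longrightarrow> (P has_real_derivative P1 (cos_polar x)) (at (cos_polar x))"
    and u: "x \<in> D \<Longrightarrow> u x = hom_lift 2 A x *\<^sub>R x - hom_lift 1 G x *\<^sub>R axis 3 1"
    and p: "x \<in> D \<Longrightarrow> p x = hom_lift 2 P x"
begin

abbreviation "a \<equiv> hom_lift 2 A"
abbreviation "g \<equiv> hom_lift 1 G"

lemmas openD = A.openD and nz = A.nonzero

lemma u_has_derivative:
  assumes x: "x \<in> D"
  shows "(u has_derivative (\<lambda>h. frechet_derivative a (at x) h *\<^sub>R x + a x *\<^sub>R h
           - frechet_derivative g (at x) h *\<^sub>R axis 3 1)) (at x)"
  by (rule has_derivative_transform_within_open[OF
     affine_field_has_derivative[OF A.differentiable[OF x] G.differentiable[OF x]] openD x]) (simp add: u)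

lemma partial_u:
  assumes x: "x \<in> D"
  shows "partial_deriv i u x = partial_deriv i a x *\<^sub>R x + a x *\<^sub>R axis i 1 - partial_deriv i g x *\<^sub>R axis 3 1"
  unfolding partial_deriv_eq[OF u_has_derivative[OF x]] by (simp add: partial_deriv_def)

lemma partial_u_has_derivative:
  assumes x: "x \<in> D"
  shows "(partial_deriv i u has_derivative (\<lambda>h. frechet_derivative (partial_deriv i a) (at x) h *\<^sub>R x
       + partial_deriv i a x *\<^sub>R h + frechet_derivative a (at x) h *\<^sub>R axis i 1
       - frechet_derivative (partial_deriv i g) (at x) h *\<^sub>R axis 3 1)) (at x)"
  by (rule has_derivative_transform_within_open[OF
     affine_field_partial_has_derivative[OF A.differentiable[OF x] A.second_differentiable[OF x]
        G.second_differentiable[OF x]] openD x]) (simp add: partial_u)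

lemma p_has_derivative:
  assumes x: "x \<in> D"
  shows "(p has_derivative frechet_derivative (hom_lift 2 P) (at x)) (at x)"
proof -
  have "hom_lift 2 P differentiable (at x)"
    using hom_lift_has_derivative[OF nz[OF x] P[OF x]] unfolding differentiable_def by blast
  then show ?thesis
    by (intro has_derivative_transform_within_open[OF has_derivative_partial(1) openD x]) (simp_all add: p)
qed

lemma differentiable:
  assumes "x \<in> D"
  shows "u differentiable (at x)" "partial_deriv i u differentiable (at x)" "p differentiable (at x)"
  using u_has_derivative[OF assms] partial_u_has_derivative[OF assms] p_has_derivative[OF assms]
  unfolding differentiable_def by blast+

definition "x_residual t = - ((1 - t\<^sup>2) * A2 t) + 4 * t * A1 t + 2 * A t - (A t)\<^sup>2 + 2 * t * G t * A t
   - (1 - t\<^sup>2) * G t * A1 t - 2 * P t - t * P1 t"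

definition "e_residual t = - 2 * A1 t + (1 - t\<^sup>2) * G2 t - 2 * t * G1 t - t * (G t)\<^sup>2 + (1 - t\<^sup>2) * G t * G1 t + P1 t"

text \<open>Leibniz rule for \<open>a\<close> times the identity field: the latter has no second
  derivatives, and the mixed terms add up to twice the gradient of \<open>a\<close>.\<close>

lemma laplacian_u:
  assumes x: "x \<in> D"
  shows "laplacian u x = laplacian a x *\<^sub>R x + 2 *\<^sub>R (\<chi> i. partial_deriv i a x) - laplacian g x *\<^sub>R axis 3 1"
  unfolding laplacian_def partial_deriv_eq[OF partial_u_has_derivative[OF x]]
  unfolding has_derivative_partial(2)[OF A.differentiable[OF x]]
     has_derivative_partial(2)[OF A.second_differentiable[OF x]]
     has_derivative_partial(2)[OF G.second_differentiable[OF x]]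
  by (simp only: sum.distrib sum_subtractf scaleR_left.sum[symmetric] sum_axis_vec scaleR_2) (simp only: add_ac)

lemma convection_u:
  assumes x: "x \<in> D"
  shows "convection u x = (\<Sum>i\<in>UNIV. u x $ i * partial_deriv i a x) *\<^sub>R x + a x *\<^sub>R u x
     - (\<Sum>i\<in>UNIV. u x $ i * partial_deriv i g x) *\<^sub>R axis 3 1"
proof -
  have "(\<Sum>i\<in>UNIV. u x $ i *\<^sub>R (a x *\<^sub>R axis i (1::real))) = a x *\<^sub>R (\<Sum>i\<in>UNIV. u x $ i *\<^sub>R axis i 1)"
    by (simp add: scaleR_sum_right mult.commute)
  also have "\<dots> = a x *\<^sub>R u x" by (simp only: sum_axis_vec vec_nth_inverse)
  finally show ?thesis
    unfolding convection_def partial_u[OF x]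
    by (simp only: scaleR_add_right scaleR_diff_right sum.distrib sum_subtractf scaleR_scaleR scaleR_left.sum)
qed

lemma gradient_p:
  assumes x: "x \<in> D"
  shows "gradient p x = hom_lift 3 P1 x *\<^sub>R axis 3 1 - hom_lift 4 (\<lambda>t. 2 * P t + t * P1 t) x *\<^sub>R x"
proof -
  have "partial_deriv i p x = partial_deriv i (hom_lift 2 P) x" for i
    by (rule partial_deriv_cong[OF openD x]) (simp add: p)
  then show ?thesis
    using partial_deriv_hom_lift[OF nz[OF x], of P P1 _ 2] P[OF x]
    by (simp add: gradient_def vec_eq_iff axis_def)
qed

lemma divergence_u:
  assumes x: "x \<in> D"
  shows "divergence u x = hom_lift 2 (\<lambda>t. A t - (1 - t\<^sup>2) * G1 t + t * G t) x"
proof -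
  define r q where "r = norm x" and "q = cos_polar x"
  have r: "r \<noteq> 0" using nz[OF x] by (simp add: r_def)
  have x3: "x$3 = q * r" using r by (simp add: q_def r_def cos_polar_def)
  have sq: "x$1 * x$1 + x$2 * x$2 + x$3 * x$3 = r\<^sup>2"
    using norm_sq_3[of x] by (simp add: r_def power2_eq_square)
  have "divergence u x = - (2 * A q + q * A1 q) / r^4 * (x$1 * x$1 + x$2 * x$2 + x$3 * x$3)
     + A1 q * x$3 / r^3 + 3 * A q / r^2 - G1 q / r^2 + (G q + q * G1 q) * x$3 / r^3"
    unfolding divergence_def partial_u[OF x] A.partial[OF x] G.partial[OF x] hom_lift_def sum_3
    unfolding q_def[symmetric] r_def[symmetric]
    by (simp add: axis_def algebra_simps add_divide_distrib diff_divide_distrib power2_eq_square power3_eq_cube)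
  also have "\<dots> = hom_lift 2 (\<lambda>t. A t - (1 - t\<^sup>2) * G1 t + t * G t) x"
    unfolding sq unfolding x3 hom_lift_def q_def[symmetric] r_def[symmetric]
    using r by (simp add: field_simps power2_eq_square power3_eq_cube power4_eq_xxxx)
  finally show ?thesis .
qed

lemma momentum:
  assumes x: "x \<in> D"
  shows "- laplacian u x + convection u x + gradient p x
    = hom_lift 4 x_residual x *\<^sub>R x + hom_lift 3 e_residual x *\<^sub>R axis 3 1"
proof -
  define r q where "r = norm x" and "q = cos_polar x"
  have r: "r \<noteq> 0" using nz[OF x] by (simp add: r_def)
  have x3: "x$3 = q * r" using r by (simp add: q_def r_def cos_polar_def)
  have sq: "x$1 * x$1 + x$2 * x$2 + x$3 * x$3 = r\<^sup>2"
    using norm_sq_3[of x] by (simp add: r_def power2_eq_square)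
  \<comment> \<open>Advection of a general profile, used with degree 2 for \<open>a\<close> and
    degree 1 for \<open>g\<close>. The part of \<open>u\<close> along \<open>x\<close> contributes
    -k A F by Euler's relation, the part along \<open>e_3\<close> the remaining terms.\<close>
  have adv: "(\<Sum>i\<in>UNIV. u x $ i * partial_deriv i (hom_lift k F) x)
      = (- real k * A q * F q + real k * q * G q * F q - (1 - q\<^sup>2) * G q * F1 q) / r^(k+2)"
    if "hom_lift_C2 D F F1 F2" for k F F1 F2
  proof -
    have "(\<Sum>i\<in>UNIV. u x $ i * partial_deriv i (hom_lift k F) x)
      = A q / r\<^sup>2 * (F1 q * x$3 / r^(k+1)
          - (real k * F q + q * F1 q) / r^(k+2) * (x$1 * x$1 + x$2 * x$2 + x$3 * x$3))
        - G q / r * (F1 q / r^(k+1) - (real k * F q + q * F1 q) / r^(k+2) * x$3)"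
      unfolding hom_lift_C2.partial[OF that x] sum_3 u[OF x] hom_lift_def
      unfolding q_def[symmetric] r_def[symmetric]
      by (simp add: axis_def algebra_simps add_divide_distrib diff_divide_distrib)
    also have "\<dots> = (- real k * A q * F q + real k * q * G q * F q - (1 - q\<^sup>2) * G q * F1 q) / r^(k+2)"
      unfolding sq unfolding x3
      using r by (simp add: field_simps power2_eq_square)
    finally show ?thesis .
  qed
  have grad_a: "(\<chi> i. partial_deriv i a x) = (A1 q / r^3) *\<^sub>R axis 3 1 - ((2 * A q + q * A1 q) / r^4) *\<^sub>R x"
    unfolding A.partial[OF x] hom_lift_def q_def[symmetric] r_def[symmetric]
    by (simp add: vec_eq_iff axis_def)
  have coeffs: "m1 *\<^sub>R x + m2 *\<^sub>R axis 3 1 = n1 *\<^sub>R x + n2 *\<^sub>R (axis 3 1 :: real^3)"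
    if "m1 = n1" "m2 = n2" for m1 m2 n1 n2 using that by simp
  have "- laplacian u x + convection u x + gradient p x =
    (- laplacian a x + 2 * ((2 * A q + q * A1 q) / r^4)
      + (\<Sum>i\<in>UNIV. u x $ i * partial_deriv i a x) + a x * a x - hom_lift 4 (\<lambda>t. 2 * P t + t * P1 t) x) *\<^sub>R x
    + (- 2 * (A1 q / r^3) + laplacian g x - a x * g x
      - (\<Sum>i\<in>UNIV. u x $ i * partial_deriv i g x) + hom_lift 3 P1 x) *\<^sub>R axis 3 1"
    unfolding laplacian_u[OF x] convection_u[OF x] gradient_p[OF x] grad_a
    \<comment> \<open>Occurrence 2 is the factor \<open>u x\<close> of
      \<open>a x *\<^sub>R u x\<close>; in the two sums \<open>u x\<close> must stay folded so that
      \<open>adv\<close> applies.\<close>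
    by (subst (2) u[OF x]) (simp add: algebra_simps)
  also have "\<dots> = hom_lift 4 x_residual x *\<^sub>R x + hom_lift 3 e_residual x *\<^sub>R axis 3 1"
    unfolding adv[OF A.hom_lift_C2_axioms] adv[OF G.hom_lift_C2_axioms] A.laplacian[OF x] G.laplacian[OF x]
    unfolding hom_lift_def x_residual_def e_residual_def q_def[symmetric] r_def[symmetric]
    apply (rule coeffs)
    using r by (simp_all add: field_simps power2_eq_square power3_eq_cube power4_eq_xxxx)
  finally show ?thesis .
qed

end

section \<open>Smooth flows from the Riccati equation\<close>

lemma open_slit_space: "open slit_space"
proof -
  have "closed {x::real^3. x $ 1 = 0 \<and> x $ 2 = 0 \<and> x $ 3 \<le> 0}"
    by (intro closed_Collect_conj closed_Collect_eq closed_Collect_le continuous_intros)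
  then show ?thesis unfolding slit_space_def by auto
qed

lemma slit_space_nonzero: "x \<in> slit_space \<Longrightarrow> x \<noteq> 0"
  by (auto simp: slit_space_def)

lemma cos_polar_le_1: "cos_polar x \<le> 1"
proof (cases "x = 0")
  case False
  have "x $ 3 \<le> norm x" using component_le_norm_cart[of x 3] by linarith
  then show ?thesis using False by (simp add: cos_polar_def)
qed (simp add: cos_polar_def)

text \<open>Equality of \<open>x $ 3\<close> and \<open>- norm x\<close> would annihilate the
  horizontal components and put \<open>x\<close> on the slit. Hence 1 + cos_polar may be divided by
  on all of \<open>slit_space\<close>.\<close>

lemma cos_polar_gt:
  assumes "x \<in> slit_space"
  shows "-1 < cos_polar x"
proof -
  have n: "norm x > 0" using slit_space_nonzero[OF assms] by simp
  have "- norm x < x $ 3"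
  proof (rule ccontr)
    assume "\<not> ?thesis"
    then have l: "norm x \<le> - x$3" by simp
    then have "(norm x)\<^sup>2 \<le> (x$3)\<^sup>2" using power_mono[OF l, of 2] n by simp
    then have "x$1 = 0 \<and> x$2 = 0" using norm_sq_3[of x]
      by (metis add_cancel_left_left add_diff_cancel_right' diff_le_0_iff_le sum_power2_le_zero_iff add_le_same_cancel2)
    then show False using assms l n by (auto simp: slit_space_def)
  qed
  then show ?thesis using n by (simp add: cos_polar_def field_simps)
qed

section \<open>Calculus of \<open>Ck_on\<close> on open sets\<close>

lemma Ck_on_cong:
  assumes "open U" "\<And>x. x \<in> U \<Longrightarrow> f x = g x" "Ck_on k f U"
  shows "Ck_on k g U"
  using assms(2,3)
proof (induction k arbitrary: f g)
  case 0 then show ?case by (metis Ck_on.simps(1) continuous_on_cong)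
next
  case (Suc k)
  have d: "g differentiable (at x)" and e: "frechet_derivative f (at x) = frechet_derivative g (at x)" if "x \<in> U" for x
  proof -
    have "(f has_derivative frechet_derivative f (at x)) (at x)"
      using Suc.prems(2) that by (simp add: frechet_derivative_works)
    then have "(g has_derivative frechet_derivative f (at x)) (at x)"
      using has_derivative_transform_within_open[of f _ x UNIV U g] assms(1) that Suc.prems(1) by auto
    then show "g differentiable (at x)" "frechet_derivative f (at x) = frechet_derivative g (at x)"
      by (auto simp: differentiable_def frechet_derivative_at)
  qed
  show ?case using d Suc.prems(2) Suc.IH[of "\<lambda>x. frechet_derivative f (at x) v" "\<lambda>x. frechet_derivative g (at x) v" for v] e
    by auto
qed

text \<open>Allows any formula for the derivative. It agrees with \<open>frechet_derivative\<close>
  only on \<open>U\<close>, which is where \<open>Ck_on_cong\<close> comes in.\<close>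

lemma Ck_on_SucI:
  assumes "open U" "\<And>x. x \<in> U \<Longrightarrow> (f has_derivative f' x) (at x)" "\<And>v. Ck_on k (\<lambda>x. f' x v) U"
  shows "Ck_on (Suc k) f U"
proof -
  have "Ck_on k (\<lambda>x. frechet_derivative f (at x) v) U" for v
    by (rule Ck_on_cong[OF assms(1) _ assms(3)[of v]]) (simp add: frechet_derivative_at[OF assms(2)])
  then show ?thesis using assms(2) unfolding Ck_on.simps differentiable_def by blast
qed

lemma Ck_on_SucD:
  assumes "Ck_on (Suc k) f U"
  shows "Ck_on k f U"
  using assms
proof (induction k arbitrary: f)
  case 0 then show ?case
    by (auto intro!: differentiable_imp_continuous_on simp: differentiable_on_def differentiable_at_withinI)
next
  case (Suc k)
  then show ?case by (metis Ck_on.simps(2))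
qed

lemma Ck_on_const: "Ck_on k (\<lambda>x. c) U"
  by (induction k arbitrary: c) (auto simp: frechet_derivative_const)

lemma Ck_on_add:
  assumes "open U" "Ck_on k f U" "Ck_on k g U"
  shows "Ck_on k (\<lambda>x. f x + g x) U"
  using assms(2,3)
proof (induction k arbitrary: f g)
  case 0 then show ?case by (auto intro: continuous_on_add)
next
  case (Suc k)
  show ?case
    by (rule Ck_on_SucI[OF assms(1) has_derivative_add[of f "frechet_derivative f (at x)" _ g "frechet_derivative g (at x)" for x] Suc.IH])
      (use Suc.prems in \<open>auto simp: frechet_derivative_works\<close>)
qed

lemma Ck_on_scaleR:
  fixes f :: "'a::real_normed_vector \<Rightarrow> real"
  assumes "open U" "Ck_on k f U" "Ck_on k g U"
  shows "Ck_on k (\<lambda>x. f x *\<^sub>R g x) U"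
  using assms(2,3)
proof (induction k arbitrary: f g)
  case 0 then show ?case by (auto intro: continuous_on_scaleR)
next
  case (Suc k)
  note sd = Suc.prems[THEN Ck_on_SucD]
  show ?case
  proof (rule Ck_on_SucI[OF assms(1)])
    show "((\<lambda>x. f x *\<^sub>R g x) has_derivative (\<lambda>h. f x *\<^sub>R frechet_derivative g (at x) h + frechet_derivative f (at x) h *\<^sub>R g x)) (at x)"
      if "x \<in> U" for x using that Suc.prems
      by (intro has_derivative_scaleR) (auto simp: frechet_derivative_works)
    show "Ck_on k (\<lambda>x. f x *\<^sub>R frechet_derivative g (at x) v + frechet_derivative f (at x) v *\<^sub>R g x) U" for v
      using Suc.prems sd by (intro Ck_on_add[OF assms(1)] Suc.IH) auto
  qed
qed

lemma Ck_on_mult: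
  fixes f g :: "'a::real_normed_vector \<Rightarrow> real"
  assumes "open U" "Ck_on k f U" "Ck_on k g U"
  shows "Ck_on k (\<lambda>x. f x * g x) U"
  using Ck_on_scaleR[OF assms] by simp

lemma Ck_on_uminus: "open U \<Longrightarrow> Ck_on k f U \<Longrightarrow> Ck_on k (\<lambda>x. - f x) U"
  using Ck_on_scaleR[OF _ Ck_on_const[of k "-1::real" U], of f] by simp

lemma Ck_on_diff:
  assumes "open U" "Ck_on k f U" "Ck_on k g U"
  shows "Ck_on k (\<lambda>x. f x - g x) U"
  using Ck_on_add[OF assms(1,2) Ck_on_uminus[OF assms(1,3)]] by simp

lemma Ck_on_power:
  fixes f :: "'a::real_normed_vector \<Rightarrow> real"
  assumes "open U" "Ck_on k f U"
  shows "Ck_on k (\<lambda>x. f x ^ n) U"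
  by (induction n) (auto intro: Ck_on_mult Ck_on_const assms)

lemma Ck_on_linear:
  assumes "open U" "bounded_linear f"
  shows "Ck_on k f U"
proof (cases k)
  case 0 then show ?thesis using assms(2) by (auto intro: linear_continuous_on)
next
  case (Suc n) then show ?thesis
    using Ck_on_SucI[OF assms(1) bounded_linear_imp_has_derivative[OF assms(2)], of n] Ck_on_const by auto
qed

text \<open>Meant for functions that satisfy a differential equation: their derivative is an expression
  in the function itself and in functions already known to be smooth.\<close>

lemma Ck_on_bootstrap:
  assumes "open U" "\<And>x. x \<in> U \<Longrightarrow> (f has_derivative f' x) (at x)"
    "\<And>k v. Ck_on k f U \<Longrightarrow> Ck_on k (\<lambda>x. f' x v) U"
  shows "Ck_on k f U"
proof (induction k)
  case 0
  show ?case using assms(2) by (auto intro!: continuous_at_imp_continuous_on has_derivative_continuous)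
next
  case (Suc k) then show ?case using Ck_on_SucI[OF assms(1,2)] assms(3) by blast
qed

text \<open>The derivative of 1/f is a polynomial in 1/f and the derivative of f, so the bootstrap
  applies; each round uses \<open>f\<close> at the next order, hence the assumption for all
  \<open>k\<close>.\<close>

lemma Ck_on_inverse:
  fixes f :: "'a::real_normed_vector \<Rightarrow> real"
  assumes "open U" "\<And>k. Ck_on k f U" "\<And>x. x \<in> U \<Longrightarrow> f x \<noteq> 0"
  shows "Ck_on k (\<lambda>x. inverse (f x)) U"
proof (rule Ck_on_bootstrap[OF assms(1)])
  show "((\<lambda>x. inverse (f x)) has_derivative (\<lambda>h. - (inverse (f x) * frechet_derivative f (at x) h * inverse (f x)))) (at x)"
    if "x \<in> U" for x
    using that assms(2)[of 1] assms(3) by (intro Deriv.has_derivative_inverse) (auto simp: frechet_derivative_works)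
  show "Ck_on k (\<lambda>x. - (inverse (f x) * frechet_derivative f (at x) v * inverse (f x))) U"
    if "Ck_on k (\<lambda>x. inverse (f x)) U" for k v
    using that assms(2)[of "Suc k"] by (intro Ck_on_uminus Ck_on_mult assms(1)) auto
qed

text \<open>The reciprocal of the norm bootstraps by itself: its derivative is its own cube times a
  linear function.\<close>

lemma Ck_on_inverse_norm:
  assumes "open U" "0 \<notin> U"
  shows "Ck_on k (\<lambda>x::real^3. inverse (norm x)) U"
proof (rule Ck_on_bootstrap[OF assms(1)])
  show "((\<lambda>x::real^3. inverse (norm x)) has_derivative
     (\<lambda>h. - (inverse (norm x) * ((x \<bullet> h) * inverse (norm x)) * inverse (norm x)))) (at x)" if "x \<in> U" for x
    using norm_has_derivative[of x] that assms(2)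
    by (intro Deriv.has_derivative_inverse) (auto simp: divide_inverse)
  show "Ck_on k (\<lambda>x::real^3. - (inverse (norm x) * ((x \<bullet> v) * inverse (norm x)) * inverse (norm x))) U"
    if "Ck_on k (\<lambda>x::real^3. inverse (norm x)) U" for k v
    using that Ck_on_linear[OF assms(1) bounded_linear_inner_left[of v]]
    by (intro Ck_on_uminus Ck_on_mult assms(1)) auto
qed

text \<open>Pure algebra with s = 1 + t and k = 1/s. The formulas for \<open>G1\<close>,
  \<open>G2\<close>, \<open>G3\<close> are successive derivatives of w/s with w' = (c + w - w^2/2)/s
  inserted, so everything is a polynomial in w, c, s and k, and cancelling k s decides the
  identity.\<close>

lemma x_residual_identity:
  fixes s :: real
  assumes s: "s * k = 1"
    and G: "G = w * k" "G1 = (c - w\<^sup>2 / 2) * k\<^sup>2" "G2 = (w^3 / 2 - c * w - 2 * c) * k^3"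
      "G3 = ((3 * w\<^sup>2 / 2 - c) * (c + w - w\<^sup>2 / 2) - 3 * (w^3 / 2 - c * w - 2 * c)) * k^4"
    and t: "t = s - 1"
    and A: "A = (1 - t\<^sup>2) * G1 - t * G"
      "A1 = (1 - t\<^sup>2) * G2 - 3 * t * G1 - G"
      "A2 = (1 - t\<^sup>2) * G3 - 5 * t * G2 - 4 * G1"
      "P = A - t * G - (1 - t\<^sup>2) * G\<^sup>2 / 2 - c"
      "P1 = A1 - G - t * G1 + t * G\<^sup>2 - (1 - t\<^sup>2) * G * G1"
  shows "- ((1 - t\<^sup>2) * A2) + 4 * t * A1 + 2 * A - A\<^sup>2 + 2 * t * G * A
    - (1 - t\<^sup>2) * G * A1 - 2 * P - t * P1 = 0"
proof -
  have r: "k * s = 1" "k * (s * x) = x" for x using s by (auto simp: mult.commute mult.left_commute)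
  show ?thesis
    unfolding A G t
    by (simp add: algebra_simps power2_eq_square power3_eq_cube power4_eq_xxxx r
        add_divide_distrib diff_divide_distrib)
qed

lemma homogeneous_hom_lift:
  assumes "c > 0"
  shows "hom_lift k F (c *\<^sub>R x) = inverse (c ^ k) * hom_lift k F x"
  using assms by (simp add: hom_lift_def cos_polar_def field_simps power_mult_distrib)

text \<open>The point t = 1 is included with a two-sided derivative: the north pole is then an
  ordinary point, and the field is smooth across the positive axis.\<close>

locale riccati_flow =
  fixes W :: "real \<Rightarrow> real" and c :: real
  assumes W: "-1 < t \<Longrightarrow> t \<le> 1 \<Longrightarrow> (W has_real_derivative (c + W t - (W t)\<^sup>2 / 2) / (1 + t)) (at t)"
begin

definition "G t = W t / (1 + t)"
text \<open>Derivatives of \<open>G\<close> with the derivative of \<open>W\<close> eliminated by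
  the equation. In \<open>G1\<close> the term linear in \<open>W\<close> cancels against the
  quotient rule, so (1 + t)^2 (G1 + G^2/2) = c, the first integral met again in the
  classification.\<close>

definition "G1 t = (c - (W t)\<^sup>2 / 2) / (1 + t)\<^sup>2"
definition "G2 t = ((W t)^3 / 2 - c * W t - 2 * c) / (1 + t)^3"
definition "G3 t = ((3 * (W t)\<^sup>2 / 2 - c) * (c + W t - (W t)\<^sup>2 / 2) - 3 * ((W t)^3 / 2 - c * W t - 2 * c)) / (1 + t)^4"

lemma G: "-1 < t \<Longrightarrow> t \<le> 1 \<Longrightarrow> (G has_real_derivative G1 t) (at t)"
  unfolding G_def[abs_def] G1_def
  by (rule derivative_eq_intros W refl | assumption | simp)+ (simp add: field_simps power2_eq_square)

lemma G1: "-1 < t \<Longrightarrow> t \<le> 1 \<Longrightarrow> (G1 has_real_derivative G2 t) (at t)"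
proof -
  assume t: "-1 < t" "t \<le> 1"
  define s where "s = 1 + t"
  have s: "s \<noteq> 0" using t by (simp add: s_def)
  have dW: "(W has_real_derivative (c + W t - (W t)\<^sup>2 / 2) / s) (at t)" using W[OF t] by (simp add: s_def)
  have n: "((\<lambda>t. c - (W t)\<^sup>2 / 2) has_real_derivative - (W t * ((c + W t - (W t)\<^sup>2 / 2) / s))) (at t)"
    by (auto intro!: derivative_eq_intros dW)
  have m: "((\<lambda>t. (1 + t)\<^sup>2) has_real_derivative 2 * s) (at t)"
    by (auto intro!: derivative_eq_intros simp: s_def)
  have d: "(G1 has_real_derivative (- (W t * ((c + W t - (W t)\<^sup>2 / 2) / s)) * s\<^sup>2 - (c - (W t)\<^sup>2 / 2) * (2 * s)) / (s\<^sup>2 * s\<^sup>2)) (at t)"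
    unfolding G1_def[abs_def] using DERIV_divide[OF n m] s by (simp add: s_def)
  have e: "(- (W t * ((c + W t - (W t)\<^sup>2 / 2) / s)) * s\<^sup>2 - (c - (W t)\<^sup>2 / 2) * (2 * s)) / (s\<^sup>2 * s\<^sup>2) = G2 t"
    unfolding G2_def s_def[symmetric] using s by (simp add: field_simps power2_eq_square power3_eq_cube)
  show ?thesis by (rule DERIV_cong[OF d e])
qed

lemma G2: "-1 < t \<Longrightarrow> t \<le> 1 \<Longrightarrow> (G2 has_real_derivative G3 t) (at t)"
proof -
  assume t: "-1 < t" "t \<le> 1"
  define s where "s = 1 + t"
  have s: "s \<noteq> 0" using t by (simp add: s_def)
  have dW: "(W has_real_derivative (c + W t - (W t)\<^sup>2 / 2) / s) (at t)" using W[OF t] by (simp add: s_def)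
  have n: "((\<lambda>t. (W t)^3 / 2 - c * W t - 2 * c) has_real_derivative (3 * (W t)\<^sup>2 / 2 - c) * ((c + W t - (W t)\<^sup>2 / 2) / s)) (at t)"
    by (auto intro!: derivative_eq_intros dW simp: s field_simps)
  have m: "((\<lambda>t. (1 + t)^3) has_real_derivative 3 * s\<^sup>2) (at t)"
    by (auto intro!: derivative_eq_intros simp: s_def)
  have d: "(G2 has_real_derivative (((3 * (W t)\<^sup>2 / 2 - c) * ((c + W t - (W t)\<^sup>2 / 2) / s)) * s^3
      - ((W t)^3 / 2 - c * W t - 2 * c) * (3 * s\<^sup>2)) / (s^3 * s^3)) (at t)"
    unfolding G2_def[abs_def] using DERIV_divide[OF n m] s by (simp add: s_def)
  have e: "(((3 * (W t)\<^sup>2 / 2 - c) * ((c + W t - (W t)\<^sup>2 / 2) / s)) * s^3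
      - ((W t)^3 / 2 - c * W t - 2 * c) * (3 * s\<^sup>2)) / (s^3 * s^3) = G3 t"
    unfolding G3_def s_def[symmetric] using s by (simp add: field_simps power2_eq_square power3_eq_cube power4_eq_xxxx)
  show ?thesis by (rule DERIV_cong[OF d e])
qed

definition "A t = (1 - t\<^sup>2) * G1 t - t * G t"
definition "A1 t = (1 - t\<^sup>2) * G2 t - 3 * t * G1 t - G t"
definition "A2 t = (1 - t\<^sup>2) * G3 t - 5 * t * G2 t - 4 * G1 t"
text \<open>Obtained by integrating the \<open>e_3\<close> component of the momentum equation; the
  constant of integration -c is the one that the \<open>x\<close> component demands.\<close>

definition "P t = A t - t * G t - (1 - t\<^sup>2) * (G t)\<^sup>2 / 2 - c"
definition "P1 t = A1 t - G t - t * G1 t + t * (G t)\<^sup>2 - (1 - t\<^sup>2) * G t * G1 t"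

lemma A: "-1 < t \<Longrightarrow> t \<le> 1 \<Longrightarrow> (A has_real_derivative A1 t) (at t)"
  unfolding A_def[abs_def] A1_def
  by (rule derivative_eq_intros G G1 refl | assumption | simp)+

lemma A1: "-1 < t \<Longrightarrow> t \<le> 1 \<Longrightarrow> (A1 has_real_derivative A2 t) (at t)"
  unfolding A1_def[abs_def] A2_def
  by (rule derivative_eq_intros G G1 G2 refl | assumption | simp)+

lemma P: "-1 < t \<Longrightarrow> t \<le> 1 \<Longrightarrow> (P has_real_derivative P1 t) (at t)"
  unfolding P_def[abs_def] P1_def
  by (rule derivative_eq_intros A G G1 refl | assumption | simp)+ (simp add: field_simps)

definition "u x = hom_lift 2 A x *\<^sub>R x - hom_lift 1 G x *\<^sub>R axis 3 1"
definition "p = hom_lift 2 P"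

sublocale conical_flow slit_space A A1 A2 G G1 G2 P P1 u p
  by unfold_locales
    (auto intro!: open_slit_space A A1 G G1 P cos_polar_gt cos_polar_le_1 simp: slit_space_nonzero u_def p_def)

text \<open>The \<open>e_3\<close> residual vanishes by the choice of \<open>A1\<close> and
  \<open>P1\<close> alone; the \<open>x\<close> residual is where the Riccati equation is
  used.\<close>

lemma residuals: assumes "-1 < t" "t \<le> 1" shows "e_residual t = 0" "x_residual t = 0"
proof -
  show "e_residual t = 0"
    unfolding e_residual_def P1_def A1_def by (simp add: algebra_simps power2_eq_square)
  show "x_residual t = 0"
    unfolding x_residual_def
  proof (rule x_residual_identity)
    show "(1 + t) * inverse (1 + t) = 1" using assms by simp
    show "G t = W t * inverse (1 + t)" by (simp only: G_def divide_inverse)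
    show "G1 t = (c - (W t)\<^sup>2 / 2) * (inverse (1 + t))\<^sup>2"
      by (simp only: G1_def divide_inverse power_inverse)
    show "G2 t = ((W t)^3 / 2 - c * W t - 2 * c) * (inverse (1 + t))^3"
      by (simp only: G2_def divide_inverse power_inverse)
    show "G3 t = ((3 * (W t)\<^sup>2 / 2 - c) * (c + W t - (W t)\<^sup>2 / 2) - 3 * ((W t)^3 / 2 - c * W t - 2 * c)) * (inverse (1 + t))^4"
      by (simp only: G3_def divide_inverse power_inverse)
    show "t = (1 + t) - 1" by simp
  qed (simp_all only: A_def A1_def A2_def P_def P1_def)
qed

lemma divergence_free:
  assumes x: "x \<in> slit_space"
  shows "divergence u x = 0"
proof -
  have "divergence u x = hom_lift 2 (\<lambda>t. 0) x"
    unfolding divergence_u[OF x] by (rule arg_cong[where f = "\<lambda>F. hom_lift 2 F x"]) (simp add: fun_eq_iff A_def)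
  then show ?thesis by (simp add: hom_lift_def)
qed

lemma momentum_balance:
  assumes x: "x \<in> slit_space"
  shows "- laplacian u x + convection u x + gradient p x = 0"
proof -
  have "hom_lift 4 x_residual x = 0" "hom_lift 3 e_residual x = 0"
    unfolding hom_lift_def residuals[OF cos_polar_gt[OF x] cos_polar_le_1] by simp_all
  then show ?thesis unfolding momentum[OF x] by simp
qed

lemma navier_stokes: "navier_stokes_on slit_space u p"
  unfolding navier_stokes_on_def
  by (intro conjI ballI allI differentiable divergence_free momentum_balance)

lemma homogeneous: "homogeneous_on slit_space (-1) u" "homogeneous_on slit_space (-2) p"
proof -
  have "u (c *\<^sub>R x) = (c powi -1) *\<^sub>R u x" "p (c *\<^sub>R x) = (c powi -2) *\<^sub>R p x" if "c > 0" for c x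
  proof -
    have i: "inverse (c\<^sup>2) * y * c = inverse c * y" for y
      using that by (simp add: power2_eq_square)
    show "u (c *\<^sub>R x) = (c powi -1) *\<^sub>R u x"
      unfolding u_def homogeneous_hom_lift[OF that] scaleR_scaleR i
      by (simp add: power_int_minus scaleR_diff_right)
    show "p (c *\<^sub>R x) = (c powi -2) *\<^sub>R p x"
      unfolding p_def homogeneous_hom_lift[OF that] by (simp add: power_int_minus)
  qed
  then show "homogeneous_on slit_space (-1) u" "homogeneous_on slit_space (-2) p"
    unfolding homogeneous_on_def by blast+
qed

lemma smooth: "Ck_on k u slit_space"
proof -
  note op = open_slit_space
  have n: "Ck_on k (\<lambda>x::real^3. inverse (norm x)) slit_space" for k
    using Ck_on_inverse_norm[OF op] slit_space_nonzero by blast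
  have q: "Ck_on k cos_polar slit_space" for k
    unfolding cos_polar_def[abs_def] divide_inverse
    by (intro Ck_on_mult op n Ck_on_linear bounded_linear_vec_nth)
  have m: "Ck_on k (\<lambda>x. inverse (1 + cos_polar x)) slit_space" for k
    by (intro Ck_on_inverse op Ck_on_add q Ck_on_const) (use cos_polar_gt in fastforce)
  \<comment> \<open>Bootstrap: the derivative of \<open>W\<close> composed with
    \<open>cos_polar\<close> is a polynomial in that function times smooth factors.\<close>
  have w: "Ck_on k (\<lambda>x. W (cos_polar x)) slit_space" for k
  proof (rule Ck_on_bootstrap[OF op])
    fix x assume x: "x \<in> slit_space"
    show "((\<lambda>x. W (cos_polar x)) has_derivative (\<lambda>h. (c + W (cos_polar x) - (W (cos_polar x))\<^sup>2 / 2) / (1 + cos_polar x) * frechet_derivative cos_polar (at x) h)) (at x)"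
    proof -
      have dq: "(cos_polar has_derivative frechet_derivative cos_polar (at x)) (at x)"
        using q[of 1] x by (simp add: frechet_derivative_works)
      show ?thesis
        by (rule has_derivative_compose[OF dq W[OF cos_polar_gt[OF x] cos_polar_le_1, unfolded has_field_derivative_def]])
    qed
  next
    fix k v assume "Ck_on k (\<lambda>x. W (cos_polar x)) slit_space"
    then show "Ck_on k (\<lambda>x. (c + W (cos_polar x) - (W (cos_polar x))\<^sup>2 / 2) / (1 + cos_polar x) * frechet_derivative cos_polar (at x) v) slit_space"
      unfolding divide_inverse using q[of "Suc k"]
      by (intro Ck_on_mult Ck_on_add Ck_on_diff Ck_on_power Ck_on_const op m) auto
  qed
  have g: "Ck_on k (\<lambda>x. G (cos_polar x)) slit_space"
    unfolding G_def divide_inverse by (rule Ck_on_mult[OF op w m])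
  have g1: "Ck_on k (\<lambda>x. G1 (cos_polar x)) slit_space"
    unfolding G1_def divide_inverse power_inverse[symmetric]
    by (rule Ck_on_mult Ck_on_power Ck_on_diff Ck_on_const op w m)+
  have a: "Ck_on k (\<lambda>x. A (cos_polar x)) slit_space"
    unfolding A_def by (rule Ck_on_diff Ck_on_mult Ck_on_power Ck_on_const op q g g1)+
  have "Ck_on k (\<lambda>x. hom_lift 2 A x *\<^sub>R x - hom_lift 1 G x *\<^sub>R axis 3 1) slit_space"
    unfolding hom_lift_def divide_inverse power_inverse[symmetric]
    by (rule Ck_on_diff Ck_on_scaleR Ck_on_mult op a g Ck_on_power n Ck_on_const
        Ck_on_linear[OF op bounded_linear_ident])+
  then show ?thesis using u_def[abs_def] by simp
qed

end

section \<open>The spherical frame and corresponding pairs\<close>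

lemma inner_3: "(x::real^3) \<bullet> y = x$1 * y$1 + x$2 * y$2 + x$3 * y$3"
  by (simp add: inner_vec_def sum_3)

lemma frame_nth [simp]:
  "e_r \<theta> \<phi> $ 1 = sin \<theta> * cos \<phi>" "e_r \<theta> \<phi> $ 2 = sin \<theta> * sin \<phi>" "e_r \<theta> \<phi> $ 3 = cos \<theta>"
  "e_theta \<theta> \<phi> $ 1 = cos \<theta> * cos \<phi>" "e_theta \<theta> \<phi> $ 2 = cos \<theta> * sin \<phi>" "e_theta \<theta> \<phi> $ 3 = - sin \<theta>"
  "e_phi \<theta> \<phi> $ 1 = - sin \<phi>" "e_phi \<theta> \<phi> $ 2 = cos \<phi>" "e_phi \<theta> \<phi> $ 3 = 0"
  by (simp_all add: e_r_def e_theta_def e_phi_def)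

lemma cos_sq: "cos (t::real) * cos t = 1 - sin t * sin t"
  using sin_cos_squared_add[of t] by (simp add: power2_eq_square)

lemma frame_inner:
  "e_r \<theta> \<phi> \<bullet> e_r \<theta> \<phi> = 1" "e_theta \<theta> \<phi> \<bullet> e_theta \<theta> \<phi> = 1" "e_phi \<theta> \<phi> \<bullet> e_phi \<theta> \<phi> = 1"
  "e_r \<theta> \<phi> \<bullet> e_theta \<theta> \<phi> = 0" "e_r \<theta> \<phi> \<bullet> e_phi \<theta> \<phi> = 0" "e_theta \<theta> \<phi> \<bullet> e_phi \<theta> \<phi> = 0"
  "e_theta \<theta> \<phi> \<bullet> e_r \<theta> \<phi> = 0"
  using cos_sq[of \<theta>] cos_sq[of \<phi>] by (simp_all add: inner_3) algebra+

lemma frame_expansion: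
  "a = (a \<bullet> e_r \<theta> \<phi>) *\<^sub>R e_r \<theta> \<phi> + (a \<bullet> e_theta \<theta> \<phi>) *\<^sub>R e_theta \<theta> \<phi> + (a \<bullet> e_phi \<theta> \<phi>) *\<^sub>R e_phi \<theta> \<phi>"
  unfolding vec_eq_iff forall_3 using cos_sq[of \<theta>] cos_sq[of \<phi>] by (simp add: inner_3) algebra

text \<open>Turns a polar component G sin \<theta> into a combination of \<open>e_r\<close> and
  \<open>e_3\<close>, with no division by sin \<theta>.\<close>

lemma sin_e_theta: "sin \<theta> *\<^sub>R e_theta \<theta> \<phi> = cos \<theta> *\<^sub>R e_r \<theta> \<phi> - axis 3 1"
  using cos_sq[of \<theta>] by (simp add: vec_eq_iff forall_3 axis_def)

lemma norm_spherical_point [simp]: "norm (spherical_point r \<theta> \<phi>) = \<bar>r\<bar>"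
  using frame_inner(1) by (simp add: spherical_point_def norm_eq_sqrt_inner)

lemma cos_polar_spherical_point: "r > 0 \<Longrightarrow> cos_polar (spherical_point r \<theta> \<phi>) = cos \<theta>"
  unfolding cos_polar_def norm_spherical_point by (simp add: spherical_point_def)

lemma spherical_point_scale: "spherical_point r \<theta> \<phi> = r *\<^sub>R spherical_point 1 \<theta> \<phi>"
  by (simp add: spherical_point_def)

text \<open>The region covered by spherical coordinates with 0 < \<theta> < \<pi>; its cosines fill
  the open interval (-1, 1).\<close>

definition off_axis :: "(real^3) set"
  where "off_axis = {x. x $ 1 \<noteq> 0 \<or> x $ 2 \<noteq> 0}"

lemma off_axis_subset: "off_axis \<subseteq> slit_space"
  by (auto simp: off_axis_def slit_space_def)

lemma open_off_axis: "open off_axis"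
  unfolding off_axis_def by (intro open_Collect_disj open_Collect_neq continuous_intros)

lemma spherical_point_off_axis:
  assumes "r > 0" "0 < \<theta>" "\<theta> < pi"
  shows "spherical_point r \<theta> \<phi> \<in> off_axis"
proof -
  have "sin \<theta> \<noteq> 0" using sin_gt_zero assms by fastforce
  moreover have "cos \<phi> \<noteq> 0 \<or> sin \<phi> \<noteq> 0" using sin_zero_norm_cos_one[of \<phi>] by auto
  ultimately show ?thesis using assms(1) by (auto simp: off_axis_def spherical_point_def)
qed

lemma off_axis_cases:
  assumes "x \<in> off_axis"
  obtains r \<theta> \<phi> where "r > 0" "0 < \<theta>" "\<theta> < pi" "x = spherical_point r \<theta> \<phi>" "cos_polar x = cos \<theta>" "norm x = r"
proof -
  define r where "r = norm x"
  have r: "r > 0" using assms by (auto simp: r_def off_axis_def)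
  have n: "r\<^sup>2 = (x$1)\<^sup>2 + (x$2)\<^sup>2 + (x$3)\<^sup>2" unfolding r_def by (rule norm_sq_3)
  define d where "d = sqrt ((x$1)\<^sup>2 + (x$2)\<^sup>2)"
  have d: "d > 0" using assms by (auto simp: d_def off_axis_def add_pos_nonneg add_nonneg_pos)
  have d2: "d\<^sup>2 = (x$1)\<^sup>2 + (x$2)\<^sup>2" by (simp add: d_def)
  define q where "q = x$3 / r"
  have "q\<^sup>2 + (d/r)\<^sup>2 = ((x$3)\<^sup>2 + d\<^sup>2) / r\<^sup>2"
    by (simp only: q_def power_divide add_divide_distrib)
  also have "(x$3)\<^sup>2 + d\<^sup>2 = r\<^sup>2" using n d2 by simp
  finally have q2: "q\<^sup>2 + (d/r)\<^sup>2 = 1" using r by simp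
  moreover have "(d/r)\<^sup>2 > 0" using d r by simp
  ultimately have "q\<^sup>2 < 1" by linarith
  then have q: "-1 < q" "q < 1" by (simp_all add: abs_square_less_1 abs_less_iff)
  have s: "sin (arccos q) = d / r"
  proof -
    have "sin (arccos q) = sqrt (1 - q\<^sup>2)" using q by (simp add: sin_arccos)
    also have "1 - q\<^sup>2 = (d/r)\<^sup>2" using q2 by simp
    finally show ?thesis using d r by simp
  qed
  have "(x$1 / d)\<^sup>2 + (x$2 / d)\<^sup>2 = ((x$1)\<^sup>2 + (x$2)\<^sup>2) / d\<^sup>2"
    by (simp only: power_divide add_divide_distrib)
  also have "\<dots> = 1" using d unfolding d2[symmetric] by simp
  finally obtain \<phi> where p: "x$1 / d = cos \<phi>" "x$2 / d = sin \<phi>" using sincos_total_2pi by metis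
  have "x = spherical_point r (arccos q) \<phi>"
    using r d q by (simp add: vec_eq_iff forall_3 spherical_point_def s flip: p) (simp add: q_def)
  moreover have "cos_polar x = cos (arccos q)" using q by (simp add: cos_polar_def q_def r_def)
  moreover have "0 < arccos q" "arccos q < pi" using arccos_lt_bounded[of q] q by simp_all
  ultimately show ?thesis using that r r_def by metis
qed

text \<open>\<open>off_axis\<close> is dense in \<open>slit_space\<close>: a point of the positive
  axis is approached along \<open>e_1\<close>.\<close>

lemma agree_on_slit_space:
  fixes f g :: "real^3 \<Rightarrow> 'b::real_normed_vector"
  assumes "continuous_on slit_space f" "continuous_on slit_space g"
    and eq: "\<And>y. y \<in> off_axis \<Longrightarrow> f y = g y" and x: "x \<in> slit_space"
  shows "f x = g x"
proof (cases "x \<in> off_axis")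
  case False
  then have x0: "x$1 = 0" "x$2 = 0" by (auto simp: off_axis_def)
  have "isCont (\<lambda>y. f y - g y) x"
    using assms open_slit_space by (intro continuous_diff) (auto simp: continuous_on_eq_continuous_at)
  moreover have "((\<lambda>t::real. x + t *\<^sub>R axis 1 1) \<longlongrightarrow> x + 0 *\<^sub>R axis 1 1) (at_right 0)"
    by (intro tendsto_intros)
  ultimately have "((\<lambda>t::real. f (x + t *\<^sub>R axis 1 1) - g (x + t *\<^sub>R axis 1 1)) \<longlongrightarrow> f x - g x) (at_right 0)"
    using isCont_tendsto_compose[of x "\<lambda>y. f y - g y"] by simp
  moreover have "((\<lambda>t::real. f (x + t *\<^sub>R axis 1 1) - g (x + t *\<^sub>R axis 1 1)) \<longlongrightarrow> 0) (at_right 0)"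
  proof (rule tendsto_eventually, rule eventually_mono[OF eventually_at_right_less])
    fix t :: real assume "0 < t"
    then have "x + t *\<^sub>R axis 1 1 \<in> off_axis" using x0 by (simp add: off_axis_def)
    then show "f (x + t *\<^sub>R axis 1 1) - g (x + t *\<^sub>R axis 1 1) = 0" using eq by simp
  qed
  ultimately have "f x - g x = 0" by (rule tendsto_unique[rotated]) simp
  then show ?thesis by simp
qed (use eq in simp)

section \<open>Pairs that correspond to the same polar component\<close>

lemma corresponding_pair_value:
  assumes "corresponding_pair v u p" "r > 0" "0 < \<theta>" "\<theta> < pi"
  shows "u (spherical_point r \<theta> \<phi>) = inverse r *\<^sub>R (radial_component v \<theta> *\<^sub>R e_r \<theta> \<phi> + v \<theta> *\<^sub>R e_theta \<theta> \<phi>)"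
    and "p (spherical_point r \<theta> \<phi>) = inverse (r\<^sup>2) * pressure_profile v \<theta>"
proof -
  have m: "spherical_point 1 \<theta> \<phi> \<in> slit_space" using spherical_point_off_axis[of 1 \<theta>] assms off_axis_subset by auto
  have "u (spherical_point r \<theta> \<phi>) = (r powi -1) *\<^sub>R u (spherical_point 1 \<theta> \<phi>)"
     "p (spherical_point r \<theta> \<phi>) = (r powi -2) *\<^sub>R p (spherical_point 1 \<theta> \<phi>)"
    using assms m unfolding corresponding_pair_def homogeneous_on_def spherical_point_scale[of r] by blast+
  moreover have "u (spherical_point 1 \<theta> \<phi>) = radial_component v \<theta> *\<^sub>R e_r \<theta> \<phi> + v \<theta> *\<^sub>R e_theta \<theta> \<phi>"
    "p (spherical_point 1 \<theta> \<phi>) = pressure_profile v \<theta>"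
    using assms unfolding corresponding_pair_def by auto
  ultimately show "u (spherical_point r \<theta> \<phi>) = inverse r *\<^sub>R (radial_component v \<theta> *\<^sub>R e_r \<theta> \<phi> + v \<theta> *\<^sub>R e_theta \<theta> \<phi>)"
    "p (spherical_point r \<theta> \<phi>) = inverse (r\<^sup>2) * pressure_profile v \<theta>"
    by (simp_all add: power_int_minus)
qed

text \<open>\<open>is_solution_profile\<close> speaks of some pair; by this uniqueness its
  regularity and its equations pass to every pair corresponding to \<open>v\<close>.\<close>

lemma corresponding_pair_unique:
  assumes "corresponding_pair v u p" "corresponding_pair v u' p'" "x \<in> slit_space"
  shows "u x = u' x" "p x = p' x"
proof -
  have eq: "u y = u' y" "p y = p' y" if y: "y \<in> off_axis" for y
    using y by (rule off_axis_cases,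
      simp add: corresponding_pair_value[OF assms(1)] corresponding_pair_value[OF assms(2)])+
  have c: "continuous_on slit_space u" "continuous_on slit_space p"
     "continuous_on slit_space u'" "continuous_on slit_space p'"
    using assms unfolding corresponding_pair_def by blast+
  show "u x = u' x" by (rule agree_on_slit_space[OF c(1,3) eq(1) assms(3)])
  show "p x = p' x" by (rule agree_on_slit_space[OF c(2,4) eq(2) assms(3)])
qed

lemma punctured_sphere_subset: "punctured_sphere \<subseteq> slit_space"
proof
  fix x :: "real^3" assume x: "x \<in> punctured_sphere"
  show "x \<in> slit_space"
  proof (rule ccontr)
    assume "x \<notin> slit_space"
    then have h: "x$1 = 0" "x$2 = 0" "x$3 \<le> 0" by (auto simp: slit_space_def)
    have "norm x = 1" using x by (simp add: punctured_sphere_def)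
    then have "(x$3)\<^sup>2 = 1" using norm_sq_3[of x] h by simp
    then have "x$3 = -1" using h(3) by (auto simp: power2_eq_1_iff)
    then have "x = south_pole" using h by (simp add: vec_eq_iff forall_3 south_pole_def)
    then show False using x by (simp add: punctured_sphere_def)
  qed
qed

lemma navier_stokes_on_cong:
  assumes "open D" "\<And>x. x \<in> D \<Longrightarrow> u x = u' x" "\<And>x. x \<in> D \<Longrightarrow> p x = p' x" "navier_stokes_on D u' p'"
  shows "navier_stokes_on D u p"
proof -
  have pu: "partial_deriv i u x = partial_deriv i u' x" and pp: "partial_deriv i p x = partial_deriv i p' x"
    if "x \<in> D" for i x using partial_deriv_cong[OF assms(1) that] assms(2,3) by blast+
  have ppu: "partial_deriv i (partial_deriv i u) x = partial_deriv i (partial_deriv i u') x"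
    if "x \<in> D" for i x using partial_deriv_cong[OF assms(1) that] pu by blast
  have "laplacian u x = laplacian u' x" "convection u x = convection u' x"
    "gradient p x = gradient p' x" "divergence u x = divergence u' x" if "x \<in> D" for x
    using that by (simp_all add: laplacian_def convection_def gradient_def divergence_def ppu pu pp assms(2))
  moreover have "u differentiable (at x)" "partial_deriv i u differentiable (at x)" "p differentiable (at x)" if x: "x \<in> D" for x i
    using assms(2-4) x pu differentiable_cong_open[OF assms(1) x, of u' u]
      differentiable_cong_open[OF assms(1) x, of p' p] differentiable_cong_open[OF assms(1) x, of "partial_deriv i u'" "partial_deriv i u"]
    unfolding navier_stokes_on_def by auto
  ultimately show ?thesis using assms(4) unfolding navier_stokes_on_def by simp
qed

lemma Ck_on_subset_cong:
  assumes "\<And>x. x \<in> A \<Longrightarrow> f x = g x" "Ck_on_subset k g A"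
  shows "Ck_on_subset k f A"
  using assms unfolding Ck_on_subset_def by (metis IntD2)

lemma corresponding_pair_solution:
  assumes sol: "is_solution_profile \<tau> \<sigma> v" and cp: "corresponding_pair v u p"
  shows "homogeneous_axisymmetric_noswirl_C2_solution u p"
proof -
  obtain u' p' where cp': "corresponding_pair v u' p'" and sm: "smooth_on_subset u' punctured_sphere"
    and ns: "navier_stokes_on slit_space u' p'"
    using sol unfolding is_solution_profile_def by blast
  note eq = corresponding_pair_unique[OF cp cp']
  have "navier_stokes_on slit_space u p"
    by (rule navier_stokes_on_cong[OF open_slit_space eq ns])
  moreover have "Ck_on_subset 2 u punctured_sphere"
  proof (rule Ck_on_subset_cong)
    show "u x = u' x" if "x \<in> punctured_sphere" for x
      using that eq(1) punctured_sphere_subset by blast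
    show "Ck_on_subset 2 u' punctured_sphere" using sm by (simp add: smooth_on_subset_def)
  qed
  moreover have "axisymmetric u" "no_swirl u"
    unfolding axisymmetric_def no_swirl_def
    by (auto simp: corresponding_pair_value[OF cp] inner_add_left frame_inner)
  ultimately show ?thesis using cp
    unfolding homogeneous_axisymmetric_noswirl_C2_solution_def corresponding_pair_def by blast
qed

section \<open>Passing from the polar angle to its cosine\<close>

lemma deriv_eq_on_open:
  fixes f g :: "real \<Rightarrow> real"
  assumes "open S" "\<And>x. x \<in> S \<Longrightarrow> f x = g x" "x \<in> S" "(g has_real_derivative d) (at x)"
  shows "deriv f x = d"
  by (rule DERIV_imp_deriv, rule has_field_derivative_transform_within_open[OF assms(4,1,3)]) (simp add: assms(2))

lemma cos_in_open_interval:
  assumes "0 < \<theta>" "\<theta> < pi" shows "-1 < cos \<theta>" "cos \<theta> < 1"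
  using assms cos_monotone_0_pi[of \<theta> pi] cos_monotone_0_pi[of 0 \<theta>] by auto

text \<open>\<open>B\<close> is the radial component as a function of the cosine. It comes with
  derivatives of its own, because writing them through \<open>G\<close> would require a third
  derivative of \<open>G\<close>. With t = cos \<theta>, d/d\<theta> becomes -sin \<theta>
  d/dt.\<close>

lemma profile_components:
  assumes v: "\<And>\<theta>. 0 < \<theta> \<Longrightarrow> \<theta> < pi \<Longrightarrow> v \<theta> = G (cos \<theta>) * sin \<theta>"
    and G: "\<And>t. -1 < t \<Longrightarrow> t < 1 \<Longrightarrow> (G has_real_derivative G1 t) (at t)"
    and B: "\<And>t. -1 < t \<Longrightarrow> t < 1 \<Longrightarrow> B t = (1 - t\<^sup>2) * G1 t - 2 * t * G t"
    and B1: "\<And>t. -1 < t \<Longrightarrow> t < 1 \<Longrightarrow> (B has_real_derivative B1 t) (at t)"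
    and B2: "\<And>t. -1 < t \<Longrightarrow> t < 1 \<Longrightarrow> (B1 has_real_derivative B2 t) (at t)"
    and \<theta>: "0 < \<theta>" "\<theta> < pi" and q: "q = cos \<theta>"
  shows "radial_component v \<theta> = B q"
    and "pressure_profile v \<theta> = - ((1 - q\<^sup>2) * B2 q - 2 * q * B1 q + (1 - q\<^sup>2) * G q * B1 q + (B q)\<^sup>2 + (1 - q\<^sup>2) * (G q)\<^sup>2) / 2"
proof -
  note c = cos_in_open_interval
  have dc: "((\<lambda>\<theta>. F (cos \<theta>)) has_real_derivative - sin t * F' (cos t)) (at t)"
    if "0 < t" "t < pi" "\<And>t. -1 < t \<Longrightarrow> t < 1 \<Longrightarrow> (F has_real_derivative F' t) (at t)" for F F' t
    using DERIV_chain2[OF that(3)[OF c[OF that(1,2)]] DERIV_cos] by (simp add: mult.commute)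
  have s: "sin t * sin t = 1 - cos t * cos t" for t :: real using cos_sq[of t] by simp
  have r: "radial_component v t = B (cos t)" if t: "t \<in> {0<..<pi}" for t
  proof -
    have "((\<lambda>\<theta>. G (cos \<theta>) * sin \<theta>) has_real_derivative - sin t * G1 (cos t) * sin t + cos t * G (cos t)) (at t)"
      using t by (intro DERIV_mult dc G DERIV_sin) auto
    then have "deriv v t = - sin t * G1 (cos t) * sin t + cos t * G (cos t)"
      by (rule deriv_eq_on_open[of "{0<..<pi}", rotated 3]) (use t v in auto)
    moreover have "sin t > 0" using t sin_gt_zero by auto
    moreover from this have "cot t * v t = cos t * G (cos t)" using t by (simp add: v cot_def)
    ultimately show ?thesis using t B[OF c[of t]] s[of t]
      unfolding radial_component_def by simp (simp add: power2_eq_square)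
  qed
  then show "radial_component v \<theta> = B q" using \<theta> q by simp
  have r1: "deriv (radial_component v) t = - sin t * B1 (cos t)" if t: "t \<in> {0<..<pi}" for t
    by (rule deriv_eq_on_open[of "{0<..<pi}" _ "\<lambda>t. B (cos t)"]) (use t r dc[OF _ _ B1] in auto)
  have r2: "deriv (deriv (radial_component v)) t = sin t * sin t * B2 (cos t) - cos t * B1 (cos t)" if t: "t \<in> {0<..<pi}" for t
  proof (rule deriv_eq_on_open[of "{0<..<pi}" _ "\<lambda>t. - sin t * B1 (cos t)"])
    have "((\<lambda>t. - sin t * B1 (cos t)) has_real_derivative - cos t * B1 (cos t) + - sin t * B2 (cos t) * - sin t) (at t)"
      using t by (intro DERIV_mult dc B2 DERIV_minus DERIV_sin) auto
    then show "((\<lambda>t. - sin t * B1 (cos t)) has_real_derivative sin t * sin t * B2 (cos t) - cos t * B1 (cos t)) (at t)"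
      by (rule DERIV_cong) simp
  qed (use t r1 in auto)
  have "sin \<theta> \<noteq> 0" using \<theta> sin_gt_zero by force
  then have "pressure_profile v \<theta> = - (sin \<theta> * sin \<theta> * B2 q - 2 * q * B1 q + sin \<theta> * sin \<theta> * G q * B1 q + (B q)\<^sup>2 + sin \<theta> * sin \<theta> * (G q)\<^sup>2) / 2"
    using \<theta> unfolding pressure_profile_def q
    by (simp add: r r1 r2 v cot_def algebra_simps power2_eq_square)
  then show "pressure_profile v \<theta> = - ((1 - q\<^sup>2) * B2 q - 2 * q * B1 q + (1 - q\<^sup>2) * G q * B1 q + (B q)\<^sup>2 + (1 - q\<^sup>2) * (G q)\<^sup>2) / 2"
    unfolding s q power2_eq_square[of "cos \<theta>"] .
qed

context riccati_flow
begin

lemma smooth_on_punctured_sphere: "smooth_on_subset u punctured_sphere"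
  unfolding smooth_on_subset_def Ck_on_subset_def
  using open_slit_space smooth punctured_sphere_subset by blast

end

section \<open>Reduction to a first integral\<close>

text \<open>The half circle \<phi> = 0 parametrised by t = cos \<theta>; the profiles of a given
  field are read off along it.\<close>

definition meridian :: "real \<Rightarrow> real^3"
  where "meridian t = sqrt (1 - t\<^sup>2) *\<^sub>R axis 1 1 + t *\<^sub>R axis 3 1"

lemma meridian_nth [simp]: "meridian t $ 1 = sqrt (1 - t\<^sup>2)" "meridian t $ 2 = 0" "meridian t $ 3 = t"
  by (simp_all add: meridian_def axis_def)

lemma one_minus_sq_pos: "-1 < t \<Longrightarrow> t < 1 \<Longrightarrow> 0 < 1 - t\<^sup>2" for t :: real
  by (simp add: abs_square_less_1 abs_less_iff)

lemma meridian_spherical: "0 < \<theta> \<Longrightarrow> \<theta> < pi \<Longrightarrow> meridian (cos \<theta>) = spherical_point 1 \<theta> 0"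
proof -
  assume "0 < \<theta>" "\<theta> < pi"
  then have "sqrt (1 - (cos \<theta>)\<^sup>2) = sin \<theta>"
    using sin_gt_zero[of \<theta>] by (simp add: sin_squared_eq[symmetric])
  then show ?thesis by (simp add: vec_eq_iff forall_3 spherical_point_def)
qed

lemma arccos_cases:
  assumes "-1 < t" "t < 1"
  obtains \<theta> where "0 < \<theta>" "\<theta> < pi" "t = cos \<theta>"
  using arccos_lt_bounded[OF assms] cos_arccos[of t] assms by (metis less_imp_le)

lemma meridian_off_axis: "-1 < t \<Longrightarrow> t < 1 \<Longrightarrow> meridian t \<in> off_axis"
  using one_minus_sq_pos[of t] by (simp add: off_axis_def)

lemma meridian_sphere: "-1 < t \<Longrightarrow> t < 1 \<Longrightarrow> norm (meridian t) = 1"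
  by (rule arccos_cases) (auto simp: meridian_spherical)

lemma cos_polar_meridian: "-1 < t \<Longrightarrow> t < 1 \<Longrightarrow> cos_polar (meridian t) = t"
  using meridian_sphere by (simp add: cos_polar_def)

lemma sqrt_one_minus_sq_deriv:
  assumes "-1 < t" "t < 1"
  shows "((\<lambda>t. sqrt (1 - t\<^sup>2)) has_real_derivative - t / sqrt (1 - t\<^sup>2)) (at t)"
proof -
  have "((\<lambda>t. 1 - t\<^sup>2) has_real_derivative - (2 * t)) (at t)" by (auto intro!: derivative_eq_intros)
  from DERIV_chain2[OF DERIV_real_sqrt[OF one_minus_sq_pos[OF assms]] this]
  moreover have "inverse r / 2 * - (2 * t) = - t / r" for r by (cases "r = 0") (simp_all add: field_simps)
  ultimately show ?thesis by (rule DERIV_cong)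
qed

lemma meridian_chain:
  fixes g :: "real^3 \<Rightarrow> real"
  assumes "-1 < t" "t < 1" "g differentiable (at (meridian t))"
  shows "((\<lambda>t. g (meridian t)) has_real_derivative
     (- t / sqrt (1 - t\<^sup>2)) * partial_deriv 1 g (meridian t) + partial_deriv 3 g (meridian t)) (at t)"
proof -
  let ?D = "frechet_derivative g (at (meridian t))"
  have m: "(meridian has_derivative (\<lambda>h. (- t / sqrt (1 - t\<^sup>2) * h) *\<^sub>R axis 1 1 + h *\<^sub>R axis 3 1)) (at t)"
    unfolding meridian_def[abs_def]
    by (intro has_derivative_add has_derivative_scaleR_left has_derivative_ident
        sqrt_one_minus_sq_deriv[OF assms(1,2), unfolded has_field_derivative_def])
  have g: "(g has_derivative ?D) (at (meridian t))"
    using assms(3) by (simp add: frechet_derivative_works)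
  then interpret D: bounded_linear ?D by (rule has_derivative_bounded_linear)
  have "((\<lambda>t. g (meridian t)) has_derivative
     (\<lambda>h. ?D ((- t / sqrt (1 - t\<^sup>2) * h) *\<^sub>R axis 1 1 + h *\<^sub>R axis 3 1))) (at t)"
    by (rule has_derivative_compose[OF m g])
  then show ?thesis
    unfolding has_field_derivative_def partial_deriv_def D.add D.scaleR
    by (rule has_derivative_eq_rhs) (simp add: fun_eq_iff algebra_simps)
qed

text \<open>Two derivatives without continuity of the second, exactly what
  \<open>navier_stokes_on\<close> provides along the meridian.\<close>

definition twice_diff :: "(real \<Rightarrow> real) \<Rightarrow> bool"
  where "twice_diff f \<longleftrightarrow> (\<exists>f1 f2. \<forall>t. -1 < t \<and> t < 1 \<longrightarrow>
     (f has_real_derivative f1 t) (at t) \<and> (f1 has_real_derivative f2 t) (at t))"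

lemma twice_diffE:
  assumes "twice_diff f"
  obtains f1 f2 where "\<And>t. -1 < t \<Longrightarrow> t < 1 \<Longrightarrow> (f has_real_derivative f1 t) (at t)"
    "\<And>t. -1 < t \<Longrightarrow> t < 1 \<Longrightarrow> (f1 has_real_derivative f2 t) (at t)"
  using assms unfolding twice_diff_def by blast

lemma twice_diffI:
  assumes "\<And>t. -1 < t \<Longrightarrow> t < 1 \<Longrightarrow> (f has_real_derivative f1 t) (at t)"
    "\<And>t. -1 < t \<Longrightarrow> t < 1 \<Longrightarrow> (f1 has_real_derivative f2 t) (at t)"
  shows "twice_diff f"
  using assms unfolding twice_diff_def by blast

lemma twice_diff_mult:
  assumes "twice_diff f" "twice_diff g"
  shows "twice_diff (\<lambda>t. f t * g t)"
proof -
  obtain f1 f2 where f: "\<And>t. -1 < t \<Longrightarrow> t < 1 \<Longrightarrow> (f has_real_derivative f1 t) (at t)"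
    "\<And>t. -1 < t \<Longrightarrow> t < 1 \<Longrightarrow> (f1 has_real_derivative f2 t) (at t)" using twice_diffE[OF assms(1)] by blast
  obtain g1 g2 where g: "\<And>t. -1 < t \<Longrightarrow> t < 1 \<Longrightarrow> (g has_real_derivative g1 t) (at t)"
    "\<And>t. -1 < t \<Longrightarrow> t < 1 \<Longrightarrow> (g1 has_real_derivative g2 t) (at t)" using twice_diffE[OF assms(2)] by blast
  show ?thesis
    by (rule twice_diffI[of _ "\<lambda>t. f1 t * g t + g1 t * f t"
         "\<lambda>t. (f2 t * g t + g1 t * f1 t) + (g2 t * f t + f1 t * g1 t)"])
      (intro DERIV_mult DERIV_add f g; assumption)+
qed

lemma twice_diff_diff:
  assumes "twice_diff f" "twice_diff g"
  shows "twice_diff (\<lambda>t. f t - g t)"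
proof -
  obtain f1 f2 where f: "\<And>t. -1 < t \<Longrightarrow> t < 1 \<Longrightarrow> (f has_real_derivative f1 t) (at t)"
    "\<And>t. -1 < t \<Longrightarrow> t < 1 \<Longrightarrow> (f1 has_real_derivative f2 t) (at t)" using twice_diffE[OF assms(1)] by blast
  obtain g1 g2 where g: "\<And>t. -1 < t \<Longrightarrow> t < 1 \<Longrightarrow> (g has_real_derivative g1 t) (at t)"
    "\<And>t. -1 < t \<Longrightarrow> t < 1 \<Longrightarrow> (g1 has_real_derivative g2 t) (at t)" using twice_diffE[OF assms(2)] by blast
  show ?thesis
    by (rule twice_diffI[of _ "\<lambda>t. f1 t - g1 t" "\<lambda>t. f2 t - g2 t"]) (intro DERIV_diff f g; assumption)+
qed

lemma twice_diff_ident: "twice_diff (\<lambda>t. t)"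
  by (rule twice_diffI[of _ "\<lambda>t. 1" "\<lambda>t. 0"]) (auto intro!: derivative_eq_intros)

lemma twice_diff_inverse_sqrt: "twice_diff (\<lambda>t. inverse (sqrt (1 - t\<^sup>2)))"
proof -
  have 1: "((\<lambda>t. inverse (sqrt (1 - t\<^sup>2))) has_real_derivative t * inverse (sqrt (1 - t\<^sup>2)) ^ 3) (at t)"
    if t: "-1 < t" "t < 1" for t :: real
  proof -
    have s: "sqrt (1 - t\<^sup>2) \<noteq> 0" using one_minus_sq_pos[OF t] by simp
    have "- (- t / r * inverse (r ^ Suc (Suc 0))) = t * inverse r ^ 3" for r :: real
      by (simp add: divide_inverse power3_eq_cube)
    then show ?thesis
      by (rule DERIV_cong[OF DERIV_inverse_fun[OF sqrt_one_minus_sq_deriv[OF t] s]])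
  qed
  show ?thesis
  proof (rule twice_diffI[OF 1])
    fix t :: real assume t: "-1 < t" "t < 1"
    show "((\<lambda>t. t * inverse (sqrt (1 - t\<^sup>2)) ^ 3) has_real_derivative
       1 * inverse (sqrt (1 - t\<^sup>2)) ^ 3 + of_nat 3 * (t * inverse (sqrt (1 - t\<^sup>2)) ^ 3 * inverse (sqrt (1 - t\<^sup>2)) ^ (3 - Suc 0)) * t) (at t)"
      by (intro DERIV_mult DERIV_ident DERIV_power 1 t)
  qed
qed

lemma twice_diff_meridian:
  fixes u :: "real^3 \<Rightarrow> real^3"
  assumes "\<And>x. x \<in> slit_space \<Longrightarrow> u differentiable (at x)"
    "\<And>x i. x \<in> slit_space \<Longrightarrow> partial_deriv i u differentiable (at x)"
  shows "twice_diff (\<lambda>t. u (meridian t) $ j)"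
proof -
  have nth: "(\<lambda>x. f x $ j) differentiable (at x)" "partial_deriv i (\<lambda>x. f x $ j) x = partial_deriv i f x $ j"
    if "f differentiable (at x)" for f :: "real^3 \<Rightarrow> real^3" and x i
  proof -
    have "((\<lambda>x. f x $ j) has_derivative (\<lambda>h. frechet_derivative f (at x) h $ j)) (at x)"
      using that by (intro bounded_linear.has_derivative[OF bounded_linear_vec_nth]) (simp add: frechet_derivative_works)
    then show "(\<lambda>x. f x $ j) differentiable (at x)" "partial_deriv i (\<lambda>x. f x $ j) x = partial_deriv i f x $ j"
      using partial_deriv_eq by (auto simp: differentiable_def partial_deriv_def[of i f])
  qed
  have m: "meridian t \<in> slit_space" if "-1 < t" "t < 1" for t
    using meridian_off_axis[OF that] off_axis_subset by blast
  define f1 where "f1 t = (- t / sqrt (1 - t\<^sup>2)) * partial_deriv 1 u (meridian t) $ j + partial_deriv 3 u (meridian t) $ j" for t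
  have 1: "((\<lambda>t. u (meridian t) $ j) has_real_derivative f1 t) (at t)" if t: "-1 < t" "t < 1" for t
    using meridian_chain[OF t nth(1)[OF assms(1)[OF m[OF t]]]]
    unfolding nth(2)[OF assms(1)[OF m[OF t]]] f1_def .
  have "f1 differentiable (at t)" if t: "-1 < t" "t < 1" for t
  proof -
    have p: "(\<lambda>t. partial_deriv i u (meridian t) $ j) differentiable (at t)" for i
      using meridian_chain[OF t nth(1)[OF assms(2)[OF m[OF t]]], of i] real_differentiable_def by blast
    have "(\<lambda>t. sqrt (1 - t\<^sup>2)) differentiable (at t)"
      using sqrt_one_minus_sq_deriv[OF t] real_differentiable_def by blast
    then show ?thesis
      unfolding f1_def[abs_def] using one_minus_sq_pos[OF t]
      by (intro derivative_intros p) auto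
  qed
  then have "(f1 has_real_derivative deriv f1 t) (at t)" if "-1 < t" "t < 1" for t
    using that by (metis DERIV_deriv_iff_real_differentiable)
  with 1 show ?thesis by (rule twice_diffI)
qed

lemma arccos_at_left_1: "filterlim arccos (at_right 0) (at_left 1)"
proof -
  have "(arccos \<longlongrightarrow> arccos 1) (at 1 within {-1..1})"
    using continuous_on_arccos' unfolding continuous_on_def by (rule bspec) simp
  then have "(arccos \<longlongrightarrow> 0) (at_left 1)" using at_within_Icc_at_left[of "-1" "1::real"] by simp
  moreover have "\<forall>\<^sub>F t in at_left 1. arccos t \<in> {0<..}"
    using eventually_at_left_real[of "-1" "1::real"] by (rule eventually_mono) (auto simp: arccos_lt_bounded)
  ultimately show ?thesis by (simp add: filterlim_at eventually_conj_iff) (auto elim: eventually_mono)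
qed

lemma at_left_1_interval: "\<forall>\<^sub>F t in at_left (1::real). -1 < t \<and> t < 1"
  using eventually_at_left_real[of "-1" "1::real"] by (simp add: conj_commute)

lemma constant_of_zero_derivative:
  fixes f :: "real \<Rightarrow> real"
  assumes "\<And>t. -1 < t \<Longrightarrow> t < 1 \<Longrightarrow> (f has_real_derivative 0) (at t)" "-1 < t" "t < 1"
  shows "f t = f 0"
  using DERIV_isconst3[of "-1" 1 t 0 f] assms by auto

text \<open>Serves both directions: D is \<open>off_axis\<close> for a given solution, whose
  profiles are known only on (-1, 1), and \<open>slit_space\<close> for a constructed flow.\<close>

locale axial_flow = conical_flow +
  assumes off_axis_D: "off_axis \<subseteq> D"
    and ns: "navier_stokes_on slit_space u p"
begin

lemma interval_derivs:
  assumes t: "-1 < t" "t < 1"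
  shows "(A has_real_derivative A1 t) (at t)" "(A1 has_real_derivative A2 t) (at t)"
    "(G has_real_derivative G1 t) (at t)" "(G1 has_real_derivative G2 t) (at t)"
    "(P has_real_derivative P1 t) (at t)"
proof -
  have m: "meridian t \<in> D" using meridian_off_axis[OF t] off_axis_D by blast
  show "(A has_real_derivative A1 t) (at t)" "(A1 has_real_derivative A2 t) (at t)"
    "(G has_real_derivative G1 t) (at t)" "(G1 has_real_derivative G2 t) (at t)"
    "(P has_real_derivative P1 t) (at t)"
    using A.F[OF m] A.F1[OF m] G.F[OF m] G.F1[OF m] P[OF m] unfolding cos_polar_meridian[OF t] by simp_all
qed

lemma A_eq:
  assumes t: "-1 < t" "t < 1"
  shows "A t = (1 - t\<^sup>2) * G1 t - t * G t"
proof -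
  have m: "meridian t \<in> D" "meridian t \<in> slit_space"
    using meridian_off_axis[OF t] off_axis_D off_axis_subset by blast+
  have "divergence u (meridian t) = 0" using ns m(2) unfolding navier_stokes_on_def by blast
  then show ?thesis
    unfolding divergence_u[OF m(1)] hom_lift_def cos_polar_meridian[OF t] meridian_sphere[OF t] by simp
qed

lemma A1_eq:
  assumes t: "-1 < t" "t < 1"
  shows "A1 t = (1 - t\<^sup>2) * G2 t - 3 * t * G1 t - G t"
proof -
  have "((\<lambda>t. (1 - t\<^sup>2) * G1 t - t * G t) has_real_derivative (1 - t\<^sup>2) * G2 t - 3 * t * G1 t - G t) (at t)"
    using interval_derivs[OF t] by (auto intro!: derivative_eq_intros)
  then have "(A has_real_derivative (1 - t\<^sup>2) * G2 t - 3 * t * G1 t - G t) (at t)"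
    by (rule has_field_derivative_transform_within_open[of _ _ _ "{-1<..<1}"]) (use t A_eq in auto)
  then show ?thesis using interval_derivs(1)[OF t] DERIV_unique by blast
qed

text \<open>Off the axis \<open>x\<close> and \<open>e_3\<close> are independent: the first
  coordinate, where \<open>e_3\<close> is zero and the meridian is positive, isolates the
  \<open>x\<close> residual.\<close>

lemma residuals_zero:
  assumes t: "-1 < t" "t < 1"
  shows "x_residual t = 0" "e_residual t = 0"
proof -
  have m: "meridian t \<in> D" "meridian t \<in> slit_space"
    using meridian_off_axis[OF t] off_axis_D off_axis_subset by blast+
  have "hom_lift 4 x_residual (meridian t) *\<^sub>R meridian t + hom_lift 3 e_residual (meridian t) *\<^sub>R axis 3 1 = 0"
    using ns m(2) unfolding navier_stokes_on_def momentum[OF m(1), symmetric] by blast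
  then have "x_residual t *\<^sub>R meridian t + e_residual t *\<^sub>R axis 3 1 = 0"
    unfolding hom_lift_def cos_polar_meridian[OF t] meridian_sphere[OF t] by simp
  then have *: "x_residual t * meridian t $ i + e_residual t * axis 3 1 $ i = 0" for i
    by (metis vector_add_component vector_scaleR_component zero_index real_scaleR_def)
  show "x_residual t = 0" using *[of 1] one_minus_sq_pos[OF t] by (simp add: axis_def)
  then show "e_residual t = 0" using *[of 3] by (simp add: axis_def)
qed

text \<open>The profile of the radial component \<open>u_r\<close>.\<close>

definition "B t = A t - t * G t"
definition "B1 t = A1 t - G t - t * G1 t"
definition "B2 t = A2 t - 2 * G1 t - t * G2 t"

lemma B_derivs:
  assumes t: "-1 < t" "t < 1"
  shows "(B has_real_derivative B1 t) (at t)" "(B1 has_real_derivative B2 t) (at t)"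
  unfolding B_def[abs_def] B1_def[abs_def] B1_def B2_def using interval_derivs[OF t]
  by (auto intro!: derivative_eq_intros)

lemma B_eq: "-1 < t \<Longrightarrow> t < 1 \<Longrightarrow> B t = (1 - t\<^sup>2) * G1 t - 2 * t * G t"
  using A_eq[of t] by (simp add: B_def)

lemma polar_momentum:
  assumes t: "-1 < t" "t < 1"
  shows "P1 t = B1 t - G t * A t"
  using residuals_zero(2)[OF t] unfolding e_residual_def B1_def A1_eq[OF t] A_eq[OF t]
  by (simp add: algebra_simps power2_eq_square)

text \<open>On the unit sphere the component of the momentum equation along \<open>e_r\<close> is
  \<open>x_residual\<close> plus t times \<open>e_residual\<close>; solved for \<open>P\<close> it
  is the pressure formula.\<close>

lemma radial_momentum:
  assumes t: "-1 < t" "t < 1"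
  shows "P t = - ((1 - t\<^sup>2) * B2 t - 2 * t * B1 t + (1 - t\<^sup>2) * G t * B1 t + (B t)\<^sup>2 + (1 - t\<^sup>2) * (G t)\<^sup>2) / 2"
proof -
  have "t * e_residual t = 0" "x_residual t = 0" using residuals_zero[OF t] by simp_all
  then show ?thesis
    unfolding x_residual_def e_residual_def B_def B1_def B2_def A1_eq[OF t] A_eq[OF t]
    by (simp add: algebra_simps power2_eq_square)
qed

text \<open>The radial component is dictated by the divergence and the pressure by radial momentum;
  continuity on the axis follows from the differentiability in \<open>ns\<close>.\<close>

lemma corresponding:
  assumes hom: "homogeneous_on slit_space (-1) u" "homogeneous_on slit_space (-2) p"
    and v: "\<And>\<theta>. 0 < \<theta> \<Longrightarrow> \<theta> < pi \<Longrightarrow> v \<theta> = G (cos \<theta>) * sin \<theta>"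
  shows "corresponding_pair v u p"
proof -
  have "u (spherical_point 1 \<theta> \<phi>) = radial_component v \<theta> *\<^sub>R e_r \<theta> \<phi> + v \<theta> *\<^sub>R e_theta \<theta> \<phi> \<and>
       p (spherical_point 1 \<theta> \<phi>) = pressure_profile v \<theta>" if t: "0 < \<theta>" "\<theta> < pi" for \<theta> \<phi>
  proof -
    define q where "q = cos \<theta>"
    have q: "-1 < q" "q < 1" using cos_in_open_interval t q_def by auto
    have pc1: "radial_component v \<theta> = B q"
      by (rule profile_components(1)[OF _ _ _ _ _ t q_def])
        ((rule v interval_derivs(3) B_eq B_derivs; assumption)+)
    have pc2: "pressure_profile v \<theta> = P q" unfolding radial_momentum[OF q]
      by (rule profile_components(2)[OF _ _ _ _ _ t q_def])
        ((rule v interval_derivs(3) B_eq B_derivs; assumption)+)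
    have m: "spherical_point 1 \<theta> \<phi> \<in> D"
      using spherical_point_off_axis[of 1 \<theta> \<phi>] t off_axis_D by auto
    have cp: "cos_polar (spherical_point 1 \<theta> \<phi>) = q" using cos_polar_spherical_point[of 1] q_def by simp
    have "u (spherical_point 1 \<theta> \<phi>) = A q *\<^sub>R e_r \<theta> \<phi> - G q *\<^sub>R axis 3 1"
      unfolding u[OF m] hom_lift_def cp norm_spherical_point by (simp add: spherical_point_def)
    moreover have "v \<theta> *\<^sub>R e_theta \<theta> \<phi> = G q *\<^sub>R (q *\<^sub>R e_r \<theta> \<phi> - axis 3 1)"
      using v[OF t] sin_e_theta[of \<theta> \<phi>] by (simp add: q_def flip: scaleR_scaleR)
    moreover have "p (spherical_point 1 \<theta> \<phi>) = P q"
      unfolding p[OF m] hom_lift_def cp norm_spherical_point by simp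
    ultimately show ?thesis
      unfolding pc1 pc2 by (simp add: B_def scaleR_left_diff_distrib scaleR_right_diff_distrib mult.commute)
  qed
  moreover have "continuous_on slit_space u" "continuous_on slit_space p"
    using ns unfolding navier_stokes_on_def
    by (blast intro: continuous_at_imp_continuous_on differentiable_imp_continuous_within)+
  ultimately show ?thesis unfolding corresponding_pair_def using hom by auto
qed

text \<open>With \<open>U = (1 - t\<^sup>2) G = u\<^sub>\<theta> sin \<theta>\<close>, the function \<open>(1 - t\<^sup>2) U' + 2 t U + U\<^sup>2 / 2\<close> is a
  quadratic polynomial for every solution. Differentiability at the north pole makes it vanish to
  second order at \<open>t = 1\<close>.\<close>

lemma first_integral:
  assumes A_lim: "(A \<longlongrightarrow> l) (at_left 1)" and u3_lim: "((\<lambda>t. t * A t - G t) \<longlongrightarrow> m) (at_left 1)"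
  obtains c where "\<And>t. -1 < t \<Longrightarrow> t < 1 \<Longrightarrow> (1 + t)\<^sup>2 * (G1 t + (G t)\<^sup>2 / 2) = c"
    and "(G \<longlongrightarrow> l - m) (at_left 1)"
proof -
  define U where "U t = (1 - t\<^sup>2) * G t" for t
  define E where "E t = (1 - t\<^sup>2) * B t + 2 * t * U t + (U t)\<^sup>2 / 2" for t
  define E1 where "E1 t = (1 - t\<^sup>2) * B1 t + 2 * U t + U t * B t" for t
  note ivl = interval_derivs B_derivs
  have dU: "(U has_real_derivative B t) (at t)" if t: "-1 < t" "t < 1" for t
    unfolding U_def[abs_def] B_eq[OF t] using ivl[OF t] by (auto intro!: derivative_eq_intros)
  have dE: "(E has_real_derivative E1 t) (at t)" if t: "-1 < t" "t < 1" for t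
    unfolding E_def[abs_def] E1_def using ivl[OF t] dU[OF t]
    by (auto intro!: derivative_eq_intros simp: algebra_simps)
  have dE1: "(E1 has_real_derivative (1 - t\<^sup>2) * B2 t - 2 * t * B1 t + 2 * B t + (B t)\<^sup>2 + U t * B1 t) (at t)"
    if t: "-1 < t" "t < 1" for t
    unfolding E1_def[abs_def] using ivl[OF t] dU[OF t]
    by (auto intro!: derivative_eq_intros simp: algebra_simps power2_eq_square)
  \<comment> \<open>Integral of the polar momentum equation: (1 - t^2) G^2 / 2 is an antiderivative
    of G A.\<close>
  define Q where "Q t = P t - B t + (1 - t\<^sup>2) * (G t)\<^sup>2 / 2" for t
  have dQ: "(Q has_real_derivative 0) (at t)" if t: "-1 < t" "t < 1" for t
  proof -
    have "(Q has_real_derivative P1 t - B1 t + (- t * (G t)\<^sup>2 + (1 - t\<^sup>2) * G t * G1 t)) (at t)"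
      unfolding Q_def[abs_def] using ivl[OF t]
      by (auto intro!: derivative_eq_intros simp: field_simps)
    moreover have "P1 t - B1 t + (- t * (G t)\<^sup>2 + (1 - t\<^sup>2) * G t * G1 t) = 0"
      unfolding polar_momentum[OF t] A_eq[OF t] by (simp add: algebra_simps power2_eq_square)
    ultimately show ?thesis by simp
  qed
  define C where "C = Q 0"
  have P_eq: "P t = B t - (1 - t\<^sup>2) * (G t)\<^sup>2 / 2 + C" if t: "-1 < t" "t < 1" for t
    using constant_of_zero_derivative[OF dQ t] unfolding C_def by (simp add: Q_def)
  \<comment> \<open>With the pressure eliminated, radial momentum says that the second derivative of
    \<open>E\<close> is -2C. Two integrations make \<open>E\<close> quadratic.\<close>
  have "((\<lambda>t. E1 t + 2 * C * t) has_real_derivative 0) (at t)" if t: "-1 < t" "t < 1" for t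
  proof -
    have "((\<lambda>t. E1 t + 2 * C * t) has_real_derivative
      ((1 - t\<^sup>2) * B2 t - 2 * t * B1 t + 2 * B t + (B t)\<^sup>2 + U t * B1 t) + 2 * C) (at t)"
      using dE1[OF t] by (auto intro!: derivative_eq_intros)
    moreover have "((1 - t\<^sup>2) * B2 t - 2 * t * B1 t + 2 * B t + (B t)\<^sup>2 + U t * B1 t) + 2 * C = 0"
      using radial_momentum[OF t] P_eq[OF t] unfolding U_def by (simp add: field_simps)
    ultimately show ?thesis by simp
  qed
  from constant_of_zero_derivative[OF this]
  have E1_eq: "E1 t = E1 0 - 2 * C * t" if "-1 < t" "t < 1" for t using that by force
  have "((\<lambda>t. E t - E1 0 * t + C * t\<^sup>2) has_real_derivative 0) (at t)" if t: "-1 < t" "t < 1" for t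
    using dE[OF t] E1_eq[OF t] by (auto intro!: derivative_eq_intros)
  from constant_of_zero_derivative[OF this]
  have E_eq: "E t = E 0 + E1 0 * t - C * t\<^sup>2" if "-1 < t" "t < 1" for t using that by force
  have ident: "((\<lambda>t. t) \<longlongrightarrow> 1) (at_left (1::real))" by (rule tendsto_ident_at)
  have "((\<lambda>t. t * A t - (t * A t - G t)) \<longlongrightarrow> 1 * l - m) (at_left 1)"
    by (intro tendsto_intros A_lim u3_lim)
  then have G_lim: "(G \<longlongrightarrow> l - m) (at_left 1)" by simp
  have "((\<lambda>t. A t - t * G t) \<longlongrightarrow> l - 1 * (l - m)) (at_left 1)"
    by (intro tendsto_intros A_lim G_lim)
  then have B_lim: "(B \<longlongrightarrow> m) (at_left 1)" unfolding B_def[abs_def] by simp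
  have "((\<lambda>t. (1 - t\<^sup>2) * G t) \<longlongrightarrow> (1 - 1\<^sup>2) * (l - m)) (at_left 1)"
    by (intro tendsto_intros G_lim)
  then have U_lim: "(U \<longlongrightarrow> 0) (at_left 1)" unfolding U_def[abs_def] by simp
  \<comment> \<open>The same quotient is evaluated twice, by l'Hopital through U' = B and directly
    as (1 + t) G. The resulting relation between \<open>l\<close> and \<open>m\<close> is the
    regularity condition at the pole.\<close>
  have "((\<lambda>t. U t / (1 - t)) \<longlongrightarrow> m / -1) (at_left 1)"
  proof (rule lhopital_left[OF U_lim])
    have "((\<lambda>t::real. 1 - t) \<longlongrightarrow> 1 - 1) (at_left 1)" by (intro tendsto_intros)
    then show "((\<lambda>t::real. 1 - t) \<longlongrightarrow> 0) (at_left 1)" by simp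
    show "\<forall>\<^sub>F t in at_left 1. (U has_real_derivative B t) (at t)"
      using at_left_1_interval by (rule eventually_mono) (use dU in blast)
    show "\<forall>\<^sub>F t in at_left 1. 1 - t \<noteq> (0::real)"
      using at_left_1_interval by (rule eventually_mono) simp
    show "\<forall>\<^sub>F t in at_left 1. ((\<lambda>t. 1 - t) has_real_derivative - 1) (at t)"
      by (intro always_eventually allI) (auto intro!: derivative_eq_intros)
    show "((\<lambda>t. B t / - 1) \<longlongrightarrow> m / - 1) (at_left 1)" by (intro tendsto_intros B_lim) simp
  qed simp
  moreover have "((\<lambda>t. U t / (1 - t)) \<longlongrightarrow> (1 + 1) * (l - m)) (at_left 1)"
  proof (rule Lim_transform_eventually)
    show "((\<lambda>t. (1 + t) * G t) \<longlongrightarrow> (1 + 1) * (l - m)) (at_left 1)"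
      by (intro tendsto_intros G_lim)
    show "\<forall>\<^sub>F t in at_left 1. (1 + t) * G t = U t / (1 - t)"
      using at_left_1_interval by (rule eventually_mono) (simp add: U_def field_simps power2_eq_square)
  qed
  ultimately have g: "m / -1 = (1 + 1) * (l - m)" by (rule tendsto_unique[OF trivial_limit_at_left_real])
  have E_poly_lim: "((\<lambda>t. E 0 + E1 0 * t - C * t\<^sup>2) \<longlongrightarrow> E 0 + E1 0 * 1 - C * 1\<^sup>2) (at_left 1)"
    by (intro tendsto_intros)
  have "((\<lambda>t. (1 - t\<^sup>2) * B t + 2 * t * U t + (U t)\<^sup>2 / 2) \<longlongrightarrow> (1 - 1\<^sup>2) * m + 2 * 1 * 0 + 0\<^sup>2 / 2) (at_left 1)"
    by (intro tendsto_intros B_lim U_lim) simp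
  then have "(E \<longlongrightarrow> 0) (at_left 1)" unfolding E_def[abs_def] by simp
  moreover have "(E \<longlongrightarrow> E 0 + E1 0 * 1 - C * 1\<^sup>2) (at_left 1)"
    by (rule Lim_transform_eventually[OF E_poly_lim], rule eventually_mono[OF at_left_1_interval])
      (rule E_eq[symmetric]; simp)
  ultimately have e0: "E 0 + E1 0 * 1 - C * 1\<^sup>2 = 0" by (rule tendsto_unique[OF trivial_limit_at_left_real, symmetric])
  have "((\<lambda>t. E t / (1 - t)) \<longlongrightarrow> (1 + 1) * m + 2 * 1 * (1 + 1) * (l - m) + (1 - 1) * (1 + 1)\<^sup>2 * (l - m)\<^sup>2 / 2) (at_left 1)"
  proof (rule Lim_transform_eventually)
    show "((\<lambda>t. (1 + t) * B t + 2 * t * (1 + t) * G t + (1 - t) * (1 + t)\<^sup>2 * (G t)\<^sup>2 / 2) \<longlongrightarrow>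
      (1 + 1) * m + 2 * 1 * (1 + 1) * (l - m) + (1 - 1) * (1 + 1)\<^sup>2 * (l - m)\<^sup>2 / 2) (at_left 1)"
      by (intro tendsto_intros B_lim G_lim) simp
    show "\<forall>\<^sub>F t in at_left 1. (1 + t) * B t + 2 * t * (1 + t) * G t + (1 - t) * (1 + t)\<^sup>2 * (G t)\<^sup>2 / 2 = E t / (1 - t)"
      using at_left_1_interval
      by (rule eventually_mono) (simp add: E_def U_def field_simps power2_eq_square)
  qed
  moreover have "((\<lambda>t. E t / (1 - t)) \<longlongrightarrow> C * (1 + 1) - E1 0) (at_left 1)"
  proof (rule Lim_transform_eventually)
    show "((\<lambda>t. C * (1 + t) - E1 0) \<longlongrightarrow> C * (1 + 1) - E1 0) (at_left 1)"
      by (intro tendsto_intros)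
    show "\<forall>\<^sub>F t in at_left 1. C * (1 + t) - E1 0 = E t / (1 - t)"
    proof (rule eventually_mono[OF at_left_1_interval])
      fix t :: real assume t: "-1 < t \<and> t < 1"
      have "E t = (C * (1 + t) - E1 0) * (1 - t)"
        using E_eq[of t] t e0 by (simp add: algebra_simps power2_eq_square)
      then show "C * (1 + t) - E1 0 = E t / (1 - t)" using t by simp
    qed
  qed
  ultimately have "(1 + 1) * m + 2 * 1 * (1 + 1) * (l - m) + (1 - 1) * (1 + 1)\<^sup>2 * (l - m)\<^sup>2 / 2 = C * (1 + 1) - E1 0"
    by (rule tendsto_unique[OF trivial_limit_at_left_real])
  \<comment> \<open>By \<open>g\<close> the left side is 0. Together with \<open>e0\<close> this
    makes E = -C (1 - t)^2, and the factor (1 - t)^2 that \<open>E\<close> carries by definition can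
    be cancelled, so c = -C.\<close>
  then have e1: "E1 0 = 2 * C" using g by simp
  have "(1 + t)\<^sup>2 * (G1 t + (G t)\<^sup>2 / 2) = - C" if t: "-1 < t" "t < 1" for t
  proof -
    have "(1 - t)\<^sup>2 * ((1 + t)\<^sup>2 * (G1 t + (G t)\<^sup>2 / 2)) = E t"
      unfolding E_def U_def B_eq[OF t] by (simp add: field_simps power2_eq_square)
    also have "\<dots> = (1 - t)\<^sup>2 * - C"
      using E_eq[OF t] e0 e1 by (simp add: algebra_simps power2_eq_square)
    finally show ?thesis using t by (simp only: mult_cancel_left) simp
  qed
  then show ?thesis using that G_lim by blast
qed

end

section \<open>Explicit solution of the Riccati equation\<close>

text \<open>A Riccati solution \<open>y' = K - y\<^sup>2\<close> is the logarithmic derivative of the solution of the linear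
  equation \<open>\<psi>'' = K \<psi>\<close> with the same data at \<open>0\<close>; hence \<open>\<psi>\<close> cannot vanish where \<open>y\<close> is defined.\<close>

lemma riccati_linearization:
  fixes y \<psi> \<psi>1 :: "real \<Rightarrow> real"
  assumes y: "\<And>s. s < 0 \<Longrightarrow> (y has_real_derivative K - (y s)\<^sup>2) (at s)"
    and y0: "(y \<longlongrightarrow> \<psi>1 0) (at_left 0)"
    and \<psi>: "\<And>s. (\<psi> has_real_derivative \<psi>1 s) (at s)" "\<And>s. (\<psi>1 has_real_derivative K * \<psi> s) (at s)"
    and \<psi>0: "\<psi> 0 = 1" and s: "s < 0"
  shows "\<psi>1 s = y s * \<psi> s"
proof -
  \<comment> \<open>The defect \<open>z\<close> solves z' = -y z and tends to 0 at 0, so it vanishes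
    by a Gronwall argument.\<close>
  define z where "z r = \<psi>1 r - y r * \<psi> r" for r
  have dz: "(z has_real_derivative - y r * z r) (at r)" if "r < 0" for r
    unfolding z_def[abs_def] using y[OF that] \<psi>
    by (auto intro!: derivative_eq_intros simp: algebra_simps power2_eq_square)
  \<comment> \<open>Extending \<open>y\<close> by its limit makes it continuous on a compact
    interval, hence bounded there by some \<open>M\<close>.\<close>
  define y' where "y' r = (if r < 0 then y r else \<psi>1 0)" for r
  have "continuous_on {s..0} y'"
  proof (rule continuous_on_IccI)
    have y_at: "(y' \<longlongrightarrow> y' r) (at r)" if "r < 0" for r
    proof -
      have "(y' has_real_derivative K - (y r)\<^sup>2) (at r)"
        by (rule has_field_derivative_transform_within_open[OF y[OF that], of "{..<0}"]) (use that in \<open>auto simp: y'_def\<close>)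
      then show ?thesis by (metis DERIV_isCont isCont_def)
    qed
    then show "(y' \<longlongrightarrow> y' s) (at_right s)" using s by (metis filterlim_at_split)
    show "(y' \<longlongrightarrow> y' r) (at r)" if "s < r" "r < 0" for r using y_at that by blast
    have "\<forall>\<^sub>F r in at_left 0. y r = y' r"
      using eventually_at_left_real[OF s] by (rule eventually_mono) (auto simp: y'_def)
    then show "(y' \<longlongrightarrow> y' 0) (at_left 0)"
      using Lim_transform_eventually[OF y0] by (simp add: y'_def)
  qed (use s in simp)
  then have "bounded (y' ` {s..0})"
    by (intro compact_imp_bounded compact_continuous_image) auto
  then obtain M where "\<forall>r\<in>{s..0}. \<bar>y' r\<bar> \<le> M" unfolding bounded_iff by auto
  then have M: "y r \<le> M" if "s \<le> r" "r < 0" for r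
    using that by (force simp: y'_def)
  \<comment> \<open>The weight makes \<open>h\<close> nondecreasing because y \<le> M; being
    nonnegative with limit 0 at the right end, it vanishes.\<close>
  define h where "h r = (z r)\<^sup>2 * exp (2 * M * r)" for r
  have mono: "h s \<le> h r" if r: "s \<le> r" "r < 0" for r
  proof (rule DERIV_nonneg_imp_nondecreasing[OF r(1)])
    fix x assume x: "s \<le> x" "x \<le> r"
    have "(h has_real_derivative 2 * (M - y x) * (z x)\<^sup>2 * exp (2 * M * x)) (at x)"
      unfolding h_def[abs_def] using dz[of x] x r
      by (auto intro!: derivative_eq_intros simp: algebra_simps power2_eq_square)
    moreover have "0 \<le> 2 * (M - y x) * (z x)\<^sup>2 * exp (2 * M * x)"
      using M[of x] x r by simp
    ultimately show "\<exists>d. (h has_real_derivative d) (at x) \<and> 0 \<le> d" by blast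
  qed
  have lim: "(\<psi> \<longlongrightarrow> \<psi> 0) (at_left 0)" "(\<psi>1 \<longlongrightarrow> \<psi>1 0) (at_left 0)"
    using \<psi> by (metis DERIV_isCont isCont_def filterlim_at_split)+
  have "((\<lambda>r. (\<psi>1 r - y r * \<psi> r)\<^sup>2 * exp (2 * M * r)) \<longlongrightarrow> (\<psi>1 0 - \<psi>1 0 * \<psi> 0)\<^sup>2 * exp (2 * M * 0)) (at_left 0)"
    by (intro tendsto_intros lim y0)
  then have "(h \<longlongrightarrow> 0) (at_left 0)" by (simp add: h_def[abs_def] z_def \<psi>0)
  then have "h s \<le> 0"
  proof (rule tendsto_lowerbound)
    show "\<forall>\<^sub>F r in at_left 0. h s \<le> h r"
      using eventually_at_left_real[OF s] by (rule eventually_mono) (auto intro: mono)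
  qed simp
  then have "z s = 0" by (simp add: h_def mult_le_0_iff)
  then show ?thesis by (simp add: z_def)
qed

text \<open>\<psi> is written out for each sign of \<open>K\<close>, with \<psi>(0) = 1 and
  \<psi>'(0) = y0; a zero at negative s would force \<psi>' to vanish there too. In
  \<open>hyperbolic\<close> the denominator is 2 k exp(-k s) \<psi>(s). The equilibrium y = -k falls
  under \<open>hyperbolic\<close>, y = k and y = 0 under \<open>stationary\<close>.\<close>

lemma riccati_cases:
  fixes y :: "real \<Rightarrow> real"
  assumes y: "\<And>s. s < 0 \<Longrightarrow> (y has_real_derivative K - (y s)\<^sup>2) (at s)"
    and y0: "(y \<longlongrightarrow> y0) (at_left 0)"
  obtains
    (hyperbolic) k where "k > 0" "y0 < k"
      "\<And>s. s < 0 \<Longrightarrow> (k + y0) + (k - y0) * exp (- (2 * k * s)) \<noteq> 0 \<and>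
        y s * ((k + y0) + (k - y0) * exp (- (2 * k * s))) = k * ((k + y0) - (k - y0) * exp (- (2 * k * s)))"
  | (parabolic) "y0 < 0" "\<And>s. s < 0 \<Longrightarrow> 1 + y0 * s \<noteq> 0 \<and> y s * (1 + y0 * s) = y0"
  | (stationary) "y0 \<ge> 0" "\<And>s. s < 0 \<Longrightarrow> y s = y0"
proof -
  have lin: "\<psi>1 s = y s * \<psi> s"
    if "\<And>s. (\<psi> has_real_derivative \<psi>1 s) (at s)" "\<And>s. (\<psi>1 has_real_derivative K * \<psi> s) (at s)"
      "\<psi> 0 = 1" "\<psi>1 0 = y0" "s < 0" for \<psi> \<psi>1 s
    using riccati_linearization[OF y, of \<psi>1 \<psi> s] y0 that by simp
  consider "K > 0" | "K = 0" | "K < 0" by linarith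
  then show ?thesis
  proof cases
    case 1
    define k where "k = sqrt K"
    have k: "k > 0" "K = k * k" using 1 by (simp_all add: k_def)
    have h: "(k + y0) * exp (k * s) - (k - y0) * exp (- (k * s)) = y s * ((k + y0) / k * exp (k * s) + (k - y0) / k * exp (- (k * s)))"
      if "s < 0" for s
    proof -
      have "((k + y0) * exp (k * s) - (k - y0) * exp (- (k * s))) / 2 = y s * (((k + y0) / k * exp (k * s) + (k - y0) / k * exp (- (k * s))) / 2)" (is "?l / 2 = _ * (?r / 2)")
        by (rule lin) (use k that in \<open>auto intro!: derivative_eq_intros simp: field_simps\<close>)
      then have "?l / 2 = y s * ?r / 2" by (simp only: times_divide_eq_right)
      then show ?thesis by (simp only: divide_cancel_right) simp
    qed
    have eq: "y s * ((k + y0) + (k - y0) * exp (- (2 * k * s))) = k * ((k + y0) - (k - y0) * exp (- (2 * k * s)))"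
      if "s < 0" for s
    proof -
      have e: "exp (- (k * s)) = exp (k * s) * exp (- (2 * k * s))" by (simp flip: exp_add)
      have "exp (k * s) * (k * ((k + y0) - (k - y0) * exp (- (2 * k * s))))
          = k * (y s * ((k + y0) / k * exp (k * s) + (k - y0) / k * exp (- (k * s))))"
        unfolding h[OF that, symmetric] unfolding e by (simp add: algebra_simps)
      also have "\<dots> = y s * (k * ((k + y0) / k * exp (k * s) + (k - y0) / k * exp (- (k * s))))"
        by simp
      also have "k * ((k + y0) / k * exp (k * s) + (k - y0) / k * exp (- (k * s)))
          = (k + y0) * exp (k * s) + (k - y0) * exp (- (k * s))" using k by (simp add: distrib_left)
      also have "y s * \<dots> = exp (k * s) * (y s * ((k + y0) + (k - y0) * exp (- (2 * k * s))))"
        unfolding e by (simp add: algebra_simps)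
      finally show ?thesis by simp
    qed
    \<comment> \<open>Numerator and denominator cannot vanish together: that would force y0 = -k and
      y0 = k.\<close>
    have nz: "(k + y0) + (k - y0) * exp (- (2 * k * s)) \<noteq> 0" if "s < 0" for s
    proof
      assume z: "(k + y0) + (k - y0) * exp (- (2 * k * s)) = 0"
      with eq[OF that] k have "(k + y0) - (k - y0) * exp (- (2 * k * s)) = 0" by simp
      with z have "k + y0 = 0" "(k - y0) * exp (- (2 * k * s)) = 0" by linarith+
      then show False using k by simp
    qed
    consider "y0 < k" | "y0 = k" | "y0 > k" by linarith
    then show ?thesis
    proof cases
      case 1 then show ?thesis using hyperbolic k nz eq by blast
    next
      case 2
      then have "y s = y0" if "s < 0" for s using eq[OF that] k by simp
      then show ?thesis using stationary 2 k by simp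
    next
      case 3
      \<comment> \<open>The zero of the denominator, which is negative because the logarithm has an
        argument above 1.\<close>
      define s where "s = - ln ((y0 + k) / (y0 - k)) / (2 * k)"
      have g: "(y0 + k) / (y0 - k) > 1" using 3 k by simp
      then have "s < 0" using k by (simp add: s_def)
      moreover have "exp (- (2 * k * s)) = (y0 + k) / (y0 - k)" using g k by (simp add: s_def)
      then have "(k + y0) + (k - y0) * exp (- (2 * k * s)) = 0" using 3 by (simp add: field_simps)
      ultimately show ?thesis using nz by blast
    qed
  next
    case 2
    have h: "y0 = y s * (1 + y0 * s)" if "s < 0" for s
      by (rule lin[of "\<lambda>s. 1 + y0 * s" "\<lambda>s. y0"]) (use 2 that in \<open>auto intro!: derivative_eq_intros\<close>)
    consider "y0 < 0" | "y0 = 0" | "y0 > 0" by linarith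
    then show ?thesis
    proof cases
      case 1
      then have "1 + y0 * s \<noteq> 0 \<and> y s * (1 + y0 * s) = y0" if "s < 0" for s
        using h[OF that] by (metis mult_zero_right less_irrefl)
      then show ?thesis using parabolic 1 by blast
    next
      case 2 then show ?thesis using stationary h by auto
    next
      case 3
      then have "- 1 / y0 < 0" "1 + y0 * (- 1 / y0) = 0" by simp_all
      then show ?thesis using h[of "- 1 / y0"] 3 by simp
    qed
  next
    case 3
    define k where "k = sqrt (- K)"
    have k: "k > 0" "K = - k * k" using 3 by (simp_all add: k_def)
    define \<psi> where "\<psi> s = cos (k * s) + y0 / k * sin (k * s)" for s
    have h: "- k * sin (k * s) + y0 * cos (k * s) = y s * \<psi> s" if "s < 0" for s
      by (rule lin[of \<psi> "\<lambda>s. - k * sin (k * s) + y0 * cos (k * s)"])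
        (use k that in \<open>auto intro!: derivative_eq_intros simp: \<psi>_def[abs_def] field_simps\<close>)
    \<comment> \<open>Half a period suffices: \<psi> is -1 at -\<pi>/k and 1 at 0.\<close>
    have "\<exists>s. - (pi / k) \<le> s \<and> s \<le> 0 \<and> \<psi> s = 0"
      by (rule IVT') (use k in \<open>auto simp: \<psi>_def[abs_def] intro!: continuous_intros\<close>)
    then obtain s where s: "s \<le> 0" "\<psi> s = 0" by blast
    then have "s < 0" by (cases "s = 0") (auto simp: \<psi>_def)
    then have z1: "- k * sin (k * s) + y0 * cos (k * s) = 0" using h s(2) by simp
    have z2: "k * cos (k * s) + y0 * sin (k * s) = 0"
      using s(2) k unfolding \<psi>_def by (simp add: field_simps)
    \<comment> \<open>The two expressions are the vector (k, y0) rotated by an angle, so their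
      squares add up to k^2 + y0^2.\<close>
    have "k * k * ((sin (k * s))\<^sup>2 + (cos (k * s))\<^sup>2) + y0 * y0 * ((sin (k * s))\<^sup>2 + (cos (k * s))\<^sup>2) = 0"
      using z1 z2 by algebra
    then have "k * k + y0 * y0 = 0" by simp
    moreover have "k * k > 0" using k by simp
    ultimately show ?thesis using zero_le_square[of y0] by linarith
  qed
qed

text \<open>The bracket in \<open>explicit_profile\<close> as a function of t = cos \<theta>. Since
  (1 - cos \<theta>) / sin \<theta> = sin \<theta> / (1 + cos \<theta>), it is W = (1 + t)
  G.\<close>

definition explicit_W :: "real \<Rightarrow> real \<Rightarrow> real \<Rightarrow> real"
  where "explicit_W \<tau> \<sigma> t =
    (let b = \<bar>1 - \<tau> / 2\<bar> in
     if (\<tau>, \<sigma>) \<in> J1 then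
       1 - b - 2 * b * (1 - 2 * \<sigma> - b) / ((1 - 2 * \<sigma> + b) * ((1 + t) / 2) powr (- b) + 2 * \<sigma> - 1 + b)
     else if (\<tau>, \<sigma>) \<in> J2 then 1 + 2 * (1 - 2 * \<sigma>) / ((1 - 2 * \<sigma>) * ln ((1 + t) / 2) - 2)
     else 1 + b)"

lemma explicit_profile_W: "explicit_profile \<tau> \<sigma> \<theta> = (1 - cos \<theta>) / sin \<theta> * explicit_W \<tau> \<sigma> (cos \<theta>)"
  by (simp add: explicit_profile_def explicit_W_def Let_def)

lemma explicit_W_J1:
  assumes "b > 0" "2 * \<sigma> < 1 + b"
  shows "(2 - 2 * b, \<sigma>) \<in> J1"
    "explicit_W (2 - 2 * b) \<sigma> = (\<lambda>t. 1 - b - 2 * b * (1 - 2 * \<sigma> - b) / ((1 - 2 * \<sigma> + b) * ((1 + t) / 2) powr (- b) + 2 * \<sigma> - 1 + b))"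
proof -
  show J: "(2 - 2 * b, \<sigma>) \<in> J1" using assms by (simp add: J1_def)
  have "1 - (2 - 2 * b) / 2 = b" by (simp add: field_simps)
  then have "\<bar>1 - (2 - 2 * b) / 2\<bar> = b" using assms by simp
  then show "explicit_W (2 - 2 * b) \<sigma> = (\<lambda>t. 1 - b - 2 * b * (1 - 2 * \<sigma> - b) / ((1 - 2 * \<sigma> + b) * ((1 + t) / 2) powr (- b) + 2 * \<sigma> - 1 + b))"
    using J by (simp only: explicit_W_def Let_def if_True fun_eq_iff) simp
qed

lemma explicit_W_J2:
  assumes "2 * \<sigma> < 1"
  shows "(2, \<sigma>) \<in> J2"
    "explicit_W 2 \<sigma> = (\<lambda>t. 1 + 2 * (1 - 2 * \<sigma>) / ((1 - 2 * \<sigma>) * ln ((1 + t) / 2) - 2))"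
  using assms by (auto simp: J1_def J2_def explicit_W_def Let_def fun_eq_iff)

lemma explicit_W_J3:
  assumes "b \<ge> 0"
  shows "(2 + 2 * b, (1 + b) / 2) \<in> J3" "explicit_W (2 + 2 * b) ((1 + b) / 2) = (\<lambda>t. 1 + b)"
  using assms by (auto simp: J1_def J2_def J3_def explicit_W_def Let_def fun_eq_iff)

text \<open>Resolves the absolute value: b = 1 - \<tau>/2 in \<open>J1\<close> and b = \<tau>/2 - 1
  in \<open>J3\<close>.\<close>

lemma J_cases:
  assumes "(\<tau>, \<sigma>) \<in> J1 \<union> J2 \<union> J3"
  obtains (J1) b where "b > 0" "2 * \<sigma> < 1 + b" "\<tau> = 2 - 2 * b"
  | (J2) "\<tau> = 2" "2 * \<sigma> < 1"
  | (J3) b where "b \<ge> 0" "\<tau> = 2 + 2 * b" "\<sigma> = (1 + b) / 2"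
proof -
  from assms consider "(\<tau>, \<sigma>) \<in> J1" | "(\<tau>, \<sigma>) \<in> J2" | "(\<tau>, \<sigma>) \<in> J3" by blast
  then show ?thesis
  proof cases
    case 1 then show ?thesis by (intro J1[of "1 - \<tau> / 2"]) (auto simp: J1_def)
  next
    case 2 then show ?thesis by (intro J2) (auto simp: J2_def)
  next
    case 3 then show ?thesis by (intro J3[of "\<tau> / 2 - 1"]) (auto simp: J3_def)
  qed
qed

lemma riccati_explicit:
  fixes W :: "real \<Rightarrow> real"
  assumes W: "\<And>t. -1 < t \<Longrightarrow> t < 1 \<Longrightarrow> (W has_real_derivative (c + W t - (W t)\<^sup>2 / 2) / (1 + t)) (at t)"
    and W1: "(W \<longlongrightarrow> w1) (at_left 1)"
  obtains \<tau> \<sigma> where "(\<tau>, \<sigma>) \<in> J1 \<union> J2 \<union> J3" "\<And>t. -1 < t \<Longrightarrow> t < 1 \<Longrightarrow> W t = explicit_W \<tau> \<sigma> t"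
proof -
  \<comment> \<open>t = 2 exp s - 1 carries s < 0 onto (-1, 1) and turns (1 + t) d/dt into d/ds; the
    shift by 1 completes the square and the factor 1/2 normalises the quadratic term to
    -y^2.\<close>
  define y where "y s = (W (2 * exp s - 1) - 1) / 2" for s
  have dy: "(y has_real_derivative (1 + 2 * c) / 4 - (y s)\<^sup>2) (at s)" if "s < 0" for s
  proof -
    have r: "-1 < 2 * exp s - 1" "2 * exp s - 1 < 1" using that by simp_all
    have "((\<lambda>s. 2 * exp s - 1) has_real_derivative 2 * exp s) (at s)" by (auto intro!: derivative_eq_intros)
    from DERIV_chain2[OF W[OF r] this]
    have d: "((\<lambda>s. W (2 * exp s - 1)) has_real_derivative c + W (2 * exp s - 1) - (W (2 * exp s - 1))\<^sup>2 / 2) (at s)"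
      by simp
    have "(y has_real_derivative (c + W (2 * exp s - 1) - (W (2 * exp s - 1))\<^sup>2 / 2) / 2) (at s)"
      unfolding y_def[abs_def] using d by (auto intro!: derivative_eq_intros)
    then show ?thesis by (rule DERIV_cong) (simp add: y_def field_simps power2_eq_square)
  qed
  have "filterlim (\<lambda>s::real. 2 * exp s - 1) (at_left 1) (at_left 0)"
  proof (rule tendsto_imp_filterlim_at_left)
    have "((\<lambda>s::real. 2 * exp s - 1) \<longlongrightarrow> 2 * exp 0 - 1) (at_left 0)" by (intro tendsto_intros)
    then show "((\<lambda>s::real. 2 * exp s - 1) \<longlongrightarrow> 1) (at_left 0)" by simp
    show "\<forall>\<^sub>F s::real in at_left 0. 2 * exp s - 1 < 1"
      using eventually_at_left_real[of "-1" "0::real"] by (rule eventually_mono) auto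
  qed
  from filterlim_compose[OF W1 this]
  have y0: "(y \<longlongrightarrow> (w1 - 1) / 2) (at_left 0)" unfolding y_def[abs_def] by (intro tendsto_intros) auto
  define s where "s t = ln ((1 + t) / 2)" for t :: real
  have s: "s t < 0" "W t = 1 + 2 * y (s t)" if "-1 < t" "t < 1" for t
  proof -
    show "s t < 0" using that by (simp add: s_def)
    have "2 * exp (s t) - 1 = t" using that by (simp add: s_def field_simps)
    then show "W t = 1 + 2 * y (s t)" unfolding y_def by (simp add: field_simps)
  qed
  show ?thesis
  proof (rule riccati_cases[OF dy y0])
    fix k assume k: "0 < k" "(w1 - 1) / 2 < k"
      and y: "\<And>s. s < 0 \<Longrightarrow> k + (w1 - 1) / 2 + (k - (w1 - 1) / 2) * exp (- (2 * k * s)) \<noteq> 0 \<and>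
        y s * (k + (w1 - 1) / 2 + (k - (w1 - 1) / 2) * exp (- (2 * k * s))) =
        k * (k + (w1 - 1) / 2 - (k - (w1 - 1) / 2) * exp (- (2 * k * s)))"
    \<comment> \<open>exp(-2 k s) at s = ln((1 + t)/2) is the power of (1 + t)/2 with exponent -2k.
      As w1 = 2 \<sigma>, the condition y0 < k is the bound on \<sigma> in
      \<open>J1\<close>.\<close>
    define b where "b = 2 * k"
    have b: "b > 0" "2 * (w1 / 2) < 1 + b" using k by (simp_all add: b_def)
    have "W t = explicit_W (2 - 2 * b) (w1 / 2) t" if t: "-1 < t" "t < 1" for t
    proof -
      define Z where "Z = ((1 + t) / 2) powr (- b)"
      have Z: "exp (- (2 * k * s t)) = Z" using t by (simp add: Z_def s_def powr_def b_def)
      define D where "D = (1 - w1 + b) * Z + w1 - 1 + b"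
      have D: "D \<noteq> 0" "y (s t) * D = b / 2 * (w1 - 1 + b - (1 - w1 + b) * Z)"
        using y[OF s(1)[OF t]] unfolding Z b_def D_def by (simp_all add: field_simps)
      have "explicit_W (2 - 2 * b) (w1 / 2) t = 1 - b - 2 * b * (1 - w1 - b) / D"
        unfolding explicit_W_J1(2)[OF b] Z_def[symmetric] D_def by simp
      also have "\<dots> = 1 + 2 * (y (s t) * D / D)"
        unfolding D(2) using D(1) by (simp add: field_simps) (simp add: D_def algebra_simps)
      finally show ?thesis using s(2)[OF t] D(1) by simp
    qed
    then show thesis using that[of "2 - 2 * b" "w1 / 2"] explicit_W_J1(1)[OF b] by blast
  next
    assume w: "(w1 - 1) / 2 < 0"
      and y: "\<And>s. s < 0 \<Longrightarrow> 1 + (w1 - 1) / 2 * s \<noteq> 0 \<and> y s * (1 + (w1 - 1) / 2 * s) = (w1 - 1) / 2"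
    have b: "2 * (w1 / 2) < 1" using w by simp
    have "W t = explicit_W 2 (w1 / 2) t" if t: "-1 < t" "t < 1" for t
    proof -
      have "y (s t) * ((1 - w1) * s t - 2) = 1 - w1" "(1 - w1) * s t - 2 \<noteq> 0"
        using y[OF s(1)[OF t]] by (simp_all add: field_simps)
      then have "y (s t) = (1 - w1) / ((1 - w1) * s t - 2)" by (simp add: field_simps)
      then show ?thesis unfolding explicit_W_J2(2)[OF b] s(2)[OF t] by (simp add: s_def)
    qed
    then show thesis using that[of 2 "w1 / 2"] explicit_W_J2(1)[OF b] by blast
  next
    assume w: "0 \<le> (w1 - 1) / 2" and y: "\<And>s. s < 0 \<Longrightarrow> y s = (w1 - 1) / 2"
    then have b: "w1 - 1 \<ge> 0" by simp
    have "W t = explicit_W (2 + 2 * (w1 - 1)) ((1 + (w1 - 1)) / 2) t" if t: "-1 < t" "t < 1" for t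
      unfolding explicit_W_J3(2)[OF b] s(2)[OF t] y[OF s(1)[OF t]] by (simp add: field_simps)
    then show thesis using that explicit_W_J3(1)[OF b] by blast
  qed
qed

text \<open>The constant comes from 1 + 2c = b^2. The formulas remain valid slightly beyond t = 1,
  which gives the two-sided derivative at the pole.\<close>

lemma explicit_riccati_flow:
  assumes "(\<tau>, \<sigma>) \<in> J1 \<union> J2 \<union> J3"
  shows "riccati_flow (explicit_W \<tau> \<sigma>) (((1 - \<tau> / 2)\<^sup>2 - 1) / 2)"
proof
  fix t :: real assume t: "-1 < t" "t \<le> 1"
  show "(explicit_W \<tau> \<sigma> has_real_derivative (((1 - \<tau> / 2)\<^sup>2 - 1) / 2 + explicit_W \<tau> \<sigma> t - (explicit_W \<tau> \<sigma> t)\<^sup>2 / 2) / (1 + t)) (at t)"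
    using assms
  proof (cases rule: J_cases)
    case (J1 b)
    \<comment> \<open>The denominator becomes \<beta> Z + \<alpha>. As Z is at least 1 for t \<le> 1
      and \<beta> > 0, it is at least \<alpha> + \<beta> = 2b, whatever the sign of
      \<alpha>.\<close>
    define \<alpha> \<beta> where "\<alpha> = 2 * \<sigma> - 1 + b" and "\<beta> = 1 - 2 * \<sigma> + b"
    have \<beta>: "\<beta> > 0" "\<alpha> + \<beta> = 2 * b" using J1 by (simp_all add: \<alpha>_def \<beta>_def)
    have W: "explicit_W \<tau> \<sigma> = (\<lambda>t. 1 - b + 2 * b * \<alpha> / (\<beta> * ((1 + t) / 2) powr (- b) + \<alpha>))"
    proof -
      have "(1 - 2 * \<sigma> + b) * x + 2 * \<sigma> - 1 + b = \<beta> * x + \<alpha>" "1 - 2 * \<sigma> - b = - \<alpha>" for x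
        by (simp_all add: \<alpha>_def \<beta>_def)
      then show ?thesis unfolding J1(3) explicit_W_J1(2)[OF J1(1,2)] by (simp add: fun_eq_iff)
    qed
    define Z where "Z = ((1 + t) / 2) powr (- b)"
    have "((1 + t) / 2) powr b \<le> 1" using t J1 by (intro powr_le1) auto
    then have "Z \<ge> 1" using t by (simp add: Z_def powr_minus one_le_inverse_iff)
    then have "\<beta> * Z \<ge> \<beta>" using \<beta> by simp
    then have D: "\<beta> * Z + \<alpha> > 0" using \<beta> J1 by linarith
    have dZ: "((\<lambda>t. ((1 + t) / 2) powr (- b)) has_real_derivative - b * Z / (1 + t)) (at t)"
    proof -
      have "((\<lambda>t. (1 + t) / 2) has_real_derivative 1 / 2) (at t)" by (auto intro!: derivative_eq_intros)
      from DERIV_fun_powr[OF this, of "- b"] t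
      have "((\<lambda>t. ((1 + t) / 2) powr (- b)) has_real_derivative - b * ((1 + t) / 2) powr (- b - 1) * (1 / 2)) (at t)" by simp
      moreover have "((1 + t) / 2) powr (- b - 1) = Z / ((1 + t) / 2)"
        using t by (simp add: Z_def powr_diff)
      then have "- b * ((1 + t) / 2) powr (- b - 1) * (1 / 2) = - b * Z / (1 + t)"
        using t by (simp only:) (simp add: field_simps)
      ultimately show ?thesis by (rule DERIV_cong)
    qed
    have dD: "((\<lambda>t. \<beta> * ((1 + t) / 2) powr (- b) + \<alpha>) has_real_derivative \<beta> * (- b * Z / (1 + t))) (at t)"
      by (rule DERIV_cong[OF DERIV_add[OF DERIV_cmult[OF dZ] DERIV_const]]) simp
    have "((\<lambda>t. 1 - b + 2 * b * \<alpha> / (\<beta> * ((1 + t) / 2) powr (- b) + \<alpha>)) has_real_derivative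
       - (2 * b * \<alpha>) * (\<beta> * (- b * Z / (1 + t))) / ((\<beta> * Z + \<alpha>) * (\<beta> * Z + \<alpha>))) (at t)"
      by (rule DERIV_cong[OF DERIV_add[OF DERIV_const DERIV_divide[OF DERIV_const dD]]]) (use D in \<open>simp_all add: Z_def\<close>)
    moreover have "- (2 * b * \<alpha>) * (\<beta> * (- b * Z / (1 + t))) / ((\<beta> * Z + \<alpha>) * (\<beta> * Z + \<alpha>))
       = ((b\<^sup>2 - 1) / 2 + w - w\<^sup>2 / 2) / (1 + t)" if w: "w = 1 - b + 2 * b * \<alpha> / (\<beta> * Z + \<alpha>)" for w
    proof -
      define d where "d = \<beta> * Z + \<alpha>"
      have d: "d > 0" "\<beta> * Z = d - \<alpha>" using D by (simp_all add: d_def)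
      have "(b\<^sup>2 - 1) / 2 + w - w\<^sup>2 / 2 = (b\<^sup>2 - (w - 1)\<^sup>2) / 2" by (simp add: field_simps power2_eq_square)
      also have "w - 1 = b * (2 * \<alpha> - d) / d" using d(1) unfolding w d_def[symmetric] by (simp add: field_simps)
      also have "(b\<^sup>2 - (b * (2 * \<alpha> - d) / d)\<^sup>2) / 2 = 2 * b * \<alpha> * b * (d - \<alpha>) / (d * d)"
        using d(1) by (simp add: field_simps power2_eq_square)
      finally show ?thesis unfolding d_def[symmetric] d(2)[symmetric] by (simp add: mult_ac)
    qed
    moreover have "1 - \<tau> / 2 = b" using J1(3) by (simp add: field_simps)
    ultimately show ?thesis unfolding W Z_def by simp
  next
    case J2
    define \<kappa> where "\<kappa> = 1 - 2 * \<sigma>"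
    have W: "explicit_W \<tau> \<sigma> = (\<lambda>t. 1 + 2 * \<kappa> / (\<kappa> * ln ((1 + t) / 2) - 2))"
      unfolding J2(1) explicit_W_J2(2)[OF J2(2)] \<kappa>_def by simp
    define L where "L = ln ((1 + t) / 2)"
    \<comment> \<open>Up to t = 1 the logarithm is nonpositive, which keeps the denominator at or
      below -2.\<close>
    have "L \<le> 0" using t by (simp add: L_def)
    then have "\<kappa> * L \<le> 0" using J2 by (simp add: \<kappa>_def mult_nonneg_nonpos)
    then have D: "\<kappa> * L - 2 \<noteq> 0" by linarith
    have dL: "((\<lambda>t. ln ((1 + t) / 2)) has_real_derivative 1 / (1 + t)) (at t)"
      using t by (auto intro!: derivative_eq_intros simp: field_simps)
    have "((\<lambda>t. 1 + 2 * \<kappa> / (\<kappa> * ln ((1 + t) / 2) - 2)) has_real_derivative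
       - (2 * \<kappa>) * (\<kappa> * (1 / (1 + t))) / ((\<kappa> * L - 2) * (\<kappa> * L - 2))) (at t)"
    proof -
      have dD: "((\<lambda>t. \<kappa> * ln ((1 + t) / 2) - 2) has_real_derivative \<kappa> * (1 / (1 + t))) (at t)"
        by (rule DERIV_cong[OF DERIV_diff[OF DERIV_cmult[OF dL] DERIV_const]]) simp
      show ?thesis
        by (rule DERIV_cong[OF DERIV_add[OF DERIV_const DERIV_divide[OF DERIV_const dD]]]) (use D in \<open>simp_all add: L_def\<close>)
    qed
    moreover have "- (2 * \<kappa>) * (\<kappa> * (1 / (1 + t))) / ((\<kappa> * L - 2) * (\<kappa> * L - 2))
       = ((0\<^sup>2 - 1) / 2 + w - w\<^sup>2 / 2) / (1 + t)" if w: "w = 1 + 2 * \<kappa> / (\<kappa> * L - 2)" for w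
    proof -
      have "(0\<^sup>2 - 1) / 2 + w - w\<^sup>2 / 2 = - ((w - 1)\<^sup>2) / 2" by (simp add: field_simps power2_eq_square)
      also have "w - 1 = 2 * \<kappa> / (\<kappa> * L - 2)" using w by simp
      finally show ?thesis by (simp add: power2_eq_square mult_ac)
    qed
    moreover have "1 - \<tau> / 2 = 0" using J2(1) by simp
    ultimately show ?thesis unfolding W L_def by simp
  next
    case (J3 b)
    have W: "explicit_W \<tau> \<sigma> = (\<lambda>t. 1 + b)" unfolding J3(2,3) explicit_W_J3(2)[OF J3(1)] ..
    have "((1 - \<tau> / 2)\<^sup>2 - 1) / 2 + (1 + b) - (1 + b)\<^sup>2 / 2 = 0"
      unfolding J3 by (simp add: field_simps power2_eq_square)
    then show ?thesis unfolding W by (simp only: div_0 DERIV_const)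
  qed
qed

lemma explicit_W_at_1:
  assumes "(\<tau>, \<sigma>) \<in> J1 \<union> J2 \<union> J3"
  shows "explicit_W \<tau> \<sigma> 1 = 2 * \<sigma>"
  using assms
proof (cases rule: J_cases)
  case (J1 b)
  then show ?thesis unfolding J1(3) explicit_W_J1(2)[OF J1(1,2)] by (simp add: field_simps)
next
  case J2 then show ?thesis unfolding J2(1) explicit_W_J2(2)[OF J2(2)] by (simp add: field_simps)
next
  case (J3 b) then show ?thesis unfolding J3(2,3) explicit_W_J3(2)[OF J3(1)] by simp
qed

text \<open>In \<open>J1\<close> and \<open>J2\<close> the denominator blows up at the slit, through
  the negative power or the logarithm, so only 1 - b survives; in \<open>J3\<close> the function is
  constant.\<close>

lemma explicit_W_at_minus_1:
  assumes "(\<tau>, \<sigma>) \<in> J1 \<union> J2 \<union> J3"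
  shows "(explicit_W \<tau> \<sigma> \<longlongrightarrow> \<tau> / 2) (at_right (- 1))"
proof -
  have "filterlim (\<lambda>t::real. (1 + t) / 2) (at_right 0) (at_right (- 1))"
  proof (rule tendsto_imp_filterlim_at_right)
    have "((\<lambda>t::real. (1 + t) / 2) \<longlongrightarrow> (1 + - 1) / 2) (at_right (- 1))" by (intro tendsto_intros) simp
    then show "((\<lambda>t::real. (1 + t) / 2) \<longlongrightarrow> 0) (at_right (- 1))" by simp
    show "\<forall>\<^sub>F t::real in at_right (- 1). 0 < (1 + t) / 2"
      using eventually_at_right_less[of "- 1 :: real"] by (rule eventually_mono) simp
  qed
  from filterlim_compose[OF ln_at_0 this]
  have ln: "filterlim (\<lambda>t::real. ln ((1 + t) / 2)) at_bot (at_right (- 1))" .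
  show ?thesis using assms
  proof (cases rule: J_cases)
    case (J1 b)
    have "filterlim (\<lambda>t. exp (b * - ln ((1 + t) / 2))) at_top (at_right (- 1))"
      by (rule filterlim_compose[OF exp_at_top], rule filterlim_tendsto_pos_mult_at_top[OF tendsto_const J1(1)])
        (use ln in \<open>simp add: filterlim_uminus_at_bot\<close>)
    then have "filterlim (\<lambda>t. ((1 + t) / 2) powr (- b)) at_top (at_right (- 1))"
    proof (rule filterlim_cong[THEN iffD1, rotated 3])
      show "\<forall>\<^sub>F t in at_right (- 1). exp (b * - ln ((1 + t) / 2)) = ((1 + t) / 2) powr - b"
        using eventually_at_right_less[of "- 1 :: real"] by (rule eventually_mono) (simp add: powr_def)
    qed simp_all
    then have "filterlim (\<lambda>t. (2 * \<sigma> - 1 + b) + (1 - 2 * \<sigma> + b) * ((1 + t) / 2) powr (- b)) at_top (at_right (- 1))"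
      by (intro filterlim_tendsto_add_at_top[OF tendsto_const] filterlim_tendsto_pos_mult_at_top[OF tendsto_const])
        (use J1 in simp_all)
    then have "filterlim (\<lambda>t. (1 - 2 * \<sigma> + b) * ((1 + t) / 2) powr (- b) + 2 * \<sigma> - 1 + b) at_infinity (at_right (- 1))"
      by (intro filterlim_at_top_imp_at_infinity) (simp add: algebra_simps)
    then have "((\<lambda>t. 1 - b - 2 * b * (1 - 2 * \<sigma> - b) / ((1 - 2 * \<sigma> + b) * ((1 + t) / 2) powr (- b) + 2 * \<sigma> - 1 + b)) \<longlongrightarrow> 1 - b - 0) (at_right (- 1))"
      by (intro tendsto_diff tendsto_const tendsto_divide_0[OF tendsto_const])
    moreover have "1 - b - 0 = (2 - 2 * b) / 2" by simp
    ultimately show ?thesis unfolding J1(3) explicit_W_J1(2)[OF J1(1,2)] by metis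
  next
    case J2
    have "filterlim (\<lambda>t. 2 + (1 - 2 * \<sigma>) * - ln ((1 + t) / 2)) at_infinity (at_right (- 1))"
      by (rule filterlim_at_top_imp_at_infinity, rule filterlim_tendsto_add_at_top[OF tendsto_const],
          rule filterlim_tendsto_pos_mult_at_top[OF tendsto_const])
        (use J2 ln in \<open>simp_all add: filterlim_uminus_at_bot\<close>)
    then have "((\<lambda>t. 1 - 2 * (1 - 2 * \<sigma>) / (2 + (1 - 2 * \<sigma>) * - ln ((1 + t) / 2))) \<longlongrightarrow> 1 - 0) (at_right (- 1))"
      by (intro tendsto_diff tendsto_const tendsto_divide_0[OF tendsto_const])
    \<comment> \<open>The limit was taken with the denominator negated, so that it tends to
      +\<infinity>; this restores the sign used in \<open>explicit_W\<close>.\<close>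
    moreover have "1 - x / (2 + z * - r) = 1 + x / (z * r - 2)" for x z r :: real
      by (simp add: minus_divide_right)
    ultimately have "((\<lambda>t. 1 + 2 * (1 - 2 * \<sigma>) / ((1 - 2 * \<sigma>) * ln ((1 + t) / 2) - 2)) \<longlongrightarrow> 1 - 0) (at_right (- 1))"
      by (simp only:)
    then show ?thesis unfolding J2(1) explicit_W_J2(2)[OF J2(2)] by simp
  next
    case (J3 b)
    have "(2 + 2 * b) / 2 = 1 + b" by simp
    then show ?thesis unfolding J3(2,3) explicit_W_J3(2)[OF J3(1)] by (simp only: tendsto_const)
  qed
qed

section \<open>Classification\<close>

lemma (in riccati_flow) corresponding_profile:
  assumes "\<And>\<theta>. 0 < \<theta> \<Longrightarrow> \<theta> < pi \<Longrightarrow> v \<theta> = G (cos \<theta>) * sin \<theta>"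
  shows "corresponding_pair v u p"
proof -
  interpret flow: axial_flow slit_space A A1 A2 G G1 G2 P P1 u p
    by unfold_locales (rule off_axis_subset navier_stokes)+
  show ?thesis by (rule flow.corresponding[OF homogeneous assms])
qed

lemma half_angle_ratio:
  assumes "0 < \<theta>" "\<theta> < pi"
  shows "(1 - cos \<theta>) / sin \<theta> = sin \<theta> / (1 + cos \<theta>)"
  using sin_gt_zero[OF assms] cos_in_open_interval[OF assms] cos_sq[of \<theta>]
  by (simp add: divide_simps) (simp add: algebra_simps)

text \<open>v sin \<theta> is (1 - cos \<theta>) W and v / sin \<theta> is W / (1 + cos \<theta>),
  so the limits are 2 W(-1) and W(1) / 2. The values of \<open>v\<close> outside (0, \<pi>) are left
  free, so that any extension qualifies.\<close>

lemma explicit_profile_limits: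
  assumes J: "(\<tau>, \<sigma>) \<in> J1 \<union> J2 \<union> J3"
    and v: "\<And>\<theta>. 0 < \<theta> \<Longrightarrow> \<theta> < pi \<Longrightarrow> v \<theta> = explicit_profile \<tau> \<sigma> \<theta>"
  shows "((\<lambda>\<theta>. v \<theta> * sin \<theta>) \<longlongrightarrow> \<tau>) (at_left pi)"
    and "((\<lambda>\<theta>. v \<theta> / sin \<theta>) \<longlongrightarrow> \<sigma>) (at_right 0)"
proof -
  let ?W = "explicit_W \<tau> \<sigma>"
  interpret riccati_flow ?W "((1 - \<tau> / 2)\<^sup>2 - 1) / 2" by (rule explicit_riccati_flow[OF J])
  have ev_pi: "\<forall>\<^sub>F \<theta> in at_left pi. 0 < \<theta> \<and> \<theta> < pi"
    using eventually_at_left_real[OF pi_gt_zero] by simp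
  have ev_0: "\<forall>\<^sub>F \<theta> in at_right 0. 0 < \<theta> \<and> \<theta> < pi"
    using eventually_at_right_real[OF pi_gt_zero] by simp
  have cos_pi: "(cos \<longlongrightarrow> - 1) (at_left pi)"
    using tendsto_cos[OF tendsto_ident_at, of pi "{..<pi}"] by simp
  have cos_0: "(cos \<longlongrightarrow> 1) (at_right (0::real))"
    using tendsto_cos[OF tendsto_ident_at, of 0 "{0<..} :: real set"] by simp
  have "filterlim cos (at_right (- 1)) (at_left pi)"
    by (rule tendsto_imp_filterlim_at_right[OF cos_pi], rule eventually_mono[OF ev_pi])
      (use cos_in_open_interval in auto)
  from filterlim_compose[OF explicit_W_at_minus_1[OF J] this]
  have W_pi: "((\<lambda>\<theta>. ?W (cos \<theta>)) \<longlongrightarrow> \<tau> / 2) (at_left pi)" .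
  have "((\<lambda>\<theta>. (1 - cos \<theta>) * ?W (cos \<theta>)) \<longlongrightarrow> (1 - - 1) * (\<tau> / 2)) (at_left pi)"
    by (intro tendsto_intros cos_pi W_pi)
  then have "((\<lambda>\<theta>. (1 - cos \<theta>) * ?W (cos \<theta>)) \<longlongrightarrow> \<tau>) (at_left pi)" by simp
  then show "((\<lambda>\<theta>. v \<theta> * sin \<theta>) \<longlongrightarrow> \<tau>) (at_left pi)"
  proof (rule Lim_transform_eventually, intro eventually_mono[OF ev_pi])
    fix \<theta> :: real assume "0 < \<theta> \<and> \<theta> < pi"
    then show "(1 - cos \<theta>) * ?W (cos \<theta>) = v \<theta> * sin \<theta>"
      using sin_gt_zero[of \<theta>] v[of \<theta>] by (simp add: explicit_profile_W)
  qed
  have "isCont ?W 1" using W[of 1] by (intro DERIV_isCont) auto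
  from isCont_tendsto_compose[OF this cos_0]
  have W_0: "((\<lambda>\<theta>. ?W (cos \<theta>)) \<longlongrightarrow> 2 * \<sigma>) (at_right 0)" unfolding explicit_W_at_1[OF J] .
  have "((\<lambda>\<theta>. ?W (cos \<theta>) / (1 + cos \<theta>)) \<longlongrightarrow> 2 * \<sigma> / (1 + 1)) (at_right 0)"
    by (intro tendsto_intros cos_0 W_0) simp
  then have "((\<lambda>\<theta>. ?W (cos \<theta>) / (1 + cos \<theta>)) \<longlongrightarrow> \<sigma>) (at_right 0)" by simp
  then show "((\<lambda>\<theta>. v \<theta> / sin \<theta>) \<longlongrightarrow> \<sigma>) (at_right 0)"
  proof (rule Lim_transform_eventually, intro eventually_mono[OF ev_0])
    fix \<theta> :: real assume t: "0 < \<theta> \<and> \<theta> < pi"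
    then show "?W (cos \<theta>) / (1 + cos \<theta>) = v \<theta> / sin \<theta>"
      using sin_gt_zero[of \<theta>] v[of \<theta>] half_angle_ratio[of \<theta>] by (simp add: explicit_profile_W)
  qed
qed

lemma explicit_solution:
  assumes J: "(\<tau>, \<sigma>) \<in> J1 \<union> J2 \<union> J3"
    and v: "\<And>\<theta>. 0 < \<theta> \<Longrightarrow> \<theta> < pi \<Longrightarrow> v \<theta> = explicit_profile \<tau> \<sigma> \<theta>"
  shows "is_solution_profile \<tau> \<sigma> v"
proof -
  interpret riccati_flow "explicit_W \<tau> \<sigma>" "((1 - \<tau> / 2)\<^sup>2 - 1) / 2" by (rule explicit_riccati_flow[OF J])
  have "corresponding_pair v u p"
    by (rule corresponding_profile)
      (simp add: v explicit_profile_W half_angle_ratio G_def)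
  then show ?thesis unfolding is_solution_profile_def
    using smooth_on_punctured_sphere navier_stokes explicit_profile_limits[OF J v] by blast
qed

section \<open>From a given solution to its profiles\<close>

lemma axisymmetricD:
  assumes "axisymmetric u" "r > 0" "0 < \<theta>" "\<theta> < pi"
  shows "u (spherical_point r \<theta> \<phi>) \<bullet> e_r \<theta> \<phi> = u (spherical_point r \<theta> \<psi>) \<bullet> e_r \<theta> \<psi>"
    and "u (spherical_point r \<theta> \<phi>) \<bullet> e_theta \<theta> \<phi> = u (spherical_point r \<theta> \<psi>) \<bullet> e_theta \<theta> \<psi>"
  using assms unfolding axisymmetric_def by (meson greaterThanLessThan_iff)+

text \<open>On the meridian the conical form reads u_1 = A sqrt(1 - t^2) and u_3 = t A - G. Solving
  this defines \<open>A\<close> and \<open>G\<close>; axisymmetry, absence of swirl and homogeneity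
  carry the form to all of \<open>off_axis\<close>.\<close>

lemma axisymmetric_flow:
  assumes sol: "homogeneous_axisymmetric_noswirl_C2_solution u p"
  obtains A A1 A2 G G1 G2 P P1 where "axial_flow off_axis A A1 A2 G G1 G2 P P1 u p"
    "\<And>t. -1 < t \<Longrightarrow> t < 1 \<Longrightarrow> A t = u (meridian t) $ 1 / sqrt (1 - t\<^sup>2)"
    "\<And>t. t * A t - G t = u (meridian t) $ 3"
proof -
  have hu: "homogeneous_on slit_space (-1) u" and hp: "homogeneous_on slit_space (-2) p"
    and ax: "axisymmetric u" and ns: "navier_stokes_on slit_space u p" and nsw: "no_swirl u"
    using sol unfolding homogeneous_axisymmetric_noswirl_C2_solution_def by blast+
  have du: "u differentiable (at x)" "partial_deriv i u differentiable (at x)" "p differentiable (at x)"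
    if "x \<in> slit_space" for x i using ns that unfolding navier_stokes_on_def by blast+
  define A where "A t = u (meridian t) $ 1 * inverse (sqrt (1 - t\<^sup>2))" for t
  define G where "G t = t * A t - u (meridian t) $ 3" for t
  define P where "P t = p (meridian t)" for t
  have tA: "twice_diff A" unfolding A_def[abs_def]
    by (intro twice_diff_mult twice_diff_inverse_sqrt twice_diff_meridian du)
  have tG: "twice_diff G" unfolding G_def[abs_def]
    by (intro twice_diff_diff twice_diff_mult twice_diff_ident twice_diff_meridian du tA)
  obtain A1 A2 where dA: "\<And>t. -1 < t \<Longrightarrow> t < 1 \<Longrightarrow> (A has_real_derivative A1 t) (at t)"
    "\<And>t. -1 < t \<Longrightarrow> t < 1 \<Longrightarrow> (A1 has_real_derivative A2 t) (at t)" using twice_diffE[OF tA] by blast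
  obtain G1 G2 where dG: "\<And>t. -1 < t \<Longrightarrow> t < 1 \<Longrightarrow> (G has_real_derivative G1 t) (at t)"
    "\<And>t. -1 < t \<Longrightarrow> t < 1 \<Longrightarrow> (G1 has_real_derivative G2 t) (at t)" using twice_diffE[OF tG] by blast
  have dP: "(P has_real_derivative deriv P t) (at t)" if t: "-1 < t" "t < 1" for t
  proof -
    have "meridian t \<in> slit_space" using meridian_off_axis[OF t] off_axis_subset by blast
    from meridian_chain[OF t du(3)[OF this]] show ?thesis
      unfolding P_def[abs_def] by (metis DERIV_imp_deriv)
  qed
  have sphere: "spherical_point 1 \<theta> \<phi> \<in> slit_space" if "0 < \<theta>" "\<theta> < pi" for \<theta> \<phi>
    using spherical_point_off_axis[OF zero_less_one that] off_axis_subset by blast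
  have u: "u x = hom_lift 2 A x *\<^sub>R x - hom_lift 1 G x *\<^sub>R axis 3 1" if x: "x \<in> off_axis" for x
  proof (rule off_axis_cases[OF x])
    fix r \<theta> \<phi>
    assume r: "r > 0" and t: "0 < \<theta>" "\<theta> < pi" and xs: "x = spherical_point r \<theta> \<phi>"
      and c: "cos_polar x = cos \<theta>" and n: "norm x = r"
    have s: "sin \<theta> > 0" using sin_gt_zero[OF t] .
    have "u (r *\<^sub>R spherical_point 1 \<theta> \<phi>) = (r powi -1) *\<^sub>R u (spherical_point 1 \<theta> \<phi>)"
      using hu sphere[OF t] r unfolding homogeneous_on_def by blast
    then have sc: "u x = inverse r *\<^sub>R u (spherical_point 1 \<theta> \<phi>)"
      unfolding xs spherical_point_scale[of r] by (simp add: power_int_minus)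
    let ?m = "meridian (cos \<theta>)"
    have sq: "sqrt (1 - (cos \<theta>)\<^sup>2) = sin \<theta>" using s by (simp add: sin_squared_eq[symmetric])
    have comp: "u (spherical_point 1 \<theta> \<phi>) \<bullet> e_r \<theta> \<phi> = u ?m \<bullet> e_r \<theta> 0"
      "u (spherical_point 1 \<theta> \<phi>) \<bullet> e_theta \<theta> \<phi> = u ?m \<bullet> e_theta \<theta> 0"
      unfolding meridian_spherical[OF t] by (rule axisymmetricD[OF ax zero_less_one t])+
    have comp_phi: "u (spherical_point 1 \<theta> \<phi>) \<bullet> e_phi \<theta> \<phi> = 0"
      using nsw t unfolding no_swirl_def by simp
    have cc: "cos \<theta> * (cos \<theta> * y) + sin \<theta> * (sin \<theta> * y) = y" for y
      using cos_sq[of \<theta>] by algebra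
    have A: "A (cos \<theta>) = u ?m $ 1 / sin \<theta>" unfolding A_def sq by (simp add: divide_inverse)
    have "u ?m \<bullet> e_r \<theta> 0 = A (cos \<theta>) - cos \<theta> * G (cos \<theta>)" "u ?m \<bullet> e_theta \<theta> 0 = G (cos \<theta>) * sin \<theta>"
      unfolding G_def A inner_3 using s by (simp_all add: field_simps) (rule cc)
    then have "u (spherical_point 1 \<theta> \<phi>) = (A (cos \<theta>) - cos \<theta> * G (cos \<theta>)) *\<^sub>R e_r \<theta> \<phi> + G (cos \<theta>) *\<^sub>R (sin \<theta> *\<^sub>R e_theta \<theta> \<phi>)"
      using frame_expansion[of "u (spherical_point 1 \<theta> \<phi>)" \<theta> \<phi>] unfolding comp comp_phi by simp
    also have "\<dots> = A (cos \<theta>) *\<^sub>R e_r \<theta> \<phi> - G (cos \<theta>) *\<^sub>R axis 3 1"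
      unfolding sin_e_theta by (simp add: scaleR_left_diff_distrib scaleR_right_diff_distrib mult.commute)
    finally have "u x = (A (cos \<theta>) / r) *\<^sub>R e_r \<theta> \<phi> - (G (cos \<theta>) / r) *\<^sub>R axis 3 1"
      unfolding sc by (simp add: scaleR_right_diff_distrib divide_inverse mult.commute)
    moreover have "(A (cos \<theta>) / r) *\<^sub>R e_r \<theta> \<phi> = (A (cos \<theta>) / r\<^sup>2) *\<^sub>R x"
      using r unfolding xs spherical_point_def by (simp add: power2_eq_square)
    ultimately show ?thesis unfolding hom_lift_def c n by simp
  qed
  have q: "-1 < cos_polar x \<and> cos_polar x < 1" "x \<noteq> 0" if "x \<in> off_axis" for x
    using that by (auto elim!: off_axis_cases simp: cos_in_open_interval)
  \<comment> \<open>Zero pressure is inserted in order to use the velocity part of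
    \<open>momentum\<close> before \<open>p\<close> is known to depend on the cosine alone.\<close>
  interpret v: conical_flow off_axis A A1 A2 G G1 G2 "\<lambda>t. 0" "\<lambda>t. 0" u "\<lambda>x. 0"
    by unfold_locales (use open_off_axis q dA dG u in \<open>auto simp: hom_lift_def\<close>)
  \<comment> \<open>Axial symmetry of the pressure is not assumed: its gradient is a combination of \<open>x\<close> and
    \<open>e\<^sub>3\<close>, so it does not depend on the meridian angle.\<close>
  have p_sphere: "p (spherical_point 1 \<theta> \<phi>) = P (cos \<theta>)" if t: "0 < \<theta>" "\<theta> < pi" for \<theta> \<phi>
  proof -
    have "((\<lambda>\<phi>. p (spherical_point 1 \<theta> \<phi>)) has_real_derivative 0) (at \<phi>)" for \<phi>
    proof -
      let ?x = "spherical_point 1 \<theta> \<phi>"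
      have x: "?x \<in> off_axis" "?x \<in> slit_space"
        using spherical_point_off_axis[OF zero_less_one t] sphere[OF t] by blast+
      have "gradient (\<lambda>x. 0) ?x = 0"
        by (simp add: gradient_def partial_deriv_def vec_eq_iff)
      then have "- laplacian u ?x + convection u ?x = hom_lift 4 v.x_residual ?x *\<^sub>R ?x + hom_lift 3 v.e_residual ?x *\<^sub>R axis 3 1"
        using v.momentum[OF x(1)] by simp
      moreover have "- laplacian u ?x + convection u ?x + gradient p ?x = 0"
        using ns x(2) unfolding navier_stokes_on_def by blast
      ultimately have "gradient p ?x = - (hom_lift 4 v.x_residual ?x *\<^sub>R ?x + hom_lift 3 v.e_residual ?x *\<^sub>R axis 3 1)"
        by (simp add: add_eq_0_iff)
      then have g: "gradient p ?x \<bullet> e_phi \<theta> \<phi> = 0"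
        by (simp add: inner_add_left inner_3 axis_def spherical_point_def)
      let ?D = "frechet_derivative p (at ?x)"
      have p: "(p has_derivative ?D) (at ?x)" using du(3)[OF x(2)] by (simp add: frechet_derivative_works)
      then interpret D: bounded_linear ?D by (rule has_derivative_bounded_linear)
      have "?D (e_phi \<theta> \<phi>) = ?D ((- sin \<phi>) *\<^sub>R axis 1 1 + cos \<phi> *\<^sub>R axis 2 1)"
        by (rule arg_cong[of _ _ ?D]) (simp add: vec_eq_iff forall_3 axis_def)
      also have "\<dots> = gradient p ?x \<bullet> e_phi \<theta> \<phi>"
        by (simp only: D.add D.scaleR inner_3 gradient_def partial_deriv_def) simp
      finally have z: "?D (e_phi \<theta> \<phi>) = 0" using g by simp
      have sp: "spherical_point 1 \<theta> \<phi> = (sin \<theta> * cos \<phi>) *\<^sub>R axis 1 1 + (sin \<theta> * sin \<phi>) *\<^sub>R axis 2 1 + cos \<theta> *\<^sub>R axis 3 1" for \<phi>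
        by (simp add: vec_eq_iff forall_3 axis_def spherical_point_def)
      have "((\<lambda>\<phi>. spherical_point 1 \<theta> \<phi>) has_derivative (\<lambda>h. h *\<^sub>R (sin \<theta> *\<^sub>R e_phi \<theta> \<phi>))) (at \<phi>)"
        unfolding sp by (rule has_derivative_eq_rhs, (rule derivative_intros)+)
          (simp add: vec_eq_iff forall_3 axis_def fun_eq_iff)
      from has_derivative_compose[OF this p] show ?thesis
        unfolding has_field_derivative_def D.scaleR z by (rule has_derivative_eq_rhs) (simp add: fun_eq_iff)
    qed
    then have "p (spherical_point 1 \<theta> \<phi>) = p (spherical_point 1 \<theta> 0)"
      using DERIV_isconst_all by blast
    then show ?thesis unfolding P_def meridian_spherical[OF t] .
  qed
  have p: "p x = hom_lift 2 P x" if x: "x \<in> off_axis" for x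
  proof (rule off_axis_cases[OF x])
    fix r \<theta> \<phi>
    assume r: "r > 0" and t: "0 < \<theta>" "\<theta> < pi" and xs: "x = spherical_point r \<theta> \<phi>"
      and c: "cos_polar x = cos \<theta>" and n: "norm x = r"
    have "p (r *\<^sub>R spherical_point 1 \<theta> \<phi>) = (r powi -2) *\<^sub>R p (spherical_point 1 \<theta> \<phi>)"
      using hp sphere[OF t] r unfolding homogeneous_on_def by blast
    then show ?thesis
      unfolding hom_lift_def c n p_sphere[OF t] unfolding xs spherical_point_scale[of r]
      by (simp add: power_int_minus divide_inverse mult.commute)
  qed
  have "axial_flow off_axis A A1 A2 G G1 G2 P (deriv P) u p"
    by unfold_locales (use q dP u p ns in auto)
  then show thesis
  proof (rule that)
    show "A t = u (meridian t) $ 1 / sqrt (1 - t\<^sup>2)" for t by (simp add: A_def divide_inverse)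
    show "t * A t - G t = u (meridian t) $ 3" for t by (simp add: G_def)
  qed
qed

text \<open>A curve through the pole joins the meridians \<phi> = 0 and \<phi> = \<pi>. Axisymmetry
  makes \<open>u_1\<close> odd along it, so \<open>u_1\<close> vanishes at the pole and its quotient
  by sin \<theta> tends to a derivative of \<open>u\<close>.\<close>

lemma north_pole_limits:
  assumes sol: "homogeneous_axisymmetric_noswirl_C2_solution u p"
  obtains l m where "((\<lambda>t. u (meridian t) $ 1 / sqrt (1 - t\<^sup>2)) \<longlongrightarrow> l) (at_left 1)"
    "((\<lambda>t. u (meridian t) $ 3) \<longlongrightarrow> m) (at_left 1)"
proof -
  have ax: "axisymmetric u" and ns: "navier_stokes_on slit_space u p"
    using sol unfolding homogeneous_axisymmetric_noswirl_C2_solution_def by blast+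
  define N :: "real^3" where "N = axis 3 1"
  have "N \<in> slit_space" by (simp add: slit_space_def N_def axis_def)
  then have du: "(u has_derivative frechet_derivative u (at N)) (at N)"
    using ns unfolding navier_stokes_on_def by (simp add: frechet_derivative_works)
  define C where "C \<theta> = sin \<theta> *\<^sub>R axis 1 1 + cos \<theta> *\<^sub>R (axis 3 1 :: real^3)" for \<theta> :: real
  have C0: "C 0 = N" by (simp add: C_def N_def)
  have dC: "(C has_derivative (\<lambda>h. h *\<^sub>R axis 1 1)) (at 0)"
    unfolding C_def[abs_def] by (rule has_derivative_eq_rhs, (rule derivative_intros)+) (simp add: fun_eq_iff)
  have "((\<lambda>\<theta>. u (C \<theta>) $ j) has_derivative (\<lambda>h. frechet_derivative u (at N) (h *\<^sub>R axis 1 1) $ j)) (at 0)" for j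
    by (rule bounded_linear.has_derivative[OF bounded_linear_vec_nth], rule has_derivative_compose[OF dC])
      (simp add: C0 du)
  then have d: "((\<lambda>\<theta>. u (C \<theta>) $ j) has_real_derivative frechet_derivative u (at N) (axis 1 1) $ j) (at 0)" for j
    using linear_scale[OF has_derivative_linear[OF du]]
    by (simp add: has_field_derivative_def mult.commute[of _ "_ $ _"])
  have Cs: "C \<theta> = spherical_point 1 \<theta> 0" for \<theta>
    by (simp add: C_def vec_eq_iff forall_3 axis_def spherical_point_def)
  have Cm: "C (- \<theta>) = spherical_point 1 \<theta> pi" for \<theta>
    by (simp add: C_def vec_eq_iff forall_3 axis_def spherical_point_def)
  have odd: "u (C (- \<theta>)) $ 1 = - u (C \<theta>) $ 1" if t: "0 < \<theta>" "\<theta> < pi" for \<theta>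
  proof -
    have "u (C (- \<theta>)) \<bullet> e_r \<theta> pi = u (C \<theta>) \<bullet> e_r \<theta> 0" "u (C (- \<theta>)) \<bullet> e_theta \<theta> pi = u (C \<theta>) \<bullet> e_theta \<theta> 0"
      unfolding Cm unfolding Cs by (rule axisymmetricD[OF ax zero_less_one t])+
    then have e: "- sin \<theta> * u (C (- \<theta>)) $ 1 + cos \<theta> * u (C (- \<theta>)) $ 3 = sin \<theta> * u (C \<theta>) $ 1 + cos \<theta> * u (C \<theta>) $ 3"
      "- cos \<theta> * u (C (- \<theta>)) $ 1 - sin \<theta> * u (C (- \<theta>)) $ 3 = cos \<theta> * u (C \<theta>) $ 1 - sin \<theta> * u (C \<theta>) $ 3"
      by (simp_all add: inner_3 mult.commute)
    have "a = - b" if "c * c = 1 - s * s" "- s * a + c * a' = s * b + c * b'" "- c * a - s * a' = c * b - s * b'"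
      for a a' b b' s c :: real using that by algebra
    from this[OF cos_sq e] show ?thesis .
  qed
  have cont: "((\<lambda>\<theta>. u (C \<theta>) $ j) \<longlongrightarrow> u N $ j) (at 0)" for j
    using DERIV_isCont[OF d[of j]] unfolding isCont_def C0 .
  have ev: "\<forall>\<^sub>F \<theta> in at_right 0. 0 < \<theta> \<and> \<theta> < pi"
    using eventually_at_right_real[OF pi_gt_zero] by simp
  have r: "((\<lambda>\<theta>. u (C \<theta>) $ j) \<longlongrightarrow> u N $ j) (at_right 0)" "((\<lambda>\<theta>. u (C \<theta>) $ j) \<longlongrightarrow> u N $ j) (at_left 0)" for j
    using cont[of j] by (simp_all add: filterlim_at_split)
  have "filterlim uminus (at_left 0) (at_right (0::real))"
    by (simp add: at_left_minus filterlim_def filtermap_filtermap)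
  from filterlim_compose[OF r(2)[of 1] this]
  have "((\<lambda>\<theta>. u (C (- \<theta>)) $ 1) \<longlongrightarrow> u N $ 1) (at_right 0)" .
  then have "((\<lambda>\<theta>. - u (C \<theta>) $ 1) \<longlongrightarrow> u N $ 1) (at_right 0)"
    by (rule Lim_transform_eventually, intro eventually_mono[OF ev]) (simp add: odd)
  from tendsto_unique[OF trivial_limit_at_right_real this tendsto_minus[OF r(1)[of 1]]]
  have u1: "u N $ 1 = 0" by simp
  define l where "l = frechet_derivative u (at N) (axis 1 1) $ 1"
  have "((\<lambda>h. (u (C (0 + h)) $ 1 - u (C 0) $ 1) / h) \<longlongrightarrow> l) (at 0)"
    using d[of 1] unfolding DERIV_def l_def .
  then have "((\<lambda>h. u (C h) $ 1 / h) \<longlongrightarrow> l) (at_right 0)"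
    unfolding C0 u1 by (simp add: filterlim_at_split)
  moreover have "((\<lambda>h::real. sin h / h) \<longlongrightarrow> 1) (at_right 0)"
    using DERIV_sin[of "0 :: real"] unfolding DERIV_def filterlim_at_split by simp
  \<comment> \<open>Exchanges the divisor h for sin h, which is \<open>sqrt (1 - t\<^sup>2)\<close>
    on the meridian.\<close>
  ultimately have "((\<lambda>h. (u (C h) $ 1 / h) / (sin h / h)) \<longlongrightarrow> l / 1) (at_right 0)"
    by (rule tendsto_divide) simp
  then have "((\<lambda>\<theta>. u (C \<theta>) $ 1 / sin \<theta>) \<longlongrightarrow> l) (at_right 0)"
    unfolding div_by_1 by (rule Lim_transform_eventually, intro eventually_mono[OF ev]) simp
  from filterlim_compose[OF this arccos_at_left_1]
  have l1: "((\<lambda>t. u (C (arccos t)) $ 1 / sin (arccos t)) \<longlongrightarrow> l) (at_left 1)" .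
  from filterlim_compose[OF r(1)[of 3] arccos_at_left_1]
  have l3: "((\<lambda>t. u (C (arccos t)) $ 3) \<longlongrightarrow> u N $ 3) (at_left 1)" .
  have eq: "C (arccos t) = meridian t" "sin (arccos t) = sqrt (1 - t\<^sup>2)" if "-1 < t" "t < 1" for t
    using that by (simp_all add: C_def meridian_def sin_arccos)
  show thesis
  proof (rule that)
    show "((\<lambda>t. u (meridian t) $ 1 / sqrt (1 - t\<^sup>2)) \<longlongrightarrow> l) (at_left 1)"
      by (rule Lim_transform_eventually[OF l1], rule eventually_mono[OF at_left_1_interval]) (simp add: eq)
    show "((\<lambda>t. u (meridian t) $ 3) \<longlongrightarrow> u N $ 3) (at_left 1)"
      by (rule Lim_transform_eventually[OF l3], rule eventually_mono[OF at_left_1_interval]) (simp add: eq)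
  qed
qed

text \<open>For W = (1 + t) G the first integral is the Riccati equation, and the limit of
  \<open>G\<close> supplies its value at the pole. The pressure comes along through
  \<open>corresponding\<close>.\<close>

lemma classification:
  assumes sol: "homogeneous_axisymmetric_noswirl_C2_solution u p"
  obtains \<tau> \<sigma> where "(\<tau>, \<sigma>) \<in> J1 \<union> J2 \<union> J3" "corresponding_pair (explicit_profile \<tau> \<sigma>) u p"
proof -
  obtain A A1 A2 G G1 G2 P P1 where flow: "axial_flow off_axis A A1 A2 G G1 G2 P P1 u p"
    and A: "\<And>t. -1 < t \<Longrightarrow> t < 1 \<Longrightarrow> A t = u (meridian t) $ 1 / sqrt (1 - t\<^sup>2)"
    and G: "\<And>t. t * A t - G t = u (meridian t) $ 3" by (rule axisymmetric_flow[OF sol]) blast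
  interpret axial_flow off_axis A A1 A2 G G1 G2 P P1 u p by (rule flow)
  obtain l m where lm: "((\<lambda>t. u (meridian t) $ 1 / sqrt (1 - t\<^sup>2)) \<longlongrightarrow> l) (at_left 1)"
    "((\<lambda>t. u (meridian t) $ 3) \<longlongrightarrow> m) (at_left 1)" using north_pole_limits[OF sol] .
  have A_lim: "(A \<longlongrightarrow> l) (at_left 1)"
    by (rule Lim_transform_eventually[OF lm(1)], rule eventually_mono[OF at_left_1_interval]) (simp add: A)
  have G_lim: "((\<lambda>t. t * A t - G t) \<longlongrightarrow> m) (at_left 1)" unfolding G by (rule lm(2))
  obtain c where c: "\<And>t. -1 < t \<Longrightarrow> t < 1 \<Longrightarrow> (1 + t)\<^sup>2 * (G1 t + (G t)\<^sup>2 / 2) = c"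
    and g: "(G \<longlongrightarrow> l - m) (at_left 1)" by (rule first_integral[OF A_lim G_lim]) blast
  define W where "W t = (1 + t) * G t" for t
  have dW: "(W has_real_derivative (c + W t - (W t)\<^sup>2 / 2) / (1 + t)) (at t)" if t: "-1 < t" "t < 1" for t
  proof -
    have "(W has_real_derivative G t + (1 + t) * G1 t) (at t)"
      unfolding W_def[abs_def] using interval_derivs(3)[OF t] by (auto intro!: derivative_eq_intros)
    moreover have "c + W t - (W t)\<^sup>2 / 2 = (G t + (1 + t) * G1 t) * (1 + t)"
      unfolding c[OF t, symmetric] W_def by (simp add: field_simps power2_eq_square)
    ultimately show ?thesis using t by simp
  qed
  have "(W \<longlongrightarrow> (1 + 1) * (l - m)) (at_left 1)"
    unfolding W_def[abs_def] by (intro tendsto_intros g)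
  then obtain \<tau> \<sigma> where J: "(\<tau>, \<sigma>) \<in> J1 \<union> J2 \<union> J3"
    and W: "\<And>t. -1 < t \<Longrightarrow> t < 1 \<Longrightarrow> W t = explicit_W \<tau> \<sigma> t" using riccati_explicit[OF dW] by blast
  have "corresponding_pair (explicit_profile \<tau> \<sigma>) u p"
  proof (rule corresponding)
    show "homogeneous_on slit_space (-1) u" "homogeneous_on slit_space (-2) p"
      using sol unfolding homogeneous_axisymmetric_noswirl_C2_solution_def by blast+
    fix \<theta> :: real assume t: "0 < \<theta>" "\<theta> < pi"
    show "explicit_profile \<tau> \<sigma> \<theta> = G (cos \<theta>) * sin \<theta>"
      using W[OF cos_in_open_interval[OF t]] cos_in_open_interval[OF t]
      unfolding explicit_profile_W half_angle_ratio[OF t] W_def by (simp add: field_simps)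
  qed
  with J show thesis by (rule that)
qed

lemma corresponding_pair_profile:
  assumes "corresponding_pair v u p" "corresponding_pair w u p" "0 < \<theta>" "\<theta> < pi"
  shows "v \<theta> = w \<theta>"
proof -
  have "v \<theta> = u (spherical_point 1 \<theta> 0) \<bullet> e_theta \<theta> 0" if "corresponding_pair v u p" for v
    using corresponding_pair_value(1)[OF that zero_less_one assms(3,4), of 0]
    by (simp add: inner_add_left frame_inner)
  with assms show ?thesis by metis
qed

text \<open>The classification gives some parameters in the admissible set; uniqueness of the two
  limits identifies them with \<tau> and \<sigma>.\<close>

lemma solution_profile_explicit:
  assumes sol: "is_solution_profile \<tau> \<sigma> v" and t: "0 < \<theta>" "\<theta> < pi"
  shows "v \<theta> = explicit_profile \<tau> \<sigma> \<theta>"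
proof -
  obtain u p where cp: "corresponding_pair v u p" using sol unfolding is_solution_profile_def by blast
  obtain \<tau>' \<sigma>' where J: "(\<tau>', \<sigma>') \<in> J1 \<union> J2 \<union> J3" and cp': "corresponding_pair (explicit_profile \<tau>' \<sigma>') u p"
    using classification[OF corresponding_pair_solution[OF sol cp]] .
  have v: "v \<theta> = explicit_profile \<tau>' \<sigma>' \<theta>" if "0 < \<theta>" "\<theta> < pi" for \<theta>
    using corresponding_pair_profile[OF cp cp' that] .
  have "((\<lambda>\<theta>. v \<theta> * sin \<theta>) \<longlongrightarrow> \<tau>) (at_left pi)" "((\<lambda>\<theta>. v \<theta> / sin \<theta>) \<longlongrightarrow> \<sigma>) (at_right 0)"
    using sol unfolding is_solution_profile_def by blast+
  with explicit_profile_limits[OF J v] have "\<tau> = \<tau>'" "\<sigma> = \<sigma>'"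
    using tendsto_unique[OF trivial_limit_at_left_real] tendsto_unique[OF trivial_limit_at_right_real] by blast+
  then show ?thesis using v[OF t] by simp
qed

text \<open>A profile matters only on (0, \<pi>), so uniqueness is stated among
  \<open>extensional\<close> functions, which have a fixed default value elsewhere.\<close>

theorem theorem1p1:
  shows "(\<forall>\<tau> \<sigma>. (\<tau>, \<sigma>) \<in> J1 \<union> J2 \<union> J3 \<longrightarrow>
            (\<exists>!v. v \<in> extensional {0<..<pi} \<and> is_solution_profile \<tau> \<sigma> v))
    \<and> (\<forall>u p. homogeneous_axisymmetric_noswirl_C2_solution u p \<longleftrightarrow>
            (\<exists>\<tau> \<sigma> v. (\<tau>, \<sigma>) \<in> J1 \<union> J2 \<union> J3 \<and>
               is_solution_profile \<tau> \<sigma> v \<and> corresponding_pair v u p))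
    \<and> (\<forall>\<tau> \<sigma> v. (\<tau>, \<sigma>) \<in> J1 \<union> J2 \<union> J3 \<and> is_solution_profile \<tau> \<sigma> v \<longrightarrow>
            (\<forall>\<theta>\<in>{0<..<pi}. v \<theta> = explicit_profile \<tau> \<sigma> \<theta>))"
proof (intro conjI allI impI ballI)
  fix \<tau> \<sigma> assume J: "(\<tau>, \<sigma>) \<in> J1 \<union> J2 \<union> J3"
  show "\<exists>!v. v \<in> extensional {0<..<pi} \<and> is_solution_profile \<tau> \<sigma> v"
  proof (rule ex_ex1I)
    show "\<exists>v. v \<in> extensional {0<..<pi} \<and> is_solution_profile \<tau> \<sigma> v"
      by (intro exI[of _ "restrict (explicit_profile \<tau> \<sigma>) {0<..<pi}"] conjI explicit_solution[OF J]) simp_all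
  next
    fix v w
    assume "v \<in> extensional {0<..<pi} \<and> is_solution_profile \<tau> \<sigma> v"
      "w \<in> extensional {0<..<pi} \<and> is_solution_profile \<tau> \<sigma> w"
    then show "v = w"
      by (intro extensionalityI[of v "{0<..<pi}" w]) (auto simp: solution_profile_explicit)
  qed
next
  fix u p
  show "homogeneous_axisymmetric_noswirl_C2_solution u p \<longleftrightarrow>
    (\<exists>\<tau> \<sigma> v. (\<tau>, \<sigma>) \<in> J1 \<union> J2 \<union> J3 \<and> is_solution_profile \<tau> \<sigma> v \<and> corresponding_pair v u p)"
  proof
    assume "homogeneous_axisymmetric_noswirl_C2_solution u p"
    then show "\<exists>\<tau> \<sigma> v. (\<tau>, \<sigma>) \<in> J1 \<union> J2 \<union> J3 \<and> is_solution_profile \<tau> \<sigma> v \<and> corresponding_pair v u p"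
      using classification explicit_solution by metis
  next
    assume "\<exists>\<tau> \<sigma> v. (\<tau>, \<sigma>) \<in> J1 \<union> J2 \<union> J3 \<and> is_solution_profile \<tau> \<sigma> v \<and> corresponding_pair v u p"
    then show "homogeneous_axisymmetric_noswirl_C2_solution u p"
      using corresponding_pair_solution by blast
  qed
next
  fix \<tau> \<sigma> v \<theta>
  assume "(\<tau>, \<sigma>) \<in> J1 \<union> J2 \<union> J3 \<and> is_solution_profile \<tau> \<sigma> v" "\<theta> \<in> {0<..<pi}"
  then show "v \<theta> = explicit_profile \<tau> \<sigma> \<theta>" using solution_profile_explicit by simp
qed

end
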